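(* Let $R$ be a Noetherian ring, let $M$ be a finitely generated $R$-module, and let $g: M \to G$ be an $R$-linear map to a free $R$-module $G$ inducing an inclusion on the torsionless quotient of $M$. The kernel of the natural epimorphism $\mathcal{R}(M)\to \mathcal{R}(g)$ is nilpotent.
   Context: All rings are commutative with identity. $\mathrm{Sym}(M)$ is the symmetric algebra of the $R$-module $M$; an $R$-linear map $g:M\to N$ induces a graded $R$-algebra map $\mathrm{Sym}(g):\mathrm{Sym}(M)\to\mathrm{Sym}(N)$. The Rees algebra of the map $g$, denoted $\mathcal{R}(g)$, is the graded $R$-algebra which is the image of $\mathrm{Sym}(g)$. The Rees algebra of the module $M$ is $\mathcal{R}(M)=\mathrm{Sym}(M)/\bigcap_g L_g$, where the intersection is over all $R$-linear maps $g$ from $M$ to free $R$-modules and $L_g=\ker \mathrm{Sym}(g)$. For any $g$ from $M$ to a free module there is a natural surjection $\mathcal{R}(M)\to\mathcal{R}(g)=\mathrm{Sym}(M)/L_g$. The torsionless quotient of $M$ is the image of the natural map from $M$ to its double dual $M^{**}$, where $M^*=\mathrm{Hom}_R(M,R)$; every map from $M$ to a free module factors uniquely through it. *)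

theory Defs
  imports "HOL-Algebra.Algebra"
begin

section \<open>Modules\<close>

text \<open>The fields \<open>mult\<close> and \<open>one\<close> that a module record inherits from rings carry no
  information and are left undefined in the modules constructed below.\<close>

definition mod_hom ::
  "('r, 'x) ring_scheme \<Rightarrow> ('r, 'm, 'y) module_scheme \<Rightarrow> ('r, 'n, 'z) module_scheme \<Rightarrow> ('m \<Rightarrow> 'n) set"
  where "mod_hom R M N =
    {f \<in> carrier M \<rightarrow> carrier N.
       (\<forall>x\<in>carrier M. \<forall>y\<in>carrier M. f (x \<oplus>\<^bsub>M\<^esub> y) = f x \<oplus>\<^bsub>N\<^esub> f y) \<and>
       (\<forall>a\<in>carrier R. \<forall>x\<in>carrier M. f (a \<odot>\<^bsub>M\<^esub> x) = a \<odot>\<^bsub>N\<^esub> f x)}"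

definition finitely_generated_module ::
  "('r, 'x) ring_scheme \<Rightarrow> ('r, 'm, 'y) module_scheme \<Rightarrow> bool"
  where "finitely_generated_module R M \<longleftrightarrow>
    (\<exists>S\<subseteq>carrier M. finite S \<and> (\<forall>N. submodule N R M \<and> S \<subseteq> N \<longrightarrow> N = carrier M))"

definition is_module_basis ::
  "('r, 'x) ring_scheme \<Rightarrow> ('r, 'm, 'y) module_scheme \<Rightarrow> 'm set \<Rightarrow> bool"
  where "is_module_basis R F B \<longleftrightarrow> B \<subseteq> carrier F \<and>
    (\<forall>x\<in>carrier F. \<exists>!c. c \<in> B \<rightarrow>\<^sub>E carrier R \<and> finite {b\<in>B. c b \<noteq> \<zero>\<^bsub>R\<^esub>} \<and>
       x = (\<Oplus>\<^bsub>F\<^esub>b\<in>{b\<in>B. c b \<noteq> \<zero>\<^bsub>R\<^esub>}. c b \<odot>\<^bsub>F\<^esub> b))"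

definition free_module :: "('r, 'x) ring_scheme \<Rightarrow> ('r, 'm, 'y) module_scheme \<Rightarrow> bool"
  where "free_module R F \<longleftrightarrow> module R F \<and> (\<exists>B. is_module_basis R F B)"

definition dual_module ::
  "('r, 'x) ring_scheme \<Rightarrow> ('r, 'm, 'y) module_scheme \<Rightarrow> ('r, 'm \<Rightarrow> 'r) module"
  where "dual_module R M =
    \<lparr>carrier = mod_hom R M \<lparr>carrier = carrier R, monoid.mult = monoid.mult R, one = one R, ring.zero = ring.zero R,
                            add = add R, smult = monoid.mult R\<rparr> \<inter> extensional (carrier M),
     monoid.mult = undefined, one = undefined,
     ring.zero = (\<lambda>x\<in>carrier M. \<zero>\<^bsub>R\<^esub>),
     add = (\<lambda>\<phi> \<psi>. \<lambda>x\<in>carrier M. \<phi> x \<oplus>\<^bsub>R\<^esub> \<psi> x),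
     smult = (\<lambda>a \<phi>. \<lambda>x\<in>carrier M. a \<otimes>\<^bsub>R\<^esub> \<phi> x)\<rparr>"

definition to_bidual ::
  "('r, 'x) ring_scheme \<Rightarrow> ('r, 'm, 'y) module_scheme \<Rightarrow> 'm \<Rightarrow> ('m \<Rightarrow> 'r) \<Rightarrow> 'r"
  where "to_bidual R M x = (\<lambda>\<phi>\<in>carrier (dual_module R M). \<phi> x)"

definition torsionless_quotient ::
  "('r, 'x) ring_scheme \<Rightarrow> ('r, 'm, 'y) module_scheme \<Rightarrow> ('r, ('m \<Rightarrow> 'r) \<Rightarrow> 'r) module"
  where "torsionless_quotient R M =
    (dual_module R (dual_module R M))\<lparr>carrier := to_bidual R M ` carrier M\<rparr>"

text \<open>\<open>g\<close> factors through the surjection of \<open>M\<close> onto its torsionless quotient (in at most one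
  way), and the resulting map is injective.\<close>

definition induces_inclusion_on_torsionless_quotient ::
  "('r, 'x) ring_scheme \<Rightarrow> ('r, 'm, 'y) module_scheme \<Rightarrow> ('r, 'n, 'z) module_scheme \<Rightarrow> ('m \<Rightarrow> 'n) \<Rightarrow> bool"
  where "induces_inclusion_on_torsionless_quotient R M G g \<longleftrightarrow>
    (\<exists>g' \<in> mod_hom R (torsionless_quotient R M) G.
       (\<forall>x\<in>carrier M. g' (to_bidual R M x) = g x) \<and>
       inj_on g' (carrier (torsionless_quotient R M)))"


section \<open>Polynomial rings and symmetric algebras\<close>

text \<open>The polynomial ring over \<open>R\<close> in the variables \<open>I\<close>; a polynomial sends a monomial, i.e. a
  multiset of variables, to its coefficient.\<close>

definition poly_ring :: "('r, 'x) ring_scheme \<Rightarrow> 'i set \<Rightarrow> ('i multiset \<Rightarrow> 'r) ring"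
  where "poly_ring R I =
    \<lparr>carrier = ring.indexed_pset R I (carrier R),
     monoid.mult = (\<lambda>p q u. \<Oplus>\<^bsub>R\<^esub>v\<in>{v. v \<subseteq># u}. p v \<otimes>\<^bsub>R\<^esub> q (u - v)),
     one = ring.indexed_const R \<one>\<^bsub>R\<^esub>,
     ring.zero = ring.indexed_const R \<zero>\<^bsub>R\<^esub>,
     add = ring.indexed_padd R\<rparr>"

text \<open>The \<open>R\<close>-algebra map between polynomial rings that sends each variable \<open>i\<close> to \<open>g i\<close>.\<close>

definition poly_rename ::
  "('r, 'x) ring_scheme \<Rightarrow> ('i \<Rightarrow> 'j) \<Rightarrow> ('i multiset \<Rightarrow> 'r) \<Rightarrow> 'j multiset \<Rightarrow> 'r"
  where "poly_rename R g p = (\<lambda>v. \<Oplus>\<^bsub>R\<^esub>u\<in>{u. p u \<noteq> \<zero>\<^bsub>R\<^esub> \<and> image_mset g u = v}. p u)"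

definition sym_ideal ::
  "('r, 'x) ring_scheme \<Rightarrow> ('r, 'm, 'y) module_scheme \<Rightarrow> ('m multiset \<Rightarrow> 'r) set"
  where "sym_ideal R M = (let P = poly_ring R (carrier M); \<xi> = ring.indexed_var R in
    Idl\<^bsub>P\<^esub> ({\<xi> (x \<oplus>\<^bsub>M\<^esub> y) \<ominus>\<^bsub>P\<^esub> (\<xi> x \<oplus>\<^bsub>P\<^esub> \<xi> y) | x y. x \<in> carrier M \<and> y \<in> carrier M} \<union>
         {\<xi> (a \<odot>\<^bsub>M\<^esub> x) \<ominus>\<^bsub>P\<^esub> (ring.indexed_const R a \<otimes>\<^bsub>P\<^esub> \<xi> x) | a x. a \<in> carrier R \<and> x \<in> carrier M}))"

definition sym_algebra ::
  "('r, 'x) ring_scheme \<Rightarrow> ('r, 'm, 'y) module_scheme \<Rightarrow> ('m multiset \<Rightarrow> 'r) set ring"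
  where "sym_algebra R M = poly_ring R (carrier M) Quot sym_ideal R M"

definition sym_map ::
  "('r, 'x) ring_scheme \<Rightarrow> ('r, 'n, 'z) module_scheme \<Rightarrow> ('m \<Rightarrow> 'n) \<Rightarrow>
   ('m multiset \<Rightarrow> 'r) set \<Rightarrow> ('n multiset \<Rightarrow> 'r) set"
  where "sym_map R N g C =
    the_elem ((\<lambda>p. sym_ideal R N +>\<^bsub>poly_ring R (carrier N)\<^esub> poly_rename R g p) ` C)"


section \<open>Rees algebras\<close>

definition sym_kernel ::
  "('r, 'x) ring_scheme \<Rightarrow> ('r, 'm, 'y) module_scheme \<Rightarrow> ('r, 'n, 'z) module_scheme \<Rightarrow> ('m \<Rightarrow> 'n) \<Rightarrow>
   ('m multiset \<Rightarrow> 'r) set set"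
  where "sym_kernel R M N g = a_kernel (sym_algebra R M) (sym_algebra R N) (sym_map R N g)"

definition rees_algebra_of_map ::
  "('r, 'x) ring_scheme \<Rightarrow> ('r, 'm, 'y) module_scheme \<Rightarrow> ('r, 'n, 'z) module_scheme \<Rightarrow> ('m \<Rightarrow> 'n) \<Rightarrow>
   ('n multiset \<Rightarrow> 'r) set ring"
  where "rees_algebra_of_map R M N g =
    (sym_algebra R N)\<lparr>carrier := sym_map R N g ` carrier (sym_algebra R M)\<rparr>"

text \<open>The intersection of the kernels of \<open>Sym(h)\<close> over all \<open>R\<close>-linear maps \<open>h\<close> from \<open>M\<close> to free
  modules. HOL cannot quantify over all types inside a definition, so \<open>F\<close> ranges over the free
  modules whose elements are of type \<^typ>\<open>nat \<Rightarrow> 'r\<close>; up to isomorphism these include all \<open>R\<^sup>n\<close>.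
  The lemma \<open>cring.rees_ideal_subset_sym_kernel\<close> below shows that free modules over any other type
  would not make the intersection smaller.\<close>

definition rees_ideal ::
  "('r, 'x) ring_scheme \<Rightarrow> ('r, 'm, 'y) module_scheme \<Rightarrow> ('m multiset \<Rightarrow> 'r) set set"
  where "rees_ideal R M =
    \<Inter>{sym_kernel R M F h | (F :: ('r, nat \<Rightarrow> 'r) module) h. free_module R F \<and> h \<in> mod_hom R M F}"

definition rees_algebra ::
  "('r, 'x) ring_scheme \<Rightarrow> ('r, 'm, 'y) module_scheme \<Rightarrow> ('m multiset \<Rightarrow> 'r) set set ring"
  where "rees_algebra R M = sym_algebra R M Quot rees_ideal R M"

text \<open>The map from the Rees algebra of \<open>M\<close> to that of \<open>g : M \<rightarrow> N\<close> that is induced by \<open>Sym(g)\<close>.\<close>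

definition rees_natural_map ::
  "('r, 'x) ring_scheme \<Rightarrow> ('r, 'n, 'z) module_scheme \<Rightarrow> ('m \<Rightarrow> 'n) \<Rightarrow>
   ('m multiset \<Rightarrow> 'r) set set \<Rightarrow> ('n multiset \<Rightarrow> 'r) set"
  where "rees_natural_map R N g C = the_elem (sym_map R N g ` C)"

definition nilpotent_ideal :: "('a, 'x) ring_scheme \<Rightarrow> 'a set \<Rightarrow> bool"
  where "nilpotent_ideal A I \<longleftrightarrow> (\<exists>n::nat. I [^]\<^bsub>ideals_set A\<^esub> n = {\<zero>\<^bsub>A\<^esub>})"

section \<open>Well-definedness of the constructions\<close>

text \<open>These facts are not needed to state the theorem. They show that polynomial rings, symmetric
  algebras and Rees algebras are commutative rings, that \<open>Sym(g)\<close> is a well-defined ring map, that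
  the bound on the types of free modules in \<^const>\<open>rees_ideal\<close> is harmless, and that the natural map
  is a well-defined epimorphism.\<close>

context cring begin

abbreviation "PR I \<equiv> poly_ring R I"

lemma poly_ring_simps:
  "carrier (PR I) = indexed_pset I (carrier R)"
  "\<zero>\<^bsub>PR I\<^esub> = indexed_const \<zero>"
  "\<one>\<^bsub>PR I\<^esub> = indexed_const \<one>"
  "p \<oplus>\<^bsub>PR I\<^esub> q = indexed_padd p q"
  by (simp_all add: poly_ring_def)

lemma poly_ring_mult: "(p \<otimes>\<^bsub>PR I\<^esub> q) u = (\<Oplus>v\<in>{v. v \<subseteq># u}. p v \<otimes> q (u - v))"
  by (simp add: poly_ring_def)

lemma finite_submsets: "finite {v. v \<subseteq># (u::'c multiset)}"
proof (induction u)
  case empty then show ?case by simp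
next
  case (add x u)
  have "{v. v \<subseteq># add_mset x u} \<subseteq> {v. v \<subseteq># u} \<union> add_mset x ` {v. v \<subseteq># u}"
  proof
    fix v assume "v \<in> {v. v \<subseteq># add_mset x u}"
    then have v: "v \<subseteq># add_mset x u" by simp
    show "v \<in> {v. v \<subseteq># u} \<union> add_mset x ` {v. v \<subseteq># u}"
    proof (cases "x \<in># v")
      case True
      then obtain w where "v = add_mset x w" by (meson multi_member_split)
      then show ?thesis using v by auto
    next
      case False
      then have "v \<subseteq># u" using v
        by (metis diff_single_trivial subset_eq_diff_conv add_mset_add_single)
      then show ?thesis by simp
    qed
  qed
  then show ?case using add by (meson finite_UnI finite_imageI finite_subset)
qed

lemma pcoeff: "p \<in> carrier (PR I) \<Longrightarrow> p u \<in> carrier R"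
  using indexed_pset_in_carrier[of "carrier R" p I] by (simp add: poly_ring_simps carrier_coeff_def)

lemma mult_const: 
  assumes "k \<in> carrier R" "\<And>u. q u \<in> carrier R"
  shows "indexed_const k \<otimes>\<^bsub>PR I\<^esub> q = (\<lambda>u. k \<otimes> q u)"
proof
  fix u
  have "(indexed_const k \<otimes>\<^bsub>PR I\<^esub> q) u = (\<Oplus>v\<in>{v. v \<subseteq># u}. if {#} = v then k \<otimes> q u else \<zero>)"
    unfolding poly_ring_mult using assms
    by (intro finsum_cong') (auto simp: indexed_const_def)
  also have "\<dots> = k \<otimes> q u"
    using assms by (subst add.finprod_singleton[where f = "\<lambda>_. k \<otimes> q u"]) (auto simp: finite_submsets)
  finally show "(indexed_const k \<otimes>\<^bsub>PR I\<^esub> q) u = k \<otimes> q u" .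
qed

lemma mult_padd:
  assumes "\<And>u. p u \<in> carrier R" "\<And>u. p' u \<in> carrier R" "\<And>u. q u \<in> carrier R"
  shows "indexed_padd p p' \<otimes>\<^bsub>PR I\<^esub> q = indexed_padd (p \<otimes>\<^bsub>PR I\<^esub> q) (p' \<otimes>\<^bsub>PR I\<^esub> q)"
proof
  fix u
  show "(indexed_padd p p' \<otimes>\<^bsub>PR I\<^esub> q) u = (indexed_padd (p \<otimes>\<^bsub>PR I\<^esub> q) (p' \<otimes>\<^bsub>PR I\<^esub> q)) u"
    unfolding poly_ring_mult indexed_padd_def using assms 
    by (subst finsum_addf[symmetric]) (auto simp: l_distr)
qed

lemma mult_pmult:
  assumes "\<And>u. p u \<in> carrier R" "\<And>u. q u \<in> carrier R"
  shows "indexed_pmult p i \<otimes>\<^bsub>PR I\<^esub> q = indexed_pmult (p \<otimes>\<^bsub>PR I\<^esub> q) i"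
proof
  fix u
  show "(indexed_pmult p i \<otimes>\<^bsub>PR I\<^esub> q) u = (indexed_pmult (p \<otimes>\<^bsub>PR I\<^esub> q) i) u"
  proof (cases "i \<in># u")
    case False
    then have "\<And>v. v \<subseteq># u \<Longrightarrow> i \<notin># v" by (meson mset_subset_eqD)
    then have "(indexed_pmult p i \<otimes>\<^bsub>PR I\<^esub> q) u = (\<Oplus>v\<in>{v. v \<subseteq># u}. \<zero>)"
      unfolding poly_ring_mult indexed_pmult_def using assms by (intro finsum_cong') auto
    then show ?thesis using False by (simp add: indexed_pmult_def)
  next
    case True
    then obtain w where w: "u = add_mset i w" by (meson multi_member_split)
    have "(indexed_pmult p i \<otimes>\<^bsub>PR I\<^esub> q) u = (\<Oplus>v\<in>add_mset i ` {v. v \<subseteq># w}. p (v - {#i#}) \<otimes> q (u - v))"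
      unfolding poly_ring_mult
    proof (intro add.finprod_mono_neutral_cong_left[symmetric])
      show "\<And>v. v \<in> {v. v \<subseteq># u} - add_mset i ` {v. v \<subseteq># w} \<Longrightarrow> indexed_pmult p i v \<otimes> q (u - v) = \<zero>"
      proof -
        fix v assume v: "v \<in> {v. v \<subseteq># u} - add_mset i ` {v. v \<subseteq># w}"
        have "i \<notin># v"
        proof
          assume "i \<in># v"
          then obtain v' where "v = add_mset i v'" by (meson multi_member_split)
          then show False using v w by auto
        qed
        then show "indexed_pmult p i v \<otimes> q (u - v) = \<zero>" using assms by (simp add: indexed_pmult_def)
      qed
    qed (use assms in \<open>auto simp: finite_submsets w indexed_pmult_def\<close>)
    also have "\<dots> = (\<Oplus>v\<in>{v. v \<subseteq># w}. p v \<otimes> q (w - v))"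
      using assms by (subst finsum_reindex) (auto simp: inj_on_def w)
    finally show ?thesis using True by (simp add: indexed_pmult_def w poly_ring_mult)
  qed
qed

lemma mult_comm:
  fixes p q :: "'i multiset \<Rightarrow> 'a"
  assumes "\<And>u. p u \<in> carrier R" "\<And>u. q u \<in> carrier R"
  shows "p \<otimes>\<^bsub>PR I\<^esub> q = q \<otimes>\<^bsub>PR I\<^esub> p"
proof
  fix u :: "'i multiset"
  have im: "(\<lambda>v. u - v) ` {v. v \<subseteq># u} = {v. v \<subseteq># u}"
  proof
    show "{v. v \<subseteq># u} \<subseteq> (\<lambda>v. u - v) ` {v. v \<subseteq># u}"
    proof
      fix v assume "v \<in> {v. v \<subseteq># u}"
      then have "v = u - (u - v)" by (simp add: double_diff multiset_eq_iff mset_subset_eq_count subseteq_mset_def)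
      then show "v \<in> (\<lambda>v. u - v) ` {v. v \<subseteq># u}" by (metis diff_subset_eq_self imageI mem_Collect_eq)
    qed
  qed auto
  have inj: "inj_on (\<lambda>v. u - v) {v. v \<subseteq># u}"
    by (rule inj_onI) (simp add: multiset_eq_iff subseteq_mset_def, metis diff_diff_cancel)
  have "(p \<otimes>\<^bsub>PR I\<^esub> q) u = (\<Oplus>v\<in>(\<lambda>v. u - v) ` {v. v \<subseteq># u}. p v \<otimes> q (u - v))"
    by (simp add: im poly_ring_mult)
  also have "\<dots> = (\<Oplus>v\<in>{v. v \<subseteq># u}. p (u - v) \<otimes> q (u - (u - v)))"
    using assms inj by (subst finsum_reindex) auto
  also have "\<dots> = (q \<otimes>\<^bsub>PR I\<^esub> p) u"
    unfolding poly_ring_mult using assms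
  proof (intro finsum_cong')
    fix v assume "v \<in> {v. v \<subseteq># u}"
    then have "u - (u - v) = v" by (simp add: multiset_eq_iff subseteq_mset_def)
    then show "p (u - v) \<otimes> q (u - (u - v)) = q v \<otimes> p (u - v)" using assms by (simp add: m_comm)
  qed auto
  finally show "(p \<otimes>\<^bsub>PR I\<^esub> q) u = (q \<otimes>\<^bsub>PR I\<^esub> p) u" .
qed

lemma mult_coeff:
  assumes "\<And>u. p u \<in> carrier R" "\<And>u. q u \<in> carrier R"
  shows "(p \<otimes>\<^bsub>PR I\<^esub> q) u \<in> carrier R"
  unfolding poly_ring_mult using assms by (intro finsum_closed) auto

lemma smult_closed_poly:
  assumes "k \<in> carrier R" "q \<in> carrier (PR I)"
  shows "(\<lambda>u. k \<otimes> q u) \<in> carrier (PR I)"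
  using assms(2) unfolding poly_ring_simps
proof induction
  case (indexed_const c)
  have "(\<lambda>u. k \<otimes> indexed_const c u) = indexed_const (k \<otimes> c)"
    using assms(1) by (auto simp: indexed_const_def)
  then show ?case using indexed_const assms(1) by (metis indexed_pset.indexed_const m_closed)
next
  case (indexed_padd P Q)
  then have "(\<lambda>u. k \<otimes> indexed_padd P Q u) = indexed_padd (\<lambda>u. k \<otimes> P u) (\<lambda>u. k \<otimes> Q u)"
    using assms(1) pcoeff[of P I] pcoeff[of Q I]
    by (intro ext) (simp add: indexed_padd_def r_distr poly_ring_simps)
  then show ?case using indexed_padd by (simp add: indexed_pset.indexed_padd)
next
  case (indexed_pmult P i)
  then have "(\<lambda>u. k \<otimes> indexed_pmult P i u) = indexed_pmult (\<lambda>u. k \<otimes> P u) i"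
    using assms(1) pcoeff[unfolded poly_ring_simps] by (auto simp: indexed_pmult_def)
  then show ?case using indexed_pmult by (simp add: indexed_pset.indexed_pmult)
qed

lemma mult_closed_poly:
  assumes "p \<in> carrier (PR I)" "q \<in> carrier (PR I)"
  shows "p \<otimes>\<^bsub>PR I\<^esub> q \<in> carrier (PR I)"
  using assms(1) unfolding poly_ring_simps(1)
proof induction
  case (indexed_const k)
  then show ?case using assms(2) by (subst mult_const) (auto simp: pcoeff smult_closed_poly simp flip: poly_ring_simps(1))
next
  case (indexed_padd P Q)
  then show ?case using assms(2)
    by (subst mult_padd) (auto intro: pcoeff[unfolded poly_ring_simps(1)] indexed_pset.indexed_padd simp: poly_ring_simps(1))
next
  case (indexed_pmult P i)
  then show ?case using assms(2)
    by (subst mult_pmult) (auto intro: pcoeff[unfolded poly_ring_simps(1)] indexed_pset.indexed_pmult simp: poly_ring_simps(1))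
qed

lemma mult_assoc_poly:
  assumes p: "p \<in> carrier (PR I)" and q: "\<And>u. q u \<in> carrier R" and s: "\<And>u. s u \<in> carrier R"
  shows "(p \<otimes>\<^bsub>PR I\<^esub> q) \<otimes>\<^bsub>PR I\<^esub> s = p \<otimes>\<^bsub>PR I\<^esub> (q \<otimes>\<^bsub>PR I\<^esub> s)"
  using p unfolding poly_ring_simps(1)
proof induction
  case (indexed_const k)
  have "(\<lambda>u. k \<otimes> q u) \<otimes>\<^bsub>PR I\<^esub> s = (\<lambda>u. k \<otimes> (q \<otimes>\<^bsub>PR I\<^esub> s) u)"
  proof
    fix u
    have "((\<lambda>u. k \<otimes> q u) \<otimes>\<^bsub>PR I\<^esub> s) u = (\<Oplus>v\<in>{v. v \<subseteq># u}. k \<otimes> (q v \<otimes> s (u - v)))"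
      unfolding poly_ring_mult using q s indexed_const by (intro finsum_cong') (auto simp: m_assoc)
    also have "\<dots> = k \<otimes> (q \<otimes>\<^bsub>PR I\<^esub> s) u"
      unfolding poly_ring_mult using q s indexed_const
      by (subst finsum_rdistr) (auto simp: finite_submsets)
    finally show "((\<lambda>u. k \<otimes> q u) \<otimes>\<^bsub>PR I\<^esub> s) u = k \<otimes> (q \<otimes>\<^bsub>PR I\<^esub> s) u" .
  qed
  then show ?case using q s indexed_const by (simp add: mult_const mult_coeff)
next
  case (indexed_padd P Q)
  then show ?case using q s
    by (simp add: mult_padd mult_coeff pcoeff poly_ring_simps(1)[symmetric])
next
  case (indexed_pmult P i)
  then show ?case using q s
    by (simp add: mult_pmult mult_coeff pcoeff poly_ring_simps(1)[symmetric])
qed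

lemma poly_ring_cring: "cring (PR I)"
proof (rule cringI)
  show "abelian_group (PR I)"
  proof (rule abelian_groupI)
    fix p assume p: "p \<in> carrier (PR I)"
    have "(\<lambda>u. (\<ominus> \<one>) \<otimes> p u) \<oplus>\<^bsub>PR I\<^esub> p = \<zero>\<^bsub>PR I\<^esub>"
      using pcoeff[OF p] by (auto simp: poly_ring_simps indexed_padd_def indexed_const_def l_minus l_neg)
    then show "\<exists>y\<in>carrier (PR I). y \<oplus>\<^bsub>PR I\<^esub> p = \<zero>\<^bsub>PR I\<^esub>"
      using smult_closed_poly[OF _ p, of "\<ominus> \<one>"] by auto
  next
    show "\<zero>\<^bsub>PR I\<^esub> \<in> carrier (PR I)" by (simp add: poly_ring_simps indexed_pset.indexed_const)
    fix p q assume p: "p \<in> carrier (PR I)" and q: "q \<in> carrier (PR I)"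
    show "p \<oplus>\<^bsub>PR I\<^esub> q \<in> carrier (PR I)" using p q by (simp add: poly_ring_simps indexed_pset.indexed_padd)
    show "p \<oplus>\<^bsub>PR I\<^esub> q = q \<oplus>\<^bsub>PR I\<^esub> p" using pcoeff[OF p] pcoeff[OF q] 
      by (auto simp: poly_ring_simps indexed_padd_def a_comm)
    show "\<zero>\<^bsub>PR I\<^esub> \<oplus>\<^bsub>PR I\<^esub> p = p" using pcoeff[OF p]
      by (auto simp: poly_ring_simps indexed_padd_def indexed_const_def)
    fix s assume s: "s \<in> carrier (PR I)"
    show "p \<oplus>\<^bsub>PR I\<^esub> q \<oplus>\<^bsub>PR I\<^esub> s = p \<oplus>\<^bsub>PR I\<^esub> (q \<oplus>\<^bsub>PR I\<^esub> s)"
      using pcoeff[OF p] pcoeff[OF q] pcoeff[OF s] by (auto simp: poly_ring_simps indexed_padd_def a_assoc)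
  qed
  show "Group.comm_monoid (PR I)"
  proof (rule comm_monoidI)
    show "\<one>\<^bsub>PR I\<^esub> \<in> carrier (PR I)" by (simp add: poly_ring_simps indexed_pset.indexed_const)
    fix p q assume p: "p \<in> carrier (PR I)" and q: "q \<in> carrier (PR I)"
    show "p \<otimes>\<^bsub>PR I\<^esub> q \<in> carrier (PR I)" using p q by (rule mult_closed_poly)
    show "p \<otimes>\<^bsub>PR I\<^esub> q = q \<otimes>\<^bsub>PR I\<^esub> p" using p q by (intro mult_comm pcoeff)
    show "\<one>\<^bsub>PR I\<^esub> \<otimes>\<^bsub>PR I\<^esub> p = p" using pcoeff[OF p] by (simp add: poly_ring_simps mult_const)
    fix s assume s: "s \<in> carrier (PR I)"
    show "p \<otimes>\<^bsub>PR I\<^esub> q \<otimes>\<^bsub>PR I\<^esub> s = p \<otimes>\<^bsub>PR I\<^esub> (q \<otimes>\<^bsub>PR I\<^esub> s)"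
      using p pcoeff[OF q] pcoeff[OF s] by (rule mult_assoc_poly)
  qed
  fix p q s assume "p \<in> carrier (PR I)" "q \<in> carrier (PR I)" "s \<in> carrier (PR I)"
  then show "(p \<oplus>\<^bsub>PR I\<^esub> q) \<otimes>\<^bsub>PR I\<^esub> s = p \<otimes>\<^bsub>PR I\<^esub> s \<oplus>\<^bsub>PR I\<^esub> q \<otimes>\<^bsub>PR I\<^esub> s"
    by (simp add: poly_ring_simps(4) mult_padd pcoeff)
qed

lemma poly_finite_support: "p \<in> carrier (PR I) \<Longrightarrow> finite {u. p u \<noteq> \<zero>}"
  unfolding poly_ring_simps(1)
proof (induction rule: indexed_pset.induct)
  case (indexed_const k)
  have "{u. indexed_const k u \<noteq> \<zero>} \<subseteq> {{#}}" by (auto simp: indexed_const_def)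
  then show ?case using finite_subset by blast
next
  case (indexed_padd P Q)
  have "{u. indexed_padd P Q u \<noteq> \<zero>} \<subseteq> {u. P u \<noteq> \<zero>} \<union> {u. Q u \<noteq> \<zero>}" by (auto simp: indexed_padd_def)
  then show ?case using indexed_padd by (meson finite_UnI finite_subset)
next
  case (indexed_pmult P i)
  have "{u. indexed_pmult P i u \<noteq> \<zero>} \<subseteq> add_mset i ` {u. P u \<noteq> \<zero>}" 
  proof
    fix u assume "u \<in> {u. indexed_pmult P i u \<noteq> \<zero>}"
    then have "i \<in># u" "P (u - {#i#}) \<noteq> \<zero>" by (auto simp: indexed_pmult_def split: if_splits)
    then show "u \<in> add_mset i ` {u. P u \<noteq> \<zero>}" by (intro image_eqI[of _ _ "u - {#i#}"]) auto
  qed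
  then show ?case using indexed_pmult by (meson finite_imageI finite_subset)
qed

lemma rename_superset:
  assumes "finite A" "{u. p u \<noteq> \<zero>} \<subseteq> A" "\<And>u. p u \<in> carrier R"
  shows "poly_rename R g p v = (\<Oplus>u\<in>{u\<in>A. image_mset g u = v}. p u)"
  unfolding poly_rename_def
  using assms by (intro add.finprod_mono_neutral_cong_left) auto

lemma rename_coeff: "(\<And>u. p u \<in> carrier R) \<Longrightarrow> poly_rename R g p v \<in> carrier R"
  unfolding poly_rename_def by (intro finsum_closed) auto

lemma rename_const:
  assumes "k \<in> carrier R"
  shows "poly_rename R g (indexed_const k) = indexed_const k"
proof
  fix v
  have "poly_rename R g (indexed_const k) v = (\<Oplus>u\<in>{u\<in>{{#}}. image_mset g u = v}. indexed_const k u)"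
    using assms by (intro rename_superset) (auto simp: indexed_const_def)
  also have "\<dots> = indexed_const k v"
  proof (cases "v = {#}")
    case True
    have "{u\<in>{{#}}. image_mset g u = v} = {{#}}" using True by auto
    then show ?thesis using True assms by (simp add: indexed_const_def)
  next
    case False
    have "{u\<in>{{#}}. image_mset g u = v} = {}" using False by auto
    then show ?thesis unfolding \<open>{u\<in>{{#}}. image_mset g u = v} = {}\<close> using False by (simp add: indexed_const_def)
  qed
  finally show "poly_rename R g (indexed_const k) v = indexed_const k v" .
qed

lemma rename_padd:
  assumes "p \<in> carrier (PR I)" "q \<in> carrier (PR I)"
  shows "poly_rename R g (indexed_padd p q) = indexed_padd (poly_rename R g p) (poly_rename R g q)"
proof
  fix v
  define A where "A = {u. p u \<noteq> \<zero>} \<union> {u. q u \<noteq> \<zero>}"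
  have A: "finite A" unfolding A_def using assms poly_finite_support by blast
  note c = pcoeff[OF assms(1)] pcoeff[OF assms(2)]
  have "poly_rename R g (indexed_padd p q) v = (\<Oplus>u\<in>{u\<in>A. image_mset g u = v}. p u \<oplus> q u)"
    using c rename_superset[OF A, of "indexed_padd p q" g v, unfolded indexed_padd_def]
    unfolding indexed_padd_def by (fastforce simp: A_def)
  also have "\<dots> = (\<Oplus>u\<in>{u\<in>A. image_mset g u = v}. p u) \<oplus> (\<Oplus>u\<in>{u\<in>A. image_mset g u = v}. q u)"
    using c A by (subst finsum_addf) auto
  also have "\<dots> = poly_rename R g p v \<oplus> poly_rename R g q v"
    using rename_superset[OF A, of p g v] rename_superset[OF A, of q g v] c by (auto simp: A_def)
  finally show "poly_rename R g (indexed_padd p q) v = indexed_padd (poly_rename R g p) (poly_rename R g q) v"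
    by (simp add: indexed_padd_def)
qed

lemma rename_pmult:
  assumes "p \<in> carrier (PR I)"
  shows "poly_rename R g (indexed_pmult p i) = indexed_pmult (poly_rename R g p) (g i)"
proof
  fix v
  define A where "A = {u. p u \<noteq> \<zero>}"
  have A: "finite A" unfolding A_def using assms poly_finite_support by blast
  note c = pcoeff[OF assms(1)]
  have sub: "{u. indexed_pmult p i u \<noteq> \<zero>} \<subseteq> add_mset i ` A" 
  proof
    fix u assume "u \<in> {u. indexed_pmult p i u \<noteq> \<zero>}"
    then have "i \<in># u" "p (u - {#i#}) \<noteq> \<zero>" by (auto simp: indexed_pmult_def split: if_splits)
    then show "u \<in> add_mset i ` A" unfolding A_def by (intro image_eqI[of _ _ "u - {#i#}"]) auto
  qed
  have "poly_rename R g (indexed_pmult p i) v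
      = (\<Oplus>u\<in>{u\<in>add_mset i ` A. image_mset g u = v}. indexed_pmult p i u)"
    using c A sub by (intro rename_superset) (auto simp: indexed_pmult_def)
  also have "{u\<in>add_mset i ` A. image_mset g u = v} = add_mset i ` {u\<in>A. add_mset (g i) (image_mset g u) = v}"
    by auto
  also have "(\<Oplus>u\<in>\<dots>. indexed_pmult p i u) = (\<Oplus>u\<in>{u\<in>A. add_mset (g i) (image_mset g u) = v}. p u)"
    using c by (subst finsum_reindex) (auto simp: indexed_pmult_def inj_on_def)
  also have "\<dots> = indexed_pmult (poly_rename R g p) (g i) v"
  proof (cases "g i \<in># v")
    case True
    then obtain w where w: "v = add_mset (g i) w" by (meson multi_member_split)
    show ?thesis using rename_superset[OF A, of p g w] c by (simp add: w indexed_pmult_def A_def)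
  next
    case False
    then have e: "{u\<in>A. add_mset (g i) (image_mset g u) = v} = {}" by auto
    show ?thesis unfolding e using False by (simp add: indexed_pmult_def)
  qed
  finally show "poly_rename R g (indexed_pmult p i) v = indexed_pmult (poly_rename R g p) (g i) v" .
qed

lemma rename_closed:
  assumes "p \<in> carrier (PR I)" "g \<in> I \<rightarrow> J"
  shows "poly_rename R g p \<in> carrier (PR J)"
  using assms(1) unfolding poly_ring_simps(1)
proof induction
  case (indexed_const k)
  then show ?case by (simp add: rename_const indexed_pset.indexed_const)
next
  case (indexed_padd P Q)
  then show ?case by (simp add: rename_padd[unfolded poly_ring_simps(1)] indexed_pset.indexed_padd)
next
  case (indexed_pmult P i)
  then show ?case using assms(2) by (auto simp: rename_pmult[unfolded poly_ring_simps(1)] intro!: indexed_pset.indexed_pmult)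
qed

lemma rename_mult:
  assumes "p \<in> carrier (PR I)" "q \<in> carrier (PR I)" "g \<in> I \<rightarrow> J"
  shows "poly_rename R g (p \<otimes>\<^bsub>PR I\<^esub> q) = poly_rename R g p \<otimes>\<^bsub>PR J\<^esub> poly_rename R g q"
  using assms(1) unfolding poly_ring_simps(1)
proof induction
  case (indexed_const k)
  note c = pcoeff[OF assms(2)]
  define A where "A = {u. q u \<noteq> \<zero>}"
  have A: "finite A" unfolding A_def using assms poly_finite_support by blast
  have "poly_rename R g (\<lambda>u. k \<otimes> q u) = (\<lambda>v. k \<otimes> poly_rename R g q v)"
  proof
    fix v
    have "poly_rename R g (\<lambda>u. k \<otimes> q u) v = (\<Oplus>u\<in>{u\<in>A. image_mset g u = v}. k \<otimes> q u)"
      using indexed_const c A by (intro rename_superset) (auto simp: A_def)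
    also have "\<dots> = k \<otimes> (\<Oplus>u\<in>{u\<in>A. image_mset g u = v}. q u)"
      using indexed_const c A by (subst finsum_rdistr) auto
    also have "\<dots> = k \<otimes> poly_rename R g q v"
      using rename_superset[OF A, of q g v] c by (auto simp: A_def)
    finally show "poly_rename R g (\<lambda>u. k \<otimes> q u) v = k \<otimes> poly_rename R g q v" .
  qed
  then show ?case using indexed_const c by (simp add: mult_const rename_const rename_coeff)
next
  case (indexed_padd P Q)
  then have "P \<in> carrier (PR I)" "Q \<in> carrier (PR I)" by (auto simp: poly_ring_simps)
  with indexed_padd assms show ?case
    by (simp add: mult_padd pcoeff rename_padd[where I=I] mult_closed_poly rename_coeff)
next
  case (indexed_pmult P i)
  then have "P \<in> carrier (PR I)" by (auto simp: poly_ring_simps)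
  with indexed_pmult assms show ?case
    by (simp add: mult_pmult pcoeff rename_pmult[where I=I] mult_closed_poly rename_coeff)
qed

lemma rename_ring_hom:
  assumes "g \<in> I \<rightarrow> J"
  shows "poly_rename R g \<in> ring_hom (PR I) (PR J)"
  using assms
  by (intro ring_hom_memI) (auto simp: rename_closed rename_mult, auto simp: poly_ring_simps rename_const rename_padd[unfolded poly_ring_simps(1)])

lemma indexed_var_closed: "i \<in> I \<Longrightarrow> indexed_var i \<in> carrier (PR I)"
  by (simp add: poly_ring_simps indexed_var_def indexed_pset.intros)

lemma rename_var: "poly_rename R g (indexed_var i) = indexed_var (g i)"
  by (simp add: indexed_var_def rename_pmult[of _ UNIV] rename_const poly_ring_simps indexed_pset.intros)

lemma rename_comp_on:
  assumes "p \<in> carrier (PR I)" "g \<in> I \<rightarrow> J" "\<And>i. i \<in> I \<Longrightarrow> h (g i) = k i"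
  shows "poly_rename R h (poly_rename R g p) = poly_rename R k p"
  using assms(1) unfolding poly_ring_simps(1)
proof induction
  case (indexed_const k)
  then show ?case by (simp add: rename_const)
next
  case (indexed_padd P Q)
  then show ?case using assms(2)
    by (simp add: rename_padd[where I=I] rename_padd[where I=J] rename_closed poly_ring_simps(1)[symmetric])
next
  case (indexed_pmult P i)
  then show ?case using assms(2,3)
    by (simp add: rename_pmult[where I=I] rename_pmult[where I=J] rename_closed poly_ring_simps(1)[symmetric])
qed

end

lemma quotient_induced_map:
  assumes "ideal I A" "ring S" "f \<in> ring_hom A S" "\<And>i. i \<in> I \<Longrightarrow> f i = \<zero>\<^bsub>S\<^esub>"
  shows "\<And>a. a \<in> carrier A \<Longrightarrow> the_elem (f ` (I +>\<^bsub>A\<^esub> a)) = f a"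
    and "(\<lambda>C. the_elem (f ` C)) \<in> ring_hom (A Quot I) S"
proof -
  interpret I: ideal I A by fact
  interpret f: ring_hom_ring A S f
    using assms I.ring_axioms by (simp add: ring_hom_ringI2)
  show *: "the_elem (f ` (I +>\<^bsub>A\<^esub> a)) = f a" if a: "a \<in> carrier A" for a
  proof -
    have "f ` (I +>\<^bsub>A\<^esub> a) = {f a}"
    proof
      show "f ` (I +>\<^bsub>A\<^esub> a) \<subseteq> {f a}"
        using a assms(4) I.Icarr by (auto simp: a_r_coset_def' f.hom_add)
      show "{f a} \<subseteq> f ` (I +>\<^bsub>A\<^esub> a)"
        using I.a_rcos_self[OF a] by blast
    qed
    then show ?thesis by simp
  qed
  show "(\<lambda>C. the_elem (f ` C)) \<in> ring_hom (A Quot I) S"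
  proof (rule ring_hom_memI)
    show "the_elem (f ` \<one>\<^bsub>A Quot I\<^esub>) = \<one>\<^bsub>S\<^esub>" by (simp add: FactRing_def *)
    fix C assume "C \<in> carrier (A Quot I)"
    then obtain a where a: "a \<in> carrier A" "C = I +>\<^bsub>A\<^esub> a" by (auto simp: FactRing_def A_RCOSETS_def')
    show "the_elem (f ` C) \<in> carrier S" using a by (simp add: *)
    fix D assume "D \<in> carrier (A Quot I)"
    then obtain b where b: "b \<in> carrier A" "D = I +>\<^bsub>A\<^esub> b" by (auto simp: FactRing_def A_RCOSETS_def')
    show "the_elem (f ` (C \<otimes>\<^bsub>A Quot I\<^esub> D)) = the_elem (f ` C) \<otimes>\<^bsub>S\<^esub> the_elem (f ` D)"
      using a b by (simp add: FactRing_def I.rcoset_mult_add *)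
    show "the_elem (f ` (C \<oplus>\<^bsub>A Quot I\<^esub> D)) = the_elem (f ` C) \<oplus>\<^bsub>S\<^esub> the_elem (f ` D)"
      using a b by (simp add: FactRing_def I.a_rcos_sum *)
  qed
qed

lemma mod_homD:
  assumes "f \<in> mod_hom R M N"
  shows "f \<in> carrier M \<rightarrow> carrier N" "\<And>x. x \<in> carrier M \<Longrightarrow> f x \<in> carrier N"
    "\<And>x y. x \<in> carrier M \<Longrightarrow> y \<in> carrier M \<Longrightarrow> f (x \<oplus>\<^bsub>M\<^esub> y) = f x \<oplus>\<^bsub>N\<^esub> f y"
    "\<And>a x. a \<in> carrier R \<Longrightarrow> x \<in> carrier M \<Longrightarrow> f (a \<odot>\<^bsub>M\<^esub> x) = a \<odot>\<^bsub>N\<^esub> f x"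
  using assms by (auto simp: mod_hom_def)

lemma mod_hom_compose:
  assumes "f \<in> mod_hom R L M" "g \<in> mod_hom R M N"
  shows "g \<circ> f \<in> mod_hom R L N"
  using assms by (auto simp: mod_hom_def Pi_iff)

context cring begin

definition sym_rels where "sym_rels M =
  {indexed_var (x \<oplus>\<^bsub>M\<^esub> y) \<ominus>\<^bsub>PR (carrier M)\<^esub> (indexed_var x \<oplus>\<^bsub>PR (carrier M)\<^esub> indexed_var y) | x y. x \<in> carrier M \<and> y \<in> carrier M} \<union>
  {indexed_var (a \<odot>\<^bsub>M\<^esub> x) \<ominus>\<^bsub>PR (carrier M)\<^esub> (indexed_const a \<otimes>\<^bsub>PR (carrier M)\<^esub> indexed_var x) | a x. a \<in> carrier R \<and> x \<in> carrier M}"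

lemma sym_ideal_rels: "sym_ideal R M = Idl\<^bsub>PR (carrier M)\<^esub> (sym_rels M)"
  by (simp add: sym_ideal_def sym_rels_def Let_def)

lemma indexed_const_closed: "a \<in> carrier R \<Longrightarrow> indexed_const a \<in> carrier (PR I)"
  by (simp add: poly_ring_simps indexed_pset.indexed_const)

lemma sym_rels_closed:
  assumes "module R M" shows "sym_rels M \<subseteq> carrier (PR (carrier M))"
proof -
  interpret M: module R M by fact
  interpret P: cring "PR (carrier M)" by (rule poly_ring_cring)
  show ?thesis by (auto simp: sym_rels_def indexed_var_closed indexed_const_closed)
qed

lemma sym_ideal_ideal: "module R M \<Longrightarrow> ideal (sym_ideal R M) (PR (carrier M))"
  unfolding sym_ideal_rels
  by (intro ring.genideal_ideal sym_rels_closed cring.axioms(1)[OF poly_ring_cring])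

lemma sym_cring: "module R M \<Longrightarrow> cring (sym_algebra R M)"
  unfolding sym_algebra_def by (intro ideal.quotient_is_cring sym_ideal_ideal poly_ring_cring)

lemma rename_sym_ideal:
  assumes M: "module R M" and N: "module R N" and g: "g \<in> mod_hom R M N" and p: "p \<in> sym_ideal R M"
  shows "poly_rename R g p \<in> sym_ideal R N"
proof -
  interpret M: module R M by fact
  interpret N: module R N by fact
  interpret P: cring "PR (carrier M)" by (rule poly_ring_cring)
  interpret Q: cring "PR (carrier N)" by (rule poly_ring_cring)
  note gD = mod_homD[OF g]
  interpret f: ring_hom_ring "PR (carrier M)" "PR (carrier N)" "poly_rename R g"
    by (intro ring_hom_ringI2 P.ring_axioms Q.ring_axioms rename_ring_hom gD)
  have fm: "poly_rename R g (a \<ominus>\<^bsub>PR (carrier M)\<^esub> b) = poly_rename R g a \<ominus>\<^bsub>PR (carrier N)\<^esub> poly_rename R g b"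
    if "a \<in> carrier (PR (carrier M))" "b \<in> carrier (PR (carrier M))" for a b
    using that by (simp add: a_minus_def f.hom_add f.hom_a_inv)
  have "poly_rename R g ` sym_rels M \<subseteq> sym_rels N"
  proof
    fix z assume "z \<in> poly_rename R g ` sym_rels M"
    then obtain q where q: "q \<in> sym_rels M" "z = poly_rename R g q" by auto
    from q(1) consider
      (add) x y where "x \<in> carrier M" "y \<in> carrier M" "q = indexed_var (x \<oplus>\<^bsub>M\<^esub> y) \<ominus>\<^bsub>PR (carrier M)\<^esub> (indexed_var x \<oplus>\<^bsub>PR (carrier M)\<^esub> indexed_var y)"
    | (smult) a x where "a \<in> carrier R" "x \<in> carrier M" "q = indexed_var (a \<odot>\<^bsub>M\<^esub> x) \<ominus>\<^bsub>PR (carrier M)\<^esub> (indexed_const a \<otimes>\<^bsub>PR (carrier M)\<^esub> indexed_var x)"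
      unfolding sym_rels_def by auto
    then show "z \<in> sym_rels N"
    proof cases
      case add
      then have "z = indexed_var (g x \<oplus>\<^bsub>N\<^esub> g y) \<ominus>\<^bsub>PR (carrier N)\<^esub> (indexed_var (g x) \<oplus>\<^bsub>PR (carrier N)\<^esub> indexed_var (g y))"
        using q(2) by (simp add: fm indexed_var_closed rename_var f.hom_add gD(3))
      then show ?thesis unfolding sym_rels_def using add gD(2) by blast
    next
      case smult
      then have "z = indexed_var (a \<odot>\<^bsub>N\<^esub> g x) \<ominus>\<^bsub>PR (carrier N)\<^esub> (indexed_const a \<otimes>\<^bsub>PR (carrier N)\<^esub> indexed_var (g x))"
        using q(2) by (simp add: fm indexed_var_closed indexed_const_closed rename_var rename_const f.hom_mult gD(4))
      then show ?thesis unfolding sym_rels_def using smult gD(2) by blast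
    qed
  qed
  also have "sym_rels N \<subseteq> sym_ideal R N"
    unfolding sym_ideal_rels by (rule Q.genideal_self[OF sym_rels_closed[OF N]])
  finally have "sym_rels M \<subseteq> {r \<in> carrier (PR (carrier M)). poly_rename R g r \<in> sym_ideal R N}"
    using sym_rels_closed[OF M] by auto
  then have "sym_ideal R M \<subseteq> {r \<in> carrier (PR (carrier M)). poly_rename R g r \<in> sym_ideal R N}"
    unfolding sym_ideal_rels[of M] by (intro P.genideal_minimal f.ideal_vimage sym_ideal_ideal[OF N])
  with p show ?thesis by auto
qed

lemma sym_map_props:
  assumes M: "module R M" and N: "module R N" and g: "g \<in> mod_hom R M N"
  shows "\<And>p. p \<in> carrier (PR (carrier M)) \<Longrightarrow>
      sym_map R N g (sym_ideal R M +>\<^bsub>PR (carrier M)\<^esub> p) = sym_ideal R N +>\<^bsub>PR (carrier N)\<^esub> poly_rename R g p"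
    and "sym_map R N g \<in> ring_hom (sym_algebra R M) (sym_algebra R N)"
proof -
  interpret I: ideal "sym_ideal R M" "PR (carrier M)" by (rule sym_ideal_ideal[OF M])
  interpret J: ideal "sym_ideal R N" "PR (carrier N)" by (rule sym_ideal_ideal[OF N])
  define f where "f = (\<lambda>p. sym_ideal R N +>\<^bsub>PR (carrier N)\<^esub> poly_rename R g p)"
  have f: "f \<in> ring_hom (PR (carrier M)) (sym_algebra R N)"
    using ring_hom_trans[OF rename_ring_hom[OF mod_homD(1)[OF g]] J.rcos_ring_hom]
    by (simp add: f_def comp_def sym_algebra_def)
  have 0: "\<And>i. i \<in> sym_ideal R M \<Longrightarrow> f i = \<zero>\<^bsub>sym_algebra R N\<^esub>"
    using rename_sym_ideal[OF M N g] by (simp add: f_def sym_algebra_def FactRing_def J.a_rcos_const)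
  have s: "sym_map R N g = (\<lambda>C. the_elem (f ` C))" by (auto simp: sym_map_def f_def)
  note * = quotient_induced_map[OF sym_ideal_ideal[OF M] cring.axioms(1)[OF sym_cring[OF N]] f 0]
  show "\<And>p. p \<in> carrier (PR (carrier M)) \<Longrightarrow>
      sym_map R N g (sym_ideal R M +>\<^bsub>PR (carrier M)\<^esub> p) = sym_ideal R N +>\<^bsub>PR (carrier N)\<^esub> poly_rename R g p"
    using *(1) unfolding s by (simp add: f_def)
  show "sym_map R N g \<in> ring_hom (sym_algebra R M) (sym_algebra R N)"
    using *(2) unfolding s by (simp add: sym_algebra_def)
qed

lemma sym_kernel_ideal:
  assumes M: "module R M" and N: "module R N" and g: "g \<in> mod_hom R M N"
  shows "ideal (sym_kernel R M N g) (sym_algebra R M)"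
proof -
  interpret ring_hom_ring "sym_algebra R M" "sym_algebra R N" "sym_map R N g"
    by (intro ring_hom_ringI2 sym_map_props[OF assms] cring.axioms(1)[OF sym_cring] M N)
  show ?thesis unfolding sym_kernel_def by (rule kernel_is_ideal)
qed

lemma poly_finite_vars:
  assumes "p \<in> carrier (PR I)"
  shows "\<exists>I0. finite I0 \<and> I0 \<subseteq> I \<and> p \<in> carrier (PR I0)"
proof -
  have mono: "p \<in> carrier (PR J)" if "p \<in> carrier (PR I0)" "I0 \<subseteq> J" for p :: "'c multiset \<Rightarrow> 'a" and I0 J
    using that(1) unfolding poly_ring_simps(1)
    by induction (use that(2) in \<open>auto intro: indexed_pset.intros\<close>)
  from assms show ?thesis unfolding poly_ring_simps(1)
  proof induction
    case (indexed_const k)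
    then show ?case by (intro exI[of _ "{}"]) (simp add: indexed_pset.indexed_const)
  next
    case (indexed_padd P Q)
    then obtain A B where "finite A" "A \<subseteq> I" "P \<in> carrier (PR A)" "finite B" "B \<subseteq> I" "Q \<in> carrier (PR B)"
      by (auto simp: poly_ring_simps)
    then show ?case using mono[of P A "A \<union> B"] mono[of Q B "A \<union> B"]
      by (intro exI[of _ "A \<union> B"]) (simp add: poly_ring_simps indexed_pset.indexed_padd)
  next
    case (indexed_pmult P i)
    then obtain A where "finite A" "A \<subseteq> I" "P \<in> carrier (PR A)" 
      by (auto simp: poly_ring_simps)
    then show ?case using mono[of P A "insert i A"] indexed_pmult
      by (intro exI[of _ "insert i A"]) (auto simp: poly_ring_simps intro!: indexed_pset.indexed_pmult)
  qed
qed

definition coord_module :: "nat \<Rightarrow> ('a, nat \<Rightarrow> 'a) module" where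
  "coord_module n = \<lparr>carrier = {v. (\<forall>i. v i \<in> carrier R) \<and> (\<forall>i\<ge>n. v i = \<zero>)},
     monoid.mult = undefined, one = undefined, ring.zero = (\<lambda>_. \<zero>),
     add = (\<lambda>v w i. v i \<oplus> w i), smult = (\<lambda>a v i. a \<otimes> v i)\<rparr>"

lemma coord_module: "module R (coord_module n)"
proof (rule moduleI)
  show "abelian_group (coord_module n)"
  proof (rule abelian_groupI)
    fix x assume x: "x \<in> carrier (coord_module n)"
    then show "\<exists>y\<in>carrier (coord_module n). y \<oplus>\<^bsub>coord_module n\<^esub> x = \<zero>\<^bsub>coord_module n\<^esub>"
      by (intro bexI[of _ "\<lambda>i. \<ominus> x i"]) (auto simp: coord_module_def l_neg)
  qed (auto simp: coord_module_def a_ac)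
qed (auto simp: coord_module_def l_distr r_distr m_assoc is_cring)

lemma coord_finsum:
  assumes "finite A" "f \<in> A \<rightarrow> carrier (coord_module n)"
  shows "(\<Oplus>\<^bsub>coord_module n\<^esub>j\<in>A. f j) = (\<lambda>i. \<Oplus>j\<in>A. f j i)"
proof -
  interpret F: module R "coord_module n" by (rule coord_module)
  show ?thesis using assms
  proof (induction A)
    case empty then show ?case by (simp, simp add: coord_module_def)
  next
    case (insert x A)
    have "(\<And>i. (\<lambda>j. f j i) \<in> A \<rightarrow> carrier R)" "\<And>i. f x i \<in> carrier R" 
      using insert by (auto simp: coord_module_def Pi_iff)
    with insert show ?case by (simp, simp add: coord_module_def)
  qed
qed

lemma coord_module_free: "free_module R (coord_module n)"
proof -
  interpret F: module R "coord_module n" by (rule coord_module)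
  have "\<exists>B. is_module_basis R (coord_module n) B"
  proof (cases "\<one> = \<zero>")
    case True
    then have 0: "\<And>x. x \<in> carrier R \<Longrightarrow> x = \<zero>" using one_zeroD by blast
    have "\<And>x. x \<in> carrier (coord_module n) \<Longrightarrow> x = \<zero>\<^bsub>coord_module n\<^esub>"
      by (auto simp: coord_module_def intro!: 0)
    then have "is_module_basis R (coord_module n) {}" by (auto simp: is_module_basis_def)
    then show ?thesis by blast
  next
    case False
    define d where "d = (\<lambda>j i :: nat. if i = j then \<one> else \<zero> :: 'a)"
    have dc: "d j \<in> carrier (coord_module n)" if "j < n" for j
      using that by (auto simp: d_def coord_module_def)
    have inj: "inj_on d {..<n}" using False by (auto simp: inj_on_def d_def fun_eq_iff)
    have sum: "(\<Oplus>\<^bsub>coord_module n\<^esub>b\<in>{b\<in>d ` {..<n}. c b \<noteq> \<zero>}. c b \<odot>\<^bsub>coord_module n\<^esub> b) = (\<lambda>i. if i < n then c (d i) else \<zero>)"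
      if c: "c \<in> d ` {..<n} \<rightarrow> carrier R" for c
    proof -
      have "(\<Oplus>\<^bsub>coord_module n\<^esub>b\<in>{b\<in>d ` {..<n}. c b \<noteq> \<zero>}. c b \<odot>\<^bsub>coord_module n\<^esub> b)
          = (\<Oplus>\<^bsub>coord_module n\<^esub>b\<in>d ` {..<n}. c b \<odot>\<^bsub>coord_module n\<^esub> b)"
        using c dc by (intro F.add.finprod_mono_neutral_cong_left) auto
      also have "\<dots> = (\<Oplus>\<^bsub>coord_module n\<^esub>j\<in>{..<n}. c (d j) \<odot>\<^bsub>coord_module n\<^esub> d j)"
        using c dc inj by (subst F.add.finprod_reindex) auto
      also have "\<dots> = (\<lambda>i. \<Oplus>j\<in>{..<n}. (c (d j) \<odot>\<^bsub>coord_module n\<^esub> d j) i)"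
        using c dc by (intro coord_finsum) auto
      also have "\<dots> = (\<lambda>i. \<Oplus>j\<in>{..<n}. if i = j then c (d j) else \<zero>)"
      proof (intro ext add.finprod_cong')
        fix i j assume "j \<in> {..<n}"
        then have "c (d j) \<in> carrier R" using c by auto
        then show "(c (d j) \<odot>\<^bsub>coord_module n\<^esub> d j) i = (if i = j then c (d j) else \<zero>)"
          by (simp add: coord_module_def, simp add: d_def)
      qed (use c in auto)
      also have "\<dots> = (\<lambda>i. if i < n then c (d i) else \<zero>)"
      proof
        fix i
        show "(\<Oplus>j\<in>{..<n}. if i = j then c (d j) else \<zero>) = (if i < n then c (d i) else \<zero>)"
        proof (cases "i < n")
          case True
          then show ?thesis using c by (subst add.finprod_singleton[where f = "\<lambda>j. c (d j)"]) auto
        next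
          case False
          have "(\<Oplus>j\<in>{..<n}. if i = j then c (d j) else \<zero>) = (\<Oplus>j\<in>{..<n}. \<zero>)"
            using False by (intro add.finprod_cong') auto
          then show ?thesis using False by simp
        qed
      qed
      finally show ?thesis .
    qed
    have "is_module_basis R (coord_module n) (d ` {..<n})"
      unfolding is_module_basis_def
    proof (intro conjI ballI)
      show "d ` {..<n} \<subseteq> carrier (coord_module n)" using dc by auto
      fix x assume x: "x \<in> carrier (coord_module n)"
      define c where "c = (\<lambda>b\<in>d ` {..<n}. x (the_inv_into {..<n} d b))"
      have cd: "c (d i) = x i" if "i < n" for i
        using that inj by (simp add: c_def the_inv_into_f_f)
      have cc: "c \<in> d ` {..<n} \<rightarrow>\<^sub>E carrier R"
        using cd x by (auto simp: c_def coord_module_def)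
      show "\<exists>!c. c \<in> d ` {..<n} \<rightarrow>\<^sub>E carrier R \<and> finite {b\<in>d ` {..<n}. c b \<noteq> \<zero>} \<and>
        x = (\<Oplus>\<^bsub>coord_module n\<^esub>b\<in>{b\<in>d ` {..<n}. c b \<noteq> \<zero>}. c b \<odot>\<^bsub>coord_module n\<^esub> b)"
      proof (intro ex1I[of _ c] conjI)
        show "c \<in> d ` {..<n} \<rightarrow>\<^sub>E carrier R" by fact
        show "finite {b\<in>d ` {..<n}. c b \<noteq> \<zero>}" by auto
        show "x = (\<Oplus>\<^bsub>coord_module n\<^esub>b\<in>{b\<in>d ` {..<n}. c b \<noteq> \<zero>}. c b \<odot>\<^bsub>coord_module n\<^esub> b)"
        proof -
          have "c \<in> d ` {..<n} \<rightarrow> carrier R" using cc by auto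
          from sum[OF this] show ?thesis using cd x by (auto simp: coord_module_def)
        qed
        fix c' assume c': "c' \<in> d ` {..<n} \<rightarrow>\<^sub>E carrier R \<and> finite {b\<in>d ` {..<n}. c' b \<noteq> \<zero>} \<and>
          x = (\<Oplus>\<^bsub>coord_module n\<^esub>b\<in>{b\<in>d ` {..<n}. c' b \<noteq> \<zero>}. c' b \<odot>\<^bsub>coord_module n\<^esub> b)"
        then have "c' \<in> d ` {..<n} \<rightarrow> carrier R" by auto
        from sum[OF this] c' have xe: "x = (\<lambda>i. if i < n then c' (d i) else \<zero>)" by metis
        have "c' (d i) = c (d i)" if "i < n" for i
          using that cd[OF that] fun_cong[OF xe, of i] by simp
        then show "c' = c" using c' cc by (intro PiE_ext[of c' "d ` {..<n}" "\<lambda>_. carrier R" c]) auto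
      qed
    qed
    then show ?thesis by blast
  qed
  then show ?thesis by (simp add: free_module_def coord_module)
qed

end

context cring begin

lemma free_coordinates:
  assumes G: "module R G" and B: "is_module_basis R G B"
  obtains k where
    "\<And>x b. x \<in> carrier G \<Longrightarrow> b \<in> B \<Longrightarrow> k x b \<in> carrier R"
    "\<And>x. x \<in> carrier G \<Longrightarrow> finite {b\<in>B. k x b \<noteq> \<zero>}"
    "\<And>x. x \<in> carrier G \<Longrightarrow> x = (\<Oplus>\<^bsub>G\<^esub>b\<in>{b\<in>B. k x b \<noteq> \<zero>}. k x b \<odot>\<^bsub>G\<^esub> b)"
    "\<And>x y b. x \<in> carrier G \<Longrightarrow> y \<in> carrier G \<Longrightarrow> b \<in> B \<Longrightarrow> k (x \<oplus>\<^bsub>G\<^esub> y) b = k x b \<oplus> k y b"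
    "\<And>a x b. a \<in> carrier R \<Longrightarrow> x \<in> carrier G \<Longrightarrow> b \<in> B \<Longrightarrow> k (a \<odot>\<^bsub>G\<^esub> x) b = a \<otimes> k x b"
proof -
  interpret G: module R G by fact
  have Bc: "B \<subseteq> carrier G" using B by (simp add: is_module_basis_def)
  define P where "P = (\<lambda>x c. c \<in> B \<rightarrow>\<^sub>E carrier R \<and> finite {b\<in>B. c b \<noteq> \<zero>} \<and>
       x = (\<Oplus>\<^bsub>G\<^esub>b\<in>{b\<in>B. c b \<noteq> \<zero>}. c b \<odot>\<^bsub>G\<^esub> b))"
  have ex: "\<exists>!c. P x c" if "x \<in> carrier G" for x
    using B that by (simp add: is_module_basis_def P_def)
  define k where "k = (\<lambda>x. THE c. P x c)"
  have k: "P x (k x)" if "x \<in> carrier G" for x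
    unfolding k_def by (rule theI'[OF ex[OF that]])
  have uniq: "k x = c" if "x \<in> carrier G" "P x c" for x c
    using ex[OF that(1)] k[OF that(1)] that(2) by blast
  have kc: "k x b \<in> carrier R" if "x \<in> carrier G" "b \<in> B" for x b
    using k[OF that(1)] that(2) by (auto simp: P_def)
  have kf: "finite {b\<in>B. k x b \<noteq> \<zero>}" if "x \<in> carrier G" for x
    using k[OF that(1)] by (simp add: P_def)
  have ks: "x = (\<Oplus>\<^bsub>G\<^esub>b\<in>{b\<in>B. k x b \<noteq> \<zero>}. k x b \<odot>\<^bsub>G\<^esub> b)" if "x \<in> carrier G" for x
    using k[OF that(1)] by (simp add: P_def)
  have sup: "(\<Oplus>\<^bsub>G\<^esub>b\<in>{b\<in>B. c b \<noteq> \<zero>}. c b \<odot>\<^bsub>G\<^esub> b) = (\<Oplus>\<^bsub>G\<^esub>b\<in>A. c b \<odot>\<^bsub>G\<^esub> b)"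
    if "finite A" "{b\<in>B. c b \<noteq> \<zero>} \<subseteq> A" "A \<subseteq> B" "\<And>b. b \<in> B \<Longrightarrow> c b \<in> carrier R" for A c
  proof (rule G.add.finprod_mono_neutral_cong_left[OF that(1,2)])
    fix i assume "i \<in> A - {b \<in> B. c b \<noteq> \<zero>}"
      then have "c i = \<zero>" "i \<in> carrier G" using that(3) Bc by auto
      then show "c i \<odot>\<^bsub>G\<^esub> i = \<zero>\<^bsub>G\<^esub>" by simp
    next
    show "(\<lambda>b. c b \<odot>\<^bsub>G\<^esub> b) \<in> A \<rightarrow> carrier G"
      using that(3,4) Bc by auto
  qed auto
  have kadd: "k (x \<oplus>\<^bsub>G\<^esub> y) b = k x b \<oplus> k y b" if x: "x \<in> carrier G" and y: "y \<in> carrier G" and b: "b \<in> B" for x y b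
  proof -
    define c where "c = (\<lambda>b\<in>B. k x b \<oplus> k y b)"
    define A where "A = {b\<in>B. k x b \<noteq> \<zero>} \<union> {b\<in>B. k y b \<noteq> \<zero>}"
    have A: "finite A" "A \<subseteq> B" unfolding A_def using kf x y by auto
    have cA: "{b\<in>B. c b \<noteq> \<zero>} \<subseteq> A" by (auto simp: A_def c_def)
    have "(\<Oplus>\<^bsub>G\<^esub>b\<in>{b\<in>B. c b \<noteq> \<zero>}. c b \<odot>\<^bsub>G\<^esub> b) = (\<Oplus>\<^bsub>G\<^esub>b\<in>A. c b \<odot>\<^bsub>G\<^esub> b)"
      using A cA kc x y by (intro sup) (auto simp: c_def)
    also have "\<dots> = (\<Oplus>\<^bsub>G\<^esub>b\<in>A. k x b \<odot>\<^bsub>G\<^esub> b \<oplus>\<^bsub>G\<^esub> k y b \<odot>\<^bsub>G\<^esub> b)"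
    proof (intro G.finsum_cong')
      show "(\<lambda>b. k x b \<odot>\<^bsub>G\<^esub> b \<oplus>\<^bsub>G\<^esub> k y b \<odot>\<^bsub>G\<^esub> b) \<in> A \<rightarrow> carrier G"
        using A(2) Bc kc x y by (auto intro!: G.M.a_closed G.smult_closed)
      fix i assume "i \<in> A"
      then have "i \<in> B" "i \<in> carrier G" using A(2) Bc by auto
      then show "c i \<odot>\<^bsub>G\<^esub> i = k x i \<odot>\<^bsub>G\<^esub> i \<oplus>\<^bsub>G\<^esub> k y i \<odot>\<^bsub>G\<^esub> i"
        using kc x y by (simp add: c_def G.smult_l_distr)
    qed simp
    also have "\<dots> = (\<Oplus>\<^bsub>G\<^esub>b\<in>A. k x b \<odot>\<^bsub>G\<^esub> b) \<oplus>\<^bsub>G\<^esub> (\<Oplus>\<^bsub>G\<^esub>b\<in>A. k y b \<odot>\<^bsub>G\<^esub> b)"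
      using A Bc kc x y by (intro G.finsum_addf) (auto intro!: G.smult_closed)
    also have "(\<Oplus>\<^bsub>G\<^esub>b\<in>A. k x b \<odot>\<^bsub>G\<^esub> b) = x"
      using sup[OF A(1) _ A(2), of "k x"] ks[OF x, symmetric] kc[OF x] by (auto simp: A_def)
    also have "(\<Oplus>\<^bsub>G\<^esub>b\<in>A. k y b \<odot>\<^bsub>G\<^esub> b) = y"
      using sup[OF A(1) _ A(2), of "k y"] ks[OF y, symmetric] kc[OF y] by (auto simp: A_def)
    finally have "P (x \<oplus>\<^bsub>G\<^esub> y) c"
      using kc x y finite_subset[OF cA A(1)] by (auto simp: P_def c_def)
    then have "k (x \<oplus>\<^bsub>G\<^esub> y) = c" using x y by (intro uniq) auto
    then show ?thesis using b by (simp add: c_def)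
  qed
  have ksm: "k (a \<odot>\<^bsub>G\<^esub> x) b = a \<otimes> k x b" if a: "a \<in> carrier R" and x: "x \<in> carrier G" and b: "b \<in> B" for a x b
  proof -
    define c where "c = (\<lambda>b\<in>B. a \<otimes> k x b)"
    define A where "A = {b\<in>B. k x b \<noteq> \<zero>}"
    have A: "finite A" "A \<subseteq> B" unfolding A_def using kf x by auto
    have cA: "{b\<in>B. c b \<noteq> \<zero>} \<subseteq> A" using a by (auto simp: A_def c_def)
    have "(\<Oplus>\<^bsub>G\<^esub>b\<in>{b\<in>B. c b \<noteq> \<zero>}. c b \<odot>\<^bsub>G\<^esub> b) = (\<Oplus>\<^bsub>G\<^esub>b\<in>A. c b \<odot>\<^bsub>G\<^esub> b)"
      using A cA kc x a by (intro sup) (auto simp: c_def)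
    also have "\<dots> = (\<Oplus>\<^bsub>G\<^esub>b\<in>A. a \<odot>\<^bsub>G\<^esub> (k x b \<odot>\<^bsub>G\<^esub> b))"
    proof (intro G.finsum_cong')
      show "(\<lambda>b. a \<odot>\<^bsub>G\<^esub> (k x b \<odot>\<^bsub>G\<^esub> b)) \<in> A \<rightarrow> carrier G"
        using A(2) Bc kc x a by (auto intro!: G.smult_closed)
      fix i assume "i \<in> A"
      then have "i \<in> B" "i \<in> carrier G" using A(2) Bc by auto
      then show "c i \<odot>\<^bsub>G\<^esub> i = a \<odot>\<^bsub>G\<^esub> (k x i \<odot>\<^bsub>G\<^esub> i)"
        using kc x a by (simp add: c_def G.smult_assoc1)
    qed simp
    also have "\<dots> = a \<odot>\<^bsub>G\<^esub> (\<Oplus>\<^bsub>G\<^esub>b\<in>A. k x b \<odot>\<^bsub>G\<^esub> b)"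
      using A Bc kc x a by (intro G.finsum_smult_ldistr[symmetric]) (auto intro!: G.smult_closed)
    also have "(\<Oplus>\<^bsub>G\<^esub>b\<in>A. k x b \<odot>\<^bsub>G\<^esub> b) = x"
      unfolding A_def by (rule ks[OF x, symmetric])
    finally have "P (a \<odot>\<^bsub>G\<^esub> x) c"
      using kc x a finite_subset[OF cA A(1)] by (auto simp: P_def c_def)
    then have "k (a \<odot>\<^bsub>G\<^esub> x) = c" using x a by (intro uniq) auto
    then show ?thesis using b by (simp add: c_def)
  qed
  show thesis by (rule that[of k]) (fact kc kf ks kadd ksm)+
qed

lemma factor_through_coord_module:
  assumes G: "free_module R G" and g: "g \<in> mod_hom R M G" and S: "finite S" "S \<subseteq> carrier M"
  obtains n pr sc where "pr \<in> mod_hom R G (coord_module n)" "sc \<in> mod_hom R (coord_module n) G"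
    "\<And>x. x \<in> S \<Longrightarrow> sc (pr (g x)) = g x"
proof -
  from G have mG: "module R G" by (simp add: free_module_def)
  interpret G: module R G by fact
  from G obtain B where B: "is_module_basis R G B" by (auto simp: free_module_def)
  then have Bc: "B \<subseteq> carrier G" by (simp add: is_module_basis_def)
  obtain k where
    kc: "\<And>x b. x \<in> carrier G \<Longrightarrow> b \<in> B \<Longrightarrow> k x b \<in> carrier R" and
    kf: "\<And>x. x \<in> carrier G \<Longrightarrow> finite {b\<in>B. k x b \<noteq> \<zero>}" and
    ks: "\<And>x. x \<in> carrier G \<Longrightarrow> x = (\<Oplus>\<^bsub>G\<^esub>b\<in>{b\<in>B. k x b \<noteq> \<zero>}. k x b \<odot>\<^bsub>G\<^esub> b)" and
    kadd: "\<And>x y b. x \<in> carrier G \<Longrightarrow> y \<in> carrier G \<Longrightarrow> b \<in> B \<Longrightarrow> k (x \<oplus>\<^bsub>G\<^esub> y) b = k x b \<oplus> k y b" and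
    ksm: "\<And>a x b. a \<in> carrier R \<Longrightarrow> x \<in> carrier G \<Longrightarrow> b \<in> B \<Longrightarrow> k (a \<odot>\<^bsub>G\<^esub> x) b = a \<otimes> k x b"
    using free_coordinates[OF mG B] by blast
  define A where "A = (\<Union>x\<in>S. {b\<in>B. k (g x) b \<noteq> \<zero>})"
  have gS: "\<And>x. x \<in> S \<Longrightarrow> g x \<in> carrier G" using mod_homD(2)[OF g] S(2) by auto
  have A: "finite A" "A \<subseteq> B" using kf gS S(1) by (auto simp: A_def)
  obtain n and e :: "nat \<Rightarrow> _" where e: "A = e ` {i. i < n}" "inj_on e {i. i < n}"
    using finite_imp_nat_seg_image_inj_on[OF A(1)] by blast
  have eB: "e i \<in> B" "e i \<in> carrier G" if "i < n" for i using that A(2) e(1) Bc by auto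
  define pr where "pr = (\<lambda>y i. if i < n then k y (e i) else \<zero>)"
  define sc where "sc = (\<lambda>v. \<Oplus>\<^bsub>G\<^esub>i\<in>{i. i < n}. v i \<odot>\<^bsub>G\<^esub> e i)"
  show thesis
  proof (rule that[of pr n sc])
    show "pr \<in> mod_hom R G (coord_module n)"
      using kc kadd ksm eB by (auto simp: mod_hom_def pr_def coord_module_def)
    show "sc \<in> mod_hom R (coord_module n) G"
      unfolding mod_hom_def
    proof (intro CollectI conjI ballI funcsetI)
      fix v assume v: "v \<in> carrier (coord_module n)"
      then have vc: "\<And>i. v i \<in> carrier R" by (simp add: coord_module_def)
      show "sc v \<in> carrier G" unfolding sc_def using vc eB by (intro G.finsum_closed) auto
      { fix w assume w: "w \<in> carrier (coord_module n)"
        then have wc: "\<And>i. w i \<in> carrier R" by (simp add: coord_module_def)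
        have "sc (v \<oplus>\<^bsub>coord_module n\<^esub> w) = (\<Oplus>\<^bsub>G\<^esub>i\<in>{i. i < n}. v i \<odot>\<^bsub>G\<^esub> e i \<oplus>\<^bsub>G\<^esub> w i \<odot>\<^bsub>G\<^esub> e i)"
          unfolding sc_def using vc wc eB
          by (intro G.finsum_cong') (auto simp: coord_module_def G.smult_l_distr)
        also have "\<dots> = sc v \<oplus>\<^bsub>G\<^esub> sc w"
          unfolding sc_def using vc wc eB by (intro G.finsum_addf) auto
        finally show "sc (v \<oplus>\<^bsub>coord_module n\<^esub> w) = sc v \<oplus>\<^bsub>G\<^esub> sc w" . }
    next
      fix a v assume a: "a \<in> carrier R" and v: "v \<in> carrier (coord_module n)"
      then have vc: "\<And>i. v i \<in> carrier R" by (simp add: coord_module_def)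
      have "sc (a \<odot>\<^bsub>coord_module n\<^esub> v) = (\<Oplus>\<^bsub>G\<^esub>i\<in>{i. i < n}. a \<odot>\<^bsub>G\<^esub> (v i \<odot>\<^bsub>G\<^esub> e i))"
        unfolding sc_def using a vc eB
        by (intro G.finsum_cong') (auto simp: coord_module_def G.smult_assoc1)
      also have "\<dots> = a \<odot>\<^bsub>G\<^esub> sc v"
        unfolding sc_def using a vc eB by (intro G.finsum_smult_ldistr[symmetric]) auto
      finally show "sc (a \<odot>\<^bsub>coord_module n\<^esub> v) = a \<odot>\<^bsub>G\<^esub> sc v" .
    qed
    fix x assume x: "x \<in> S"
    have "sc (pr (g x)) = (\<Oplus>\<^bsub>G\<^esub>i\<in>{i. i < n}. k (g x) (e i) \<odot>\<^bsub>G\<^esub> e i)"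
      unfolding sc_def using eB kc gS[OF x] by (intro G.finsum_cong') (auto simp: pr_def)
    also have "\<dots> = (\<Oplus>\<^bsub>G\<^esub>b\<in>A. k (g x) b \<odot>\<^bsub>G\<^esub> b)"
      unfolding e(1) using e(2) eB kc gS[OF x] by (subst G.add.finprod_reindex) auto
    also have "\<dots> = (\<Oplus>\<^bsub>G\<^esub>b\<in>{b\<in>B. k (g x) b \<noteq> \<zero>}. k (g x) b \<odot>\<^bsub>G\<^esub> b)"
    proof (rule G.add.finprod_mono_neutral_cong_left[symmetric, OF A(1)])
      show "{b\<in>B. k (g x) b \<noteq> \<zero>} \<subseteq> A" using x by (auto simp: A_def)
        fix i assume "i \<in> A - {b \<in> B. k (g x) b \<noteq> \<zero>}"
        then have "k (g x) i = \<zero>" "i \<in> carrier G" using A(2) Bc by auto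
        then show "k (g x) i \<odot>\<^bsub>G\<^esub> i = \<zero>\<^bsub>G\<^esub>" by simp
      next
      show "(\<lambda>b. k (g x) b \<odot>\<^bsub>G\<^esub> b) \<in> A \<rightarrow> carrier G"
        using A(2) Bc kc gS[OF x] by (auto intro!: G.smult_closed)
    qed simp
    also have "\<dots> = g x" by (rule ks[OF gS[OF x], symmetric])
    finally show "sc (pr (g x)) = g x" .
  qed
qed

lemma sym_carrierE:
  assumes "C \<in> carrier (sym_algebra R M)"
  obtains p where "p \<in> carrier (PR (carrier M))" "C = sym_ideal R M +>\<^bsub>PR (carrier M)\<^esub> p"
  using assms by (auto simp: sym_algebra_def FactRing_def A_RCOSETS_def')

lemma rees_ideal_subset_sym_kernel:
  assumes M: "module R M" and G: "free_module R G" and g: "g \<in> mod_hom R M G"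
  shows "rees_ideal R M \<subseteq> sym_kernel R M G g"
proof
  fix C assume C: "C \<in> rees_ideal R M"
  from G have mG: "module R G" by (simp add: free_module_def)
  have "(\<lambda>_ _. \<zero>) \<in> mod_hom R M (coord_module 0)" by (auto simp: mod_hom_def coord_module_def)
  then have "C \<in> sym_kernel R M (coord_module 0) (\<lambda>_ _. \<zero>)"
    using C coord_module_free[of 0] unfolding rees_ideal_def by blast
  then have Cc: "C \<in> carrier (sym_algebra R M)" by (simp add: sym_kernel_def a_kernel_def')
  then obtain p where p: "p \<in> carrier (PR (carrier M))" "C = sym_ideal R M +>\<^bsub>PR (carrier M)\<^esub> p"
    by (rule sym_carrierE)
  from poly_finite_vars[OF p(1)] obtain S where S: "finite S" "S \<subseteq> carrier M" "p \<in> carrier (PR S)" by blast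
  obtain n pr sc where
    pr: "pr \<in> mod_hom R G (coord_module n)" and sc: "sc \<in> mod_hom R (coord_module n) G" and
    scpr: "\<And>x. x \<in> S \<Longrightarrow> sc (pr (g x)) = g x"
    by (rule factor_through_coord_module[OF G g S(1,2)]) (rule that)
  let ?F = "coord_module n"
  have prg: "pr \<circ> g \<in> mod_hom R M ?F" by (rule mod_hom_compose[OF g pr])
  have "C \<in> sym_kernel R M ?F (pr \<circ> g)"
    using C coord_module_free[of n] prg unfolding rees_ideal_def by fast
  then have "sym_map R ?F (pr \<circ> g) C = \<zero>\<^bsub>sym_algebra R ?F\<^esub>"
    by (simp add: sym_kernel_def a_kernel_def')
  then have z: "sym_ideal R ?F +>\<^bsub>PR (carrier ?F)\<^esub> poly_rename R (pr \<circ> g) p = \<zero>\<^bsub>sym_algebra R ?F\<^esub>"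
    using sym_map_props(1)[OF M coord_module prg p(1)] p(2) by simp
  have rc: "poly_rename R (pr \<circ> g) p \<in> carrier (PR (carrier ?F))"
    by (rule rename_closed[OF p(1) mod_homD(1)[OF prg]])
  interpret h: ring_hom_ring "sym_algebra R ?F" "sym_algebra R G" "sym_map R G sc"
    by (intro ring_hom_ringI2 sym_map_props(2) cring.axioms(1)[OF sym_cring] coord_module mG sc)
  have "sym_map R G sc (sym_ideal R ?F +>\<^bsub>PR (carrier ?F)\<^esub> poly_rename R (pr \<circ> g) p) = \<zero>\<^bsub>sym_algebra R G\<^esub>"
    unfolding z by simp
  then have "sym_ideal R G +>\<^bsub>PR (carrier G)\<^esub> poly_rename R sc (poly_rename R (pr \<circ> g) p) = \<zero>\<^bsub>sym_algebra R G\<^esub>"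
    using sym_map_props(1)[OF coord_module mG sc rc] by simp
  also have "poly_rename R sc (poly_rename R (pr \<circ> g) p) = poly_rename R g p"
    using mod_homD(1)[OF prg] S(2) scpr by (intro rename_comp_on[OF S(3)]) auto
  finally have "sym_map R G g C = \<zero>\<^bsub>sym_algebra R G\<^esub>"
    using sym_map_props(1)[OF M mG g p(1)] p(2) by simp
  then show "C \<in> sym_kernel R M G g" using Cc by (simp add: sym_kernel_def a_kernel_def')
qed

lemma rees_ideal_ideal:
  assumes M: "module R M"
  shows "ideal (rees_ideal R M) (sym_algebra R M)"
proof -
  interpret S: cring "sym_algebra R M" by (rule sym_cring[OF M])
  have "(\<lambda>_ _. \<zero>) \<in> mod_hom R M (coord_module 0)" by (auto simp: mod_hom_def coord_module_def)
  then show ?thesis unfolding rees_ideal_def using coord_module_free[of 0]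
    by (intro S.i_Intersect) (auto intro!: sym_kernel_ideal[OF M] simp: free_module_def)
qed

lemma rees_natural_map_epi:
  assumes M: "module R M" and G: "free_module R G" and g: "g \<in> mod_hom R M G"
  shows "cring (rees_algebra R M)" "cring (rees_algebra_of_map R M G g)"
    "rees_natural_map R G g \<in> ring_hom (rees_algebra R M) (rees_algebra_of_map R M G g)"
    "rees_natural_map R G g ` carrier (rees_algebra R M) = carrier (rees_algebra_of_map R M G g)"
    "\<And>C. C \<in> carrier (sym_algebra R M) \<Longrightarrow>
      rees_natural_map R G g (rees_ideal R M +>\<^bsub>sym_algebra R M\<^esub> C) = sym_map R G g C"
proof -
  from G have mG: "module R G" by (simp add: free_module_def)
  interpret L: ideal "rees_ideal R M" "sym_algebra R M" by (rule rees_ideal_ideal[OF M])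
  interpret h: ring_hom_ring "sym_algebra R M" "sym_algebra R G" "sym_map R G g"
    by (intro ring_hom_ringI2 sym_map_props(2) cring.axioms(1)[OF sym_cring] M mG g)
  show 1: "cring (rees_algebra R M)" unfolding rees_algebra_def by (rule L.quotient_is_cring[OF sym_cring[OF M]])
  show 2: "cring (rees_algebra_of_map R M G g)"
    unfolding rees_algebra_of_map_def by (rule ring_hom_ring.img_is_cring[OF h.ring_hom_ring_axioms sym_cring[OF mG]])
  have hom: "sym_map R G g \<in> ring_hom (sym_algebra R M) (rees_algebra_of_map R M G g)"
    by (auto simp: ring_hom_def rees_algebra_of_map_def)
  have 0: "\<And>i. i \<in> rees_ideal R M \<Longrightarrow> sym_map R G g i = \<zero>\<^bsub>rees_algebra_of_map R M G g\<^esub>"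
  proof -
    fix i assume "i \<in> rees_ideal R M"
    then have "i \<in> sym_kernel R M G g" using rees_ideal_subset_sym_kernel[OF M G g] by (rule rev_subsetD)
    then have "sym_map R G g i = \<zero>\<^bsub>sym_algebra R G\<^esub>"
      unfolding sym_kernel_def a_kernel_def' mem_Collect_eq by (rule conjunct2)
    also have "\<zero>\<^bsub>sym_algebra R G\<^esub> = \<zero>\<^bsub>rees_algebra_of_map R M G g\<^esub>"
      unfolding rees_algebra_of_map_def by simp
    finally show "sym_map R G g i = \<zero>\<^bsub>rees_algebra_of_map R M G g\<^esub>" .
  qed
  note * = quotient_induced_map[OF L.ideal_axioms cring.axioms(1)[OF 2] hom 0]
  show 3: "\<And>C. C \<in> carrier (sym_algebra R M) \<Longrightarrow>
      rees_natural_map R G g (rees_ideal R M +>\<^bsub>sym_algebra R M\<^esub> C) = sym_map R G g C"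
    unfolding rees_natural_map_def by (rule *(1))
  show "rees_natural_map R G g \<in> ring_hom (rees_algebra R M) (rees_algebra_of_map R M G g)"
    unfolding rees_natural_map_def[abs_def] rees_algebra_def by (rule *(2))
  have "carrier (rees_algebra R M) = (\<lambda>C. rees_ideal R M +>\<^bsub>sym_algebra R M\<^esub> C) ` carrier (sym_algebra R M)"
    by (auto simp: rees_algebra_def FactRing_def A_RCOSETS_def')
  then show "rees_natural_map R G g ` carrier (rees_algebra R M) = carrier (rees_algebra_of_map R M G g)"
    using 3 by (simp add: image_image rees_algebra_of_map_def)
qed

end

end

theory Submission
  imports Defs
begin

text \<open>An element of the kernel is the class of some \<open>w\<close> in \<open>Sym(M)\<close> with \<open>Sym(g)(w) = 0\<close>. The claim
  follows once, for every map \<open>\<psi>\<close> from \<open>M\<close> to a free module, the coefficients of \<open>Sym(\<psi>)(w)\<close> are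
  shown to be nilpotent: the nilpotent elements of \<open>R\<close> lie in an ideal \<open>I\<close> with \<open>I\<^sup>n = 0\<close>, so a
  product of \<open>n\<close> elements of the kernel vanishes under all \<open>Sym(\<psi>)\<close>. As \<open>R\<close> is Noetherian, it is
  enough to show that the coefficients lie in every prime \<open>P = ann(c)\<close>. If all coordinates of
  \<open>g(x)\<close> lie in \<open>P\<close>, then \<open>g(cx) = 0\<close>, so \<open>cx\<close> dies in the torsionless quotient and
  \<open>c \<psi>(x) = 0\<close>, that is, the coordinates of \<open>\<psi>(x)\<close> lie in \<open>P\<close>. Over the fraction field of \<open>R / P\<close> the
  map \<open>\<psi>\<close> therefore factors through \<open>g\<close>, and \<open>Sym(g)(w) = 0\<close> gives \<open>Sym(\<psi>)(w) = 0\<close> modulo \<open>P\<close>.\<close>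

section \<open>Prime annihilators and nilpotent ideals\<close>

text \<open>Zorn's lemma applies because a nonempty chain of ideals in a Noetherian ring contains
  its own union (\<open>ideal_chain_is_trivial\<close>).\<close>

lemma (in noetherian_ring) exists_maximal_ideal:
  assumes "S \<noteq> {}" and "\<And>I. I \<in> S \<Longrightarrow> ideal I R"
  shows "\<exists>I\<in>S. \<forall>J\<in>S. I \<subseteq> J \<longrightarrow> J = I"
proof (rule subset_Zorn_nonempty[OF assms(1)])
  fix C assume "C \<noteq> {}" "subset.chain S C"
  then have "\<Union>C \<in> C" "C \<subseteq> S"
    using ideal_chain_is_trivial[of C] assms(2) by (auto simp: subset_chain_def)
  then show "\<Union>C \<in> S" by blast
qed

text \<open>In the semiring of ideals the unit is the whole ring, so ideal powers start from
  \<open>carrier B\<close>.\<close>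

lemma ideal_power_0: "K [^]\<^bsub>ideals_set B\<^esub> (0::nat) = carrier B"
  and ideal_power_Suc: "K [^]\<^bsub>ideals_set B\<^esub> Suc n = ideal_prod B (K [^]\<^bsub>ideals_set B\<^esub> n) K"
  by (simp_all add: nat_pow_def ideals_set_def)

lemma (in ring) ideal_power_ideal: "ideal K R \<Longrightarrow> ideal (K [^]\<^bsub>ideals_set R\<^esub> (n::nat)) R"
  by (induction n) (simp_all only: ideal_power_0 ideal_power_Suc oneideal ideal_prod_is_ideal)

text \<open>An induction principle for ideal powers. Elements of \<open>ideal_prod\<close> are built
  from products by sums, so a family \<open>L\<close> that is closed under addition and moves up one
  step under multiplication by \<open>f y\<close> with \<open>y\<close> in \<open>K\<close> follows
  the powers of \<open>K\<close>. It serves inside \<open>R\<close>, with \<open>f\<close> the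
  identity, and for the maps from the Rees algebra to polynomial rings.\<close>

lemma ideal_power_image_subset:
  assumes "ring B" and K: "ideal K B" and f: "f \<in> ring_hom B C"
    and base: "f ` carrier B \<subseteq> L 0"
    and add: "\<And>n x y. x \<in> L n \<Longrightarrow> y \<in> L n \<Longrightarrow> x \<oplus>\<^bsub>C\<^esub> y \<in> L n"
    and mult: "\<And>n x y. x \<in> L n \<Longrightarrow> y \<in> K \<Longrightarrow> x \<otimes>\<^bsub>C\<^esub> f y \<in> L (Suc n)"
  shows "f ` (K [^]\<^bsub>ideals_set B\<^esub> (n::nat)) \<subseteq> L n"
proof (induction n)
  case 0
  then show ?case using base by (simp only: ideal_power_0)
next
  case (Suc n)
  interpret B: ring B by fact
  note I = B.ideal_power_ideal[OF K]
  note carr = ideal.Icarr[OF I] ideal.Icarr[OF K] subsetD[OF B.ideal_prod_in_carrier[OF I[of n] K]]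
  have "f z \<in> L (Suc n)" if "z \<in> ideal_prod B (K [^]\<^bsub>ideals_set B\<^esub> n) K" for z
    using that
  proof induction
    case (prod i j)
    then show ?case
      using Suc mult[of "f i" n j] carr ring_hom_mult[OF f, of i j] by (simp add: image_subset_iff)
  next
    case (sum s t)
    then show ?case
      using add[of "f s" "Suc n" "f t"] carr ring_hom_add[OF f, of s t] by simp
  qed
  then show ?case by (auto simp only: ideal_power_Suc)
qed

lemma (in ideal) finsum_mem:
  assumes "finite A" "f \<in> A \<rightarrow> I"
  shows "(\<Oplus>i\<in>A. f i) \<in> I"
  using assms
proof (induction A)
  case (insert x A)
  then have "f \<in> A \<rightarrow> carrier R" "f x \<in> carrier R" by (auto intro: Icarr)
  with insert show ?case by (simp add: Pi_iff)
qed simp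

section \<open>Nilpotent elements of a Noetherian ring\<close>

context cring begin

definition ann :: "'a \<Rightarrow> 'a set"
  where "ann c = {a \<in> carrier R. a \<otimes> c = \<zero>}"

lemma ann_ideal:
  assumes "c \<in> carrier R" shows "ideal (ann c) R"
proof (rule idealI[OF ring_axioms])
  show "subgroup (ann c) (add_monoid R)"
    using assms by (intro add.subgroupI) (auto simp: ann_def l_distr l_minus simp flip: a_inv_def)
next
  fix a x assume "a \<in> ann c" "x \<in> carrier R"
  then show "x \<otimes> a \<in> ann c" using assms by (simp add: ann_def m_assoc)
  with \<open>a \<in> ann c\<close> \<open>x \<in> carrier R\<close> show "a \<otimes> x \<in> ann c" by (simp add: ann_def m_comm)
qed

text \<open>Stabilisation of the annihilators of \<open>a\<^sup>k\<close> makes \<open>a\<close> a nonzerodivisor on \<open>a\<^sup>k R\<close>; if that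
  ideal were nonzero, a maximal annihilator of its elements would be a prime containing \<open>a\<close>.\<close>

lemma nilpotent_if_in_prime_annihilators:
  assumes N: "noetherian_ring R" and a: "a \<in> carrier R"
    and P: "\<And>c. c \<in> carrier R \<Longrightarrow> primeideal (ann c) R \<Longrightarrow> a \<in> ann c"
  shows "\<exists>k::nat. a [^] k = \<zero>"
proof (rule ccontr)
  assume nz: "\<nexists>k::nat. a [^] k = \<zero>"
  have "\<exists>I\<in>range (\<lambda>k::nat. ann (a [^] k)). \<forall>J\<in>range (\<lambda>k::nat. ann (a [^] k)). I \<subseteq> J \<longrightarrow> J = I"
    using a by (intro noetherian_ring.exists_maximal_ideal[OF N]) (auto intro: ann_ideal)
  then obtain k :: nat where k: "\<And>l::nat. ann (a [^] k) \<subseteq> ann (a [^] l) \<Longrightarrow> ann (a [^] l) = ann (a [^] k)"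
    by auto
  have "ann (a [^] k) \<subseteq> ann (a [^] Suc k)"
    using a by (auto simp: ann_def simp flip: m_assoc)
  then have stab: "ann (a [^] Suc k) = ann (a [^] k)" by (rule k)
  define S where "S = {c. (\<exists>r\<in>carrier R. c = r \<otimes> a [^] k) \<and> c \<noteq> \<zero>}"
  have Sc: "c \<in> carrier R" if "c \<in> S" for c using that a by (auto simp: S_def)
  have "a [^] k \<in> S" using a nz by (auto simp: S_def intro!: bexI[of _ \<one>])
  then have "\<exists>I\<in>ann ` S. \<forall>J\<in>ann ` S. I \<subseteq> J \<longrightarrow> J = I"
    using Sc by (intro noetherian_ring.exists_maximal_ideal[OF N]) (auto intro: ann_ideal)
  then obtain c where c: "c \<in> S" and max: "\<And>b. b \<in> S \<Longrightarrow> ann c \<subseteq> ann b \<Longrightarrow> ann b = ann c" by auto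
  have cc: "c \<in> carrier R" by (rule Sc[OF c])
  have "primeideal (ann c) R"
  proof (rule primeidealI[OF ann_ideal[OF cc] is_cring])
    have "\<one> \<notin> ann c" using c cc by (simp add: ann_def S_def)
    then show "carrier R \<noteq> ann c" by blast
    fix x y assume x: "x \<in> carrier R" and y: "y \<in> carrier R" and xy: "x \<otimes> y \<in> ann c"
    show "x \<in> ann c \<or> y \<in> ann c"
    proof (cases "y \<in> ann c")
      case False
      then have "y \<otimes> c \<noteq> \<zero>" using y by (simp add: ann_def)
      \<comment> \<open>The annihilator of \<open>y \<otimes> c\<close> contains that of
        \<open>c\<close>, so by maximality the two agree; the former contains
        \<open>x\<close>.\<close>
      then have "y \<otimes> c \<in> S" using c y a by (auto simp: S_def simp flip: m_assoc)
      moreover have "ann c \<subseteq> ann (y \<otimes> c)" using cc y by (auto simp: ann_def m_lcomm[of _ y c])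
      ultimately have "ann (y \<otimes> c) = ann c" by (rule max)
      moreover have "x \<in> ann (y \<otimes> c)" using xy x y cc by (simp add: ann_def m_assoc)
      ultimately show ?thesis by simp
    qed simp
  qed
  then have "a \<in> ann c" by (rule P[OF cc])
  moreover obtain r where r: "r \<in> carrier R" "c = r \<otimes> a [^] k" using c by (auto simp: S_def)
  \<comment> \<open>As \<open>a\<close> kills \<open>c\<close>, the factor \<open>r\<close> kills
    the power \<open>Suc k\<close> of \<open>a\<close> and, by \<open>stab\<close>, already the
    power \<open>k\<close>.\<close>
  ultimately have "r \<in> ann (a [^] Suc k)" using a by (simp add: ann_def m_ac)
  then have "c = \<zero>" unfolding stab using r by (simp add: ann_def)
  then show False using c by (simp add: S_def)
qed

text \<open>Take \<open>I\<close> maximal among the ideals with a vanishing power. Adding a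
  nilpotent \<open>a\<close> gives an ideal \<open>J = I + (a)\<close> that again has a vanishing
  power, so \<open>J = I\<close> and \<open>a\<close> lies in \<open>I\<close>.\<close>

lemma exists_nilpotent_ideal:
  assumes N: "noetherian_ring R"
  obtains I n where "ideal I R" "I [^]\<^bsub>ideals_set R\<^esub> (n::nat) = {\<zero>}"
    "\<And>a k. a \<in> carrier R \<Longrightarrow> a [^] (k::nat) = \<zero> \<Longrightarrow> a \<in> I"
proof -
  interpret S: semiring "ideals_set R" by (rule ideals_set_is_semiring)
  define T where "T = {I. ideal I R \<and> (\<exists>n::nat. I [^]\<^bsub>ideals_set R\<^esub> n = {\<zero>})}"
  have "{\<zero>} [^]\<^bsub>ideals_set R\<^esub> (1::nat) = {\<zero>}"
    using ideal_prod_zero[OF oneideal] by (simp only: One_nat_def ideal_power_Suc ideal_power_0)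
  then have "{\<zero>} \<in> T" unfolding T_def using zeroideal by blast
  then have "\<exists>I\<in>T. \<forall>J\<in>T. I \<subseteq> J \<longrightarrow> J = I"
    by (intro noetherian_ring.exists_maximal_ideal[OF N]) (auto simp: T_def)
  then obtain I where I: "I \<in> T" and max: "\<And>J. J \<in> T \<Longrightarrow> I \<subseteq> J \<Longrightarrow> J = I" by auto
  then obtain n :: nat where II: "ideal I R" and n: "I [^]\<^bsub>ideals_set R\<^esub> n = {\<zero>}" by (auto simp: T_def)
  interpret I: ideal I R by fact
  have "a \<in> I" if a: "a \<in> carrier R" and k: "a [^] k = \<zero>" for a and k :: nat
  proof -
    define A where "A = PIdl a"
    have A: "ideal A R" unfolding A_def by (rule cgenideal_ideal[OF a])
    define J where "J = I <+>\<^bsub>R\<^esub> A"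
    have J: "ideal J R" unfolding J_def by (rule add_ideals[OF II A])
    have sum_in: "i \<oplus> b \<in> J" if "i \<in> I" "b \<in> A" for i b
      unfolding J_def set_add_def' using that by blast
    note pow = ideal_power_ideal[OF II]
    have id: "(\<lambda>x. x) \<in> ring_hom R R" by (rule ring_hom_memI) auto
    \<comment> \<open>Modulo \<open>(a)\<close> the ideals \<open>J\<close> and \<open>I\<close>
      agree, so each power of \<open>J\<close> lies in the same power of \<open>I\<close> plus
      \<open>(a)\<close>. For the exponent \<open>n\<close> only \<open>(a)\<close> is left.\<close>
    have "(\<lambda>x. x) ` (J [^]\<^bsub>ideals_set R\<^esub> n) \<subseteq> I [^]\<^bsub>ideals_set R\<^esub> n <+>\<^bsub>R\<^esub> A"
    proof (rule ideal_power_image_subset[OF ring_axioms J id])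
      show "(\<lambda>x. x) ` carrier R \<subseteq> I [^]\<^bsub>ideals_set R\<^esub> (0::nat) <+>\<^bsub>R\<^esub> A"
      proof -
        have "x \<in> carrier R <+>\<^bsub>R\<^esub> A" if "x \<in> carrier R" for x
          unfolding set_add_def' using that r_zero[OF that] additive_subgroup.zero_closed[OF ideal.axioms(1)[OF A]]
          by (metis (mono_tags, lifting) UN_I singletonI)
        then show ?thesis unfolding ideal_power_0 by blast
      qed
    next
      fix m :: nat and x y
      assume "x \<in> I [^]\<^bsub>ideals_set R\<^esub> m <+>\<^bsub>R\<^esub> A" "y \<in> I [^]\<^bsub>ideals_set R\<^esub> m <+>\<^bsub>R\<^esub> A"
      then show "x \<oplus> y \<in> I [^]\<^bsub>ideals_set R\<^esub> m <+>\<^bsub>R\<^esub> A"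
        by (rule additive_subgroup.a_closed[OF ideal.axioms(1)[OF add_ideals[OF pow A]]])
    next
      fix m :: nat and x y
      assume "x \<in> I [^]\<^bsub>ideals_set R\<^esub> m <+>\<^bsub>R\<^esub> A" "y \<in> J"
      then obtain i b i' b' where x: "i \<in> I [^]\<^bsub>ideals_set R\<^esub> m" "b \<in> A" "x = i \<oplus> b"
        and y: "i' \<in> I" "b' \<in> A" "y = i' \<oplus> b'"
        unfolding J_def set_add_def' by blast
      note c = ideal.Icarr[OF pow x(1)] ideal.Icarr[OF A x(2)] ideal.Icarr[OF II y(1)] ideal.Icarr[OF A y(2)]
      have "x \<otimes> y = i \<otimes> i' \<oplus> (i \<otimes> b' \<oplus> b \<otimes> (i' \<oplus> b'))"
        using c by (simp add: x y l_distr r_distr a_ac)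
      moreover have "i \<otimes> i' \<in> I [^]\<^bsub>ideals_set R\<^esub> Suc m"
        unfolding ideal_power_Suc using x y by (intro ideal_prod.prod)
      moreover have "i \<otimes> b' \<oplus> b \<otimes> (i' \<oplus> b') \<in> A"
        using c by (intro additive_subgroup.a_closed[OF ideal.axioms(1)[OF A]]
          ideal.I_l_closed[OF A y(2)] ideal.I_r_closed[OF A x(2)]) auto
      ultimately show "x \<otimes> y \<in> I [^]\<^bsub>ideals_set R\<^esub> Suc m <+>\<^bsub>R\<^esub> A"
        unfolding set_add_def' by blast
    qed
    then have Jn: "J [^]\<^bsub>ideals_set R\<^esub> n \<subseteq> A"
      using ideal.Icarr[OF A] by (auto simp: n set_add_def')
    \<comment> \<open>Since \<open>J^n\<close> lies in \<open>(a)\<close>, its power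
      \<open>k\<close> consists of multiples of \<open>a^k\<close>, and these are zero.\<close>
    have "(\<lambda>x. x) ` ((J [^]\<^bsub>ideals_set R\<^esub> n) [^]\<^bsub>ideals_set R\<^esub> k) \<subseteq> {r \<otimes> a [^] k | r. r \<in> carrier R}"
    proof (rule ideal_power_image_subset[OF ring_axioms ideal_power_ideal[OF J] id, where L = "\<lambda>k. {r \<otimes> a [^] k | r. r \<in> carrier R}"])
      show "(\<lambda>x. x) ` carrier R \<subseteq> {r \<otimes> a [^] (0::nat) | r. r \<in> carrier R}" by force
    next
      fix m :: nat and x y
      assume "x \<in> {r \<otimes> a [^] m | r. r \<in> carrier R}" "y \<in> {r \<otimes> a [^] m | r. r \<in> carrier R}"
      then obtain r s where "r \<in> carrier R" "s \<in> carrier R" "x = r \<otimes> a [^] m" "y = s \<otimes> a [^] m" by blast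
      then have "x \<oplus> y = (r \<oplus> s) \<otimes> a [^] m" "r \<oplus> s \<in> carrier R" using a by (auto simp: l_distr)
      then show "x \<oplus> y \<in> {r \<otimes> a [^] m | r. r \<in> carrier R}" by blast
    next
      fix m :: nat and x y
      assume x: "x \<in> {r \<otimes> a [^] m | r. r \<in> carrier R}" and "y \<in> J [^]\<^bsub>ideals_set R\<^esub> n"
      then have "y \<in> A" using Jn by blast
      with x obtain r s where "r \<in> carrier R" "s \<in> carrier R" "x = r \<otimes> a [^] m" "y = s \<otimes> a"
        unfolding A_def cgenideal_def by blast
      then have "x \<otimes> y = (r \<otimes> s) \<otimes> a [^] Suc m" "r \<otimes> s \<in> carrier R" using a by (auto simp: m_ac)
      then show "x \<otimes> y \<in> {r \<otimes> a [^] Suc m | r. r \<in> carrier R}" by blast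
    qed
    moreover have "(J [^]\<^bsub>ideals_set R\<^esub> n) [^]\<^bsub>ideals_set R\<^esub> k = J [^]\<^bsub>ideals_set R\<^esub> (n * k)"
      using J by (intro S.nat_pow_pow) (simp add: ideals_set_def)
    ultimately have "J [^]\<^bsub>ideals_set R\<^esub> (n * k) \<subseteq> {\<zero>}" using k by auto
    then have "J [^]\<^bsub>ideals_set R\<^esub> (n * k) = {\<zero>}"
      using additive_subgroup.zero_closed[OF ideal.axioms(1)[OF ideal_power_ideal[OF J]]] by blast
    then have "J \<in> T" using J by (auto simp: T_def)
    moreover have "I \<subseteq> J"
    proof
      fix x assume x: "x \<in> I"
      have "x \<oplus> \<zero> \<in> J" by (rule sum_in[OF x additive_subgroup.zero_closed[OF ideal.axioms(1)[OF A]]])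
      then show "x \<in> J" using ideal.Icarr[OF II x] by simp
    qed
    ultimately have "J = I" by (rule max)
    moreover have "a \<in> J"
      using sum_in[OF additive_subgroup.zero_closed[OF ideal.axioms(1)[OF II]] cgenideal_self[OF a, folded A_def]] a
      by simp
    ultimately show ?thesis by simp
  qed
  then show ?thesis using that II n by blast
qed

end

section \<open>Functionals modulo a prime\<close>

context cring begin

text \<open>Over the fraction field of \<open>R / P\<close> this is the fact that a linear functional vanishing on the
  common kernel of finitely many others is a linear combination of them; \<open>d\<close> is a common denominator.\<close>

lemma functionals_span_mod_prime:
  fixes N :: "((nat \<Rightarrow> 'a) \<times> ('k \<Rightarrow> 'a)) set"
  assumes P: "primeideal P R"
    and carr: "\<And>f h i. (f, h) \<in> N \<Longrightarrow> f i \<in> carrier R" "\<And>f h k. (f, h) \<in> N \<Longrightarrow> h k \<in> carrier R"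
    and comb: "\<And>a b f h f' h'. a \<in> carrier R \<Longrightarrow> b \<in> carrier R \<Longrightarrow> (f, h) \<in> N \<Longrightarrow> (f', h') \<in> N \<Longrightarrow>
      (\<lambda>i. a \<otimes> f i \<oplus> b \<otimes> f' i, \<lambda>k. a \<otimes> h k \<oplus> b \<otimes> h' k) \<in> N"
    and ker: "\<And>f h k. (f, h) \<in> N \<Longrightarrow> (\<And>j. j < n \<Longrightarrow> f j \<in> P) \<Longrightarrow> h k \<in> P"
  shows "\<exists>d e. d \<in> carrier R - P \<and> (\<forall>j k. e j k \<in> carrier R) \<and>
    (\<forall>f h k. (f, h) \<in> N \<longrightarrow> d \<otimes> h k \<ominus> (\<Oplus>j\<in>{..<n}. f j \<otimes> e j k) \<in> P)"
  using carr comb ker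
proof (induction n arbitrary: N)
  case 0
  interpret P: primeideal P R by (rule P)
  \<comment> \<open>Without coordinates the kernel condition puts every \<open>h k\<close> into
    \<open>P\<close>, so \<open>d = 1\<close> and the empty sum suffice.\<close>
  have "\<one> \<notin> P" using P.I_notcarr P.one_imp_carrier by blast
  moreover have "\<one> \<otimes> h k \<ominus> \<zero> \<in> P" if "(f, h) \<in> N" for f h k
    using 0(2,4)[OF that] by (simp add: a_minus_def)
  ultimately show ?case by (intro exI[of _ \<one>] exI[of _ "\<lambda>_ _. \<zero>"]) auto
next
  case (Suc n)
  interpret P: primeideal P R by (rule P)
  note fc = Suc.prems(1) and hc = Suc.prems(2) and comb = Suc.prems(3)
  \<comment> \<open>Where the last coordinate lies in \<open>P\<close>, the first \<open>n\<close>
    coordinates alone control \<open>h\<close>, so the induction hypothesis applies.\<close>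
  define N' where "N' = {(f, h) \<in> N. f n \<in> P}"
  have "\<exists>d e. d \<in> carrier R - P \<and> (\<forall>j k. e j k \<in> carrier R) \<and>
    (\<forall>f h k. (f, h) \<in> N' \<longrightarrow> d \<otimes> h k \<ominus> (\<Oplus>j\<in>{..<n}. f j \<otimes> e j k) \<in> P)"
  proof (rule Suc.IH)
    fix f h k assume "(f, h) \<in> N'" "\<And>j. j < n \<Longrightarrow> f j \<in> P"
    then show "h k \<in> P" using Suc.prems(4)[of f h k] by (auto simp: N'_def less_Suc_eq)
  qed (auto simp: N'_def fc hc comb P.I_l_closed)
  then obtain d e where d: "d \<in> carrier R" "d \<notin> P" and e: "\<And>j k. e j k \<in> carrier R"
    and de: "\<And>f h k. (f, h) \<in> N' \<Longrightarrow> d \<otimes> h k \<ominus> (\<Oplus>j\<in>{..<n}. f j \<otimes> e j k) \<in> P" by blast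
  \<comment> \<open>The error of the relation found on \<open>N'\<close>, now measured on all of
    \<open>N\<close>.\<close>
  define \<omega> where "\<omega> = (\<lambda>f h k. d \<otimes> h k \<ominus> (\<Oplus>j\<in>{..<n}. f j \<otimes> e j k))"
  have \<omega>c: "\<omega> f h k \<in> carrier R" if "(f, h) \<in> N" for f h k
    using fc[OF that] hc[OF that] d e by (simp add: \<omega>_def)
  show ?case
  proof (cases "N' = N")
    case True
    have "(\<Oplus>j\<in>{..<Suc n}. f j \<otimes> (e(n := \<lambda>_. \<zero>)) j k) = (\<Oplus>j\<in>{..<n}. f j \<otimes> e j k)" if "(f, h) \<in> N" for f h k
    proof -
      have "(\<Oplus>j\<in>{..<n}. f j \<otimes> (e(n := \<lambda>_. \<zero>)) j k) = (\<Oplus>j\<in>{..<n}. f j \<otimes> e j k)"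
        using fc[OF that] e by (intro finsum_cong') auto
      then show ?thesis using fc[OF that] e by (simp add: lessThan_Suc Pi_iff)
    qed
    then show ?thesis using d e de True
      by (intro exI[of _ d] exI[of _ "e(n := \<lambda>_. \<zero>)"]) auto
  next
    case False
    \<comment> \<open>Gaussian elimination with pivot \<open>f0 n\<close>. The pivot does not depend
      on \<open>k\<close>, so the single denominator \<open>f0 n \<otimes> d\<close> serves all
      \<open>k\<close>. The coefficient of the last coordinate is the error at the pivot.\<close>
    then obtain f0 h0 where y: "(f0, h0) \<in> N" and s: "f0 n \<notin> P" by (auto simp: N'_def)
    note yc = fc[OF y] hc[OF y] \<omega>c[OF y]
    define e' where "e' = (\<lambda>j k. if j = n then \<omega> f0 h0 k else f0 n \<otimes> e j k)"
    have "(f0 n \<otimes> d) \<otimes> h k \<ominus> (\<Oplus>j\<in>{..<Suc n}. f j \<otimes> e' j k) \<in> P" if x: "(f, h) \<in> N" for f h k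
    proof -
      note xc = fc[OF x] hc[OF x] \<omega>c[OF x]
      \<comment> \<open>The combination \<open>f0 n (f, h) - f n (f0, h0)\<close> has last
        coordinate zero and so lies in \<open>N'\<close>; its old error equals the error of the new
        relation at \<open>(f, h)\<close>.\<close>
      define f1 where "f1 = (\<lambda>i. f0 n \<otimes> f i \<oplus> (\<ominus> f n) \<otimes> f0 i)"
      define h1 where "h1 = (\<lambda>k. f0 n \<otimes> h k \<oplus> (\<ominus> f n) \<otimes> h0 k)"
      have "(f1, h1) \<in> N" unfolding f1_def h1_def using xc yc by (intro comb x y) auto
      moreover have "f1 n = \<zero>" using xc yc by (simp add: f1_def l_minus m_comm[of "f n"] r_neg)
      ultimately have "(f1, h1) \<in> N'" by (simp add: N'_def)
      then have "\<omega> f1 h1 k \<in> P" unfolding \<omega>_def by (rule de)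
      also have "\<omega> f1 h1 k = f0 n \<otimes> \<omega> f h k \<ominus> f n \<otimes> \<omega> f0 h0 k"
      proof -
        have "(\<Oplus>j\<in>{..<n}. f1 j \<otimes> e j k) = (\<Oplus>j\<in>{..<n}. f0 n \<otimes> (f j \<otimes> e j k) \<oplus> (\<ominus> f n) \<otimes> (f0 j \<otimes> e j k))"
          using xc yc e by (intro finsum_cong') (auto simp: f1_def l_distr m_assoc)
        also have "\<dots> = f0 n \<otimes> (\<Oplus>j\<in>{..<n}. f j \<otimes> e j k) \<oplus> (\<ominus> f n) \<otimes> (\<Oplus>j\<in>{..<n}. f0 j \<otimes> e j k)"
          using xc yc e by (subst finsum_addf) (auto simp: finsum_rdistr)
        finally show ?thesis
          using xc yc d e unfolding \<omega>_def h1_def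
          by (simp add: a_minus_def r_distr l_minus r_minus minus_add m_ac a_ac)
      qed
      also have "\<dots> = (f0 n \<otimes> d) \<otimes> h k \<ominus> (\<Oplus>j\<in>{..<Suc n}. f j \<otimes> e' j k)"
      proof -
        have "(\<Oplus>j\<in>{..<n}. f j \<otimes> e' j k) = (\<Oplus>j\<in>{..<n}. f0 n \<otimes> (f j \<otimes> e j k))"
          using xc yc e by (intro finsum_cong') (auto simp: e'_def m_ac)
        also have "\<dots> = f0 n \<otimes> (\<Oplus>j\<in>{..<n}. f j \<otimes> e j k)"
          using xc yc e by (subst finsum_rdistr) auto
        finally have "(\<Oplus>j\<in>{..<Suc n}. f j \<otimes> e' j k) = f n \<otimes> \<omega> f0 h0 k \<oplus> f0 n \<otimes> (\<Oplus>j\<in>{..<n}. f j \<otimes> e j k)"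
          using xc yc e by (simp add: lessThan_Suc Pi_iff e'_def)
        moreover have "\<omega> f h k = d \<otimes> h k \<ominus> (\<Oplus>j\<in>{..<n}. f j \<otimes> e j k)" by (simp add: \<omega>_def)
        ultimately show ?thesis using xc yc d e
          by (simp add: a_minus_def r_distr l_minus r_minus minus_add m_ac a_ac)
      qed
      finally show ?thesis .
    qed
    moreover have "f0 n \<otimes> d \<notin> P" using P.I_prime[OF _ d(1), of "f0 n"] s d yc by blast
    moreover have "e' j k \<in> carrier R" for j k using yc e by (simp add: e'_def)
    ultimately show ?thesis using d yc
      by (intro exI[of _ "f0 n \<otimes> d"] exI[of _ e']) auto
  qed
qed

end

section \<open>Evaluation of polynomials\<close>

context cring begin

lemma indexed_var_mult:
  assumes "\<And>u. q u \<in> carrier R"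
  shows "indexed_var i \<otimes>\<^bsub>PR I\<^esub> q = indexed_pmult q i"
proof -
  have "indexed_const \<one> \<otimes>\<^bsub>PR I\<^esub> q = q" using assms by (simp add: mult_const)
  moreover have "indexed_var i \<otimes>\<^bsub>PR I\<^esub> q = indexed_pmult (indexed_const \<one> \<otimes>\<^bsub>PR I\<^esub> q) i"
    unfolding indexed_var_def using assms by (intro mult_pmult) (auto simp: indexed_const_def)
  ultimately show ?thesis by simp
qed

text \<open>Restates the inductive definition of polynomials through ring operations, so that
  homomorphism rules apply in each step.\<close>

lemma poly_ring_induct [consumes 1, case_names const add mult]:
  assumes "p \<in> carrier (PR I)"
    and "\<And>k. k \<in> carrier R \<Longrightarrow> Q (indexed_const k)"
    and "\<And>p q. p \<in> carrier (PR I) \<Longrightarrow> q \<in> carrier (PR I) \<Longrightarrow> Q p \<Longrightarrow> Q q \<Longrightarrow> Q (p \<oplus>\<^bsub>PR I\<^esub> q)"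
    and "\<And>p i. p \<in> carrier (PR I) \<Longrightarrow> i \<in> I \<Longrightarrow> Q p \<Longrightarrow> Q (indexed_var i \<otimes>\<^bsub>PR I\<^esub> p)"
  shows "Q p"
  using assms(1) unfolding poly_ring_simps(1)
proof induction
  case (indexed_padd p q)
  then show ?case using assms(3) by (simp add: poly_ring_simps)
next
  case (indexed_pmult p i)
  then have p: "p \<in> carrier (PR I)" by (simp add: poly_ring_simps)
  show ?case using assms(4)[OF p indexed_pmult(2,3)] pcoeff[OF p] by (simp add: indexed_var_mult)
qed (rule assms(2))

lemma poly_support_vars:
  assumes "p \<in> carrier (PR I)" "p u \<noteq> \<zero>" shows "set_mset u \<subseteq> I"
  using assms unfolding poly_ring_simps(1)
proof (induction arbitrary: u)
  case (indexed_pmult p i)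
  then have "i \<in># u" "p (u - {#i#}) \<noteq> \<zero>" by (auto simp: indexed_pmult_def split: if_splits)
  then show ?case using indexed_pmult.IH[of "u - {#i#}"] indexed_pmult.hyps(2)
    by (metis insert_DiffM insert_subset set_mset_add_mset_insert)
next
  case (indexed_padd p q)
  then have "p u \<noteq> \<zero> \<or> q u \<noteq> \<zero>" by (auto simp: indexed_padd_def)
  then show ?case using indexed_padd by blast
qed (auto simp: indexed_const_def split: if_splits)

text \<open>The uniqueness half of the universal property of polynomial rings: by induction over
  polynomials, two maps need to be compared on constants and variables only.\<close>

lemma poly_hom_unique:
  assumes "ring A" "f \<in> ring_hom (PR I) A" "h \<in> ring_hom (PR I) A"
    and "\<And>k. k \<in> carrier R \<Longrightarrow> f (indexed_const k) = h (indexed_const k)"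
    and "\<And>i. i \<in> I \<Longrightarrow> f (indexed_var i) = h (indexed_var i)"
    and "p \<in> carrier (PR I)"
  shows "f p = h p"
  using assms(6)
proof (induction rule: poly_ring_induct)
  case (add p q)
  then show ?case using ring_hom_add[OF assms(2)] ring_hom_add[OF assms(3)] by simp
next
  case (mult p i)
  then show ?case using ring_hom_mult[OF assms(2)] ring_hom_mult[OF assms(3)] assms(5)
    by (simp add: indexed_var_closed)
qed (rule assms(4))

lemma const_ring_hom: "indexed_const \<in> ring_hom R (PR I)"
proof (rule ring_hom_memI)
  fix x y assume "x \<in> carrier R" "y \<in> carrier R"
  then show "indexed_const (x \<otimes> y) = indexed_const x \<otimes>\<^bsub>PR I\<^esub> indexed_const y"
    by (subst mult_const) (auto simp: indexed_const_def)
qed (auto simp: poly_ring_simps indexed_pset.indexed_const indexed_padd_const)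

end

section \<open>Evaluation homomorphisms\<close>

definition monom_eval :: "('b, 'x) ring_scheme \<Rightarrow> ('i \<Rightarrow> 'b) \<Rightarrow> 'i multiset \<Rightarrow> 'b"
  where "monom_eval A a u = (\<Otimes>\<^bsub>A\<^esub>i\<in>set_mset u. a i [^]\<^bsub>A\<^esub> count u i)"

text \<open>The existence half of the universal property; \<open>\<sigma>\<close> makes
  \<open>A\<close> an \<open>R\<close>-algebra. The sum runs over the support because it has to be
  finite.\<close>

definition poly_eval ::
  "('r, 'x) ring_scheme \<Rightarrow> ('b, 'y) ring_scheme \<Rightarrow> ('r \<Rightarrow> 'b) \<Rightarrow> ('i \<Rightarrow> 'b) \<Rightarrow> ('i multiset \<Rightarrow> 'r) \<Rightarrow> 'b"
  where "poly_eval R A \<sigma> a p = (\<Oplus>\<^bsub>A\<^esub>u\<in>{u. p u \<noteq> \<zero>\<^bsub>R\<^esub>}. \<sigma> (p u) \<otimes>\<^bsub>A\<^esub> monom_eval A a u)"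

lemma (in cring) monom_eval_closed: "a \<in> set_mset u \<rightarrow> carrier R \<Longrightarrow> monom_eval R a u \<in> carrier R"
  unfolding monom_eval_def by (intro finprod_closed) auto

lemma (in cring) monom_eval_add:
  assumes "a \<in> set_mset u \<rightarrow> carrier R" "a i \<in> carrier R"
  shows "monom_eval R a (add_mset i u) = a i \<otimes> monom_eval R a u"
proof -
  \<comment> \<open>Without \<open>i\<close> the two monomials share one index set, whether or not
    \<open>i\<close> already occurs in \<open>u\<close>.\<close>
  define B where "B = set_mset u - {i}"
  have B: "finite B" "i \<notin> B" "a \<in> B \<rightarrow> carrier R" "set_mset (add_mset i u) = insert i B"
    using assms by (auto simp: B_def)
  have rest: "(\<Otimes>j\<in>B. a j [^] count (add_mset i u) j) = (\<Otimes>j\<in>B. a j [^] count u j)"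
    using B by (intro finprod_cong') auto
  have "monom_eval R a (add_mset i u) = a i [^] Suc (count u i) \<otimes> (\<Otimes>j\<in>B. a j [^] count u j)"
    unfolding monom_eval_def B(4) using B(1-3) assms rest
    by (subst finprod_insert) (auto simp del: count_add_mset simp: count_add_mset[of i u i])
  also have "monom_eval R a u = a i [^] count u i \<otimes> (\<Otimes>j\<in>B. a j [^] count u j)"
  proof (cases "i \<in># u")
    case True
    then have "set_mset u = insert i B" by (auto simp: B_def)
    then show ?thesis unfolding monom_eval_def using B assms by (simp add: Pi_iff)
  next
    case False
    then have "set_mset u = B" "count u i = 0" by (auto simp: B_def count_eq_zero_iff)
    then show ?thesis unfolding monom_eval_def using B assms by (auto simp: Pi_iff intro!: finprod_closed)
  qed
  ultimately show ?thesis using B assms 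
    by (simp add: m_ac Pi_iff finprod_closed)
qed

locale poly_evaluation = R: cring R + A: cring A
  for R :: "('r, 'x) ring_scheme" and A :: "('b, 'y) ring_scheme" +
  fixes I :: "'i set" and \<sigma> :: "'r \<Rightarrow> 'b" and a :: "'i \<Rightarrow> 'b"
  assumes \<sigma>: "\<sigma> \<in> ring_hom R A" and a: "a \<in> I \<rightarrow> carrier A"
begin

abbreviation "P \<equiv> poly_ring R I"
abbreviation "ev \<equiv> poly_eval R A \<sigma> a"

sublocale \<sigma>: ring_hom_ring R A \<sigma>
  by (intro ring_hom_ringI2 R.ring_axioms A.ring_axioms \<sigma>)

lemma monom_closed: "set_mset u \<subseteq> I \<Longrightarrow> monom_eval A a u \<in> carrier A"
  using a by (intro A.monom_eval_closed) auto

text \<open>Lets the sums for several polynomials run over one common set of monomials.\<close>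

lemma eval_superset:
  assumes "finite B" "{u. p u \<noteq> \<zero>\<^bsub>R\<^esub>} \<subseteq> B" "\<And>u. u \<in> B \<Longrightarrow> set_mset u \<subseteq> I" "\<And>u. p u \<in> carrier R"
  shows "ev p = (\<Oplus>\<^bsub>A\<^esub>u\<in>B. \<sigma> (p u) \<otimes>\<^bsub>A\<^esub> monom_eval A a u)"
  unfolding poly_eval_def using assms monom_closed
  by (intro A.add.finprod_mono_neutral_cong_left) auto

lemma eval_closed: "p \<in> carrier P \<Longrightarrow> ev p \<in> carrier A"
  unfolding poly_eval_def using R.pcoeff[of p I] R.poly_support_vars[of p I] monom_closed
  by (intro A.finsum_closed) auto

lemma eval_const: "k \<in> carrier R \<Longrightarrow> ev (ring.indexed_const R k) = \<sigma> k"
  by (subst eval_superset[of "{{#}}"]) (auto simp: R.indexed_const_def monom_eval_def)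

lemma eval_add:
  assumes p: "p \<in> carrier P" and q: "q \<in> carrier P"
  shows "ev (p \<oplus>\<^bsub>P\<^esub> q) = ev p \<oplus>\<^bsub>A\<^esub> ev q"
proof -
  define B where "B = {u. p u \<noteq> \<zero>\<^bsub>R\<^esub>} \<union> {u. q u \<noteq> \<zero>\<^bsub>R\<^esub>}"
  have B: "finite B" unfolding B_def using p q R.poly_finite_support by blast
  have BI: "set_mset u \<subseteq> I" if "u \<in> B" for u
    using that R.poly_support_vars[OF p] R.poly_support_vars[OF q] by (auto simp: B_def)
  note c = R.pcoeff[OF p] R.pcoeff[OF q] monom_closed[OF BI]
  have "ev (p \<oplus>\<^bsub>P\<^esub> q) = (\<Oplus>\<^bsub>A\<^esub>u\<in>B. \<sigma> (p u \<oplus>\<^bsub>R\<^esub> q u) \<otimes>\<^bsub>A\<^esub> monom_eval A a u)"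
    using c BI by (subst eval_superset[OF B]) (auto simp: R.poly_ring_simps R.indexed_padd_def B_def)
  also have "\<dots> = (\<Oplus>\<^bsub>A\<^esub>u\<in>B. \<sigma> (p u) \<otimes>\<^bsub>A\<^esub> monom_eval A a u \<oplus>\<^bsub>A\<^esub> \<sigma> (q u) \<otimes>\<^bsub>A\<^esub> monom_eval A a u)"
    using c by (intro A.finsum_cong') (auto simp: A.l_distr)
  also have "\<dots> = (\<Oplus>\<^bsub>A\<^esub>u\<in>B. \<sigma> (p u) \<otimes>\<^bsub>A\<^esub> monom_eval A a u) \<oplus>\<^bsub>A\<^esub> (\<Oplus>\<^bsub>A\<^esub>u\<in>B. \<sigma> (q u) \<otimes>\<^bsub>A\<^esub> monom_eval A a u)"
    using c by (intro A.finsum_addf) auto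
  also have "(\<Oplus>\<^bsub>A\<^esub>u\<in>B. \<sigma> (p u) \<otimes>\<^bsub>A\<^esub> monom_eval A a u) = ev p"
    using c BI by (intro eval_superset[symmetric] B) (auto simp: B_def)
  also have "(\<Oplus>\<^bsub>A\<^esub>u\<in>B. \<sigma> (q u) \<otimes>\<^bsub>A\<^esub> monom_eval A a u) = ev q"
    using c BI by (intro eval_superset[symmetric] B) (auto simp: B_def)
  finally show ?thesis .
qed

lemma eval_var_mult:
  assumes p: "p \<in> carrier P" and i: "i \<in> I"
  shows "ev (ring.indexed_var R i \<otimes>\<^bsub>P\<^esub> p) = a i \<otimes>\<^bsub>A\<^esub> ev p"
proof -
  define B where "B = {u. p u \<noteq> \<zero>\<^bsub>R\<^esub>}"
  have B: "finite B" unfolding B_def using p R.poly_finite_support by blast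
  have BI: "set_mset u \<subseteq> I" if "u \<in> B" for u
    using that R.poly_support_vars[OF p] by (auto simp: B_def)
  note c = R.pcoeff[OF p] monom_closed[OF BI]
  have ai: "a i \<in> carrier A" using a i by auto
  have sub: "{u. R.indexed_pmult p i u \<noteq> \<zero>\<^bsub>R\<^esub>} \<subseteq> add_mset i ` B"
  proof
    fix u assume "u \<in> {u. R.indexed_pmult p i u \<noteq> \<zero>\<^bsub>R\<^esub>}"
    then have "i \<in># u" "p (u - {#i#}) \<noteq> \<zero>\<^bsub>R\<^esub>" by (auto simp: R.indexed_pmult_def split: if_splits)
    then show "u \<in> add_mset i ` B" unfolding B_def by (intro image_eqI[of _ _ "u - {#i#}"]) auto
  qed
  have cl: "\<sigma> (p u) \<otimes>\<^bsub>A\<^esub> monom_eval A a (add_mset i u) \<in> carrier A" if "u \<in> B" for u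
    using that c(1) BI[OF that] i by (auto intro!: A.m_closed monom_closed)
  have "ev (ring.indexed_var R i \<otimes>\<^bsub>P\<^esub> p) = (\<Oplus>\<^bsub>A\<^esub>u\<in>add_mset i ` B. \<sigma> (R.indexed_pmult p i u) \<otimes>\<^bsub>A\<^esub> monom_eval A a u)"
  proof (subst R.indexed_var_mult[OF c(1)], intro eval_superset)
    fix u assume "u \<in> add_mset i ` B"
    then obtain w where "w \<in> B" "u = add_mset i w" by blast
    then show "set_mset u \<subseteq> I" using BI[of w] i by simp
  qed (use B sub c in \<open>auto simp: R.indexed_pmult_def\<close>)
  also have "\<dots> = (\<Oplus>\<^bsub>A\<^esub>u\<in>B. \<sigma> (p u) \<otimes>\<^bsub>A\<^esub> monom_eval A a (add_mset i u))"
    using cl by (subst A.finsum_reindex) (auto simp: R.indexed_pmult_def inj_on_def)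
  also have "\<dots> = (\<Oplus>\<^bsub>A\<^esub>u\<in>B. a i \<otimes>\<^bsub>A\<^esub> (\<sigma> (p u) \<otimes>\<^bsub>A\<^esub> monom_eval A a u))"
  proof (intro A.finsum_cong')
    fix u assume u: "u \<in> B"
    then have "monom_eval A a (add_mset i u) = a i \<otimes>\<^bsub>A\<^esub> monom_eval A a u"
      using a BI[OF u] ai by (intro A.monom_eval_add) auto
    then show "\<sigma> (p u) \<otimes>\<^bsub>A\<^esub> monom_eval A a (add_mset i u) = a i \<otimes>\<^bsub>A\<^esub> (\<sigma> (p u) \<otimes>\<^bsub>A\<^esub> monom_eval A a u)"
      using ai c(1) c(2)[OF u] by (simp add: A.m_lcomm)
  qed (use ai c in auto)
  also have "\<dots> = a i \<otimes>\<^bsub>A\<^esub> ev p"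
    unfolding poly_eval_def B_def[symmetric] using ai c B by (subst A.finsum_rdistr) auto
  finally show ?thesis .
qed

lemma eval_var: "i \<in> I \<Longrightarrow> ev (ring.indexed_var R i) = a i"
  using eval_var_mult[OF R.indexed_const_closed[OF R.one_closed], of i] a R.indexed_var_mult[of "R.indexed_const \<one>\<^bsub>R\<^esub>" I i]
  by (auto simp: eval_const R.indexed_var_def R.indexed_const_in_carrier[of "carrier R"] Pi_iff)

text \<open>Multiplicativity is an induction on the left factor: constants scale the coefficients,
  and a variable is moved out by \<open>eval_var_mult\<close>.\<close>

lemma eval_ring_hom: "ev \<in> ring_hom P A"
proof (rule ring_hom_memI)
  interpret P: cring P by (rule R.poly_ring_cring)
  fix p q assume p: "p \<in> carrier P" and q: "q \<in> carrier P"
  show "ev p \<in> carrier A" using p by (rule eval_closed)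
  show "ev (p \<oplus>\<^bsub>P\<^esub> q) = ev p \<oplus>\<^bsub>A\<^esub> ev q" using p q by (rule eval_add)
  show "ev (p \<otimes>\<^bsub>P\<^esub> q) = ev p \<otimes>\<^bsub>A\<^esub> ev q"
    using p
  proof (induction rule: R.poly_ring_induct)
    case (const k)
    have c: "(\<lambda>u. k \<otimes>\<^bsub>R\<^esub> q u) \<in> carrier P" using const q by (rule R.smult_closed_poly)
    define B where "B = {u. q u \<noteq> \<zero>\<^bsub>R\<^esub>}"
    have B: "finite B" unfolding B_def using q R.poly_finite_support by blast
    have BI: "set_mset u \<subseteq> I" if "u \<in> B" for u
      using that R.poly_support_vars[OF q] by (auto simp: B_def)
    note qc = R.pcoeff[OF q]
    have "ev (R.indexed_const k \<otimes>\<^bsub>P\<^esub> q) = (\<Oplus>\<^bsub>A\<^esub>u\<in>B. \<sigma> (k \<otimes>\<^bsub>R\<^esub> q u) \<otimes>\<^bsub>A\<^esub> monom_eval A a u)"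
      using const qc BI unfolding R.mult_const[OF const qc]
      by (intro eval_superset B) (auto simp: B_def)
    also have "\<dots> = (\<Oplus>\<^bsub>A\<^esub>u\<in>B. \<sigma> k \<otimes>\<^bsub>A\<^esub> (\<sigma> (q u) \<otimes>\<^bsub>A\<^esub> monom_eval A a u))"
      using const qc monom_closed[OF BI] by (intro A.finsum_cong') (auto simp: A.m_assoc)
    also have "\<dots> = \<sigma> k \<otimes>\<^bsub>A\<^esub> ev q"
      unfolding poly_eval_def B_def[symmetric] using const B qc monom_closed[OF BI]
      by (subst A.finsum_rdistr) auto
    finally show ?case using const by (simp add: eval_const)
  next
    case (add p p')
    then show ?case using q by (simp add: P.l_distr eval_add eval_closed A.l_distr)
  next
    case (mult p i)
    then show ?case using q a
      by (auto simp: P.m_assoc R.indexed_var_closed eval_var_mult eval_closed A.m_assoc Pi_iff)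
  qed
next
  show "ev \<one>\<^bsub>P\<^esub> = \<one>\<^bsub>A\<^esub>" by (simp add: R.poly_ring_simps eval_const)
qed

end

section \<open>Symmetric algebras in coordinates\<close>

text \<open>Here \<open>l\<close> is an \<open>R\<close>-linear map into \<open>A\<close>, regarded
  as an \<open>R\<close>-module through \<open>\<sigma>\<close>. These are the data from which the
  universal property of \<open>Sym(M)\<close> produces a ring map to \<open>A\<close>.\<close>

locale semilinear_map = M: module R M + \<sigma>: ring_hom_cring R A \<sigma>
  for R :: "('r, 'x) ring_scheme" and M :: "('r, 'm, 'y) module_scheme"
    and A :: "('b, 'z) ring_scheme" and \<sigma> +
  fixes l :: "'m \<Rightarrow> 'b"
  assumes closed: "x \<in> carrier M \<Longrightarrow> l x \<in> carrier A"
    and add: "x \<in> carrier M \<Longrightarrow> y \<in> carrier M \<Longrightarrow> l (x \<oplus>\<^bsub>M\<^esub> y) = l x \<oplus>\<^bsub>A\<^esub> l y"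
    and smult: "a \<in> carrier R \<Longrightarrow> x \<in> carrier M \<Longrightarrow> l (a \<odot>\<^bsub>M\<^esub> x) = \<sigma> a \<otimes>\<^bsub>A\<^esub> l x"
begin

lemma finsum_smult:
  assumes "finite B" "c \<in> B \<rightarrow> carrier R" "e \<in> B \<rightarrow> carrier M"
  shows "l (\<Oplus>\<^bsub>M\<^esub>j\<in>B. c j \<odot>\<^bsub>M\<^esub> e j) = (\<Oplus>\<^bsub>A\<^esub>j\<in>B. \<sigma> (c j) \<otimes>\<^bsub>A\<^esub> l (e j))"
  using assms
proof (induction B)
  case empty
  have "l (\<zero>\<^bsub>R\<^esub> \<odot>\<^bsub>M\<^esub> \<zero>\<^bsub>M\<^esub>) = \<zero>\<^bsub>A\<^esub>" by (subst smult) (auto simp: closed)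
  then show ?case by simp
next
  case (insert x B)
  then show ?case by (simp add: add smult closed Pi_iff)
qed

sublocale ev: poly_evaluation R A "carrier M" \<sigma> l
  by unfold_locales (auto simp: closed \<sigma>.homh)

text \<open>The generators of the ideal express additivity and homogeneity, which \<open>l\<close>
  satisfies; hence evaluation at \<open>l\<close> descends to \<open>Sym(M)\<close>.\<close>

lemma eval_sym_ideal:
  assumes "p \<in> sym_ideal R M"
  shows "poly_eval R A \<sigma> l p = \<zero>\<^bsub>A\<^esub>"
proof -
  interpret P: cring "poly_ring R (carrier M)" by (rule M.R.poly_ring_cring)
  interpret E: ring_hom_ring "poly_ring R (carrier M)" A "poly_eval R A \<sigma> l"
    by (intro ring_hom_ringI2 P.ring_axioms \<sigma>.S.ring_axioms ev.eval_ring_hom)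
  have "M.R.sym_rels M \<subseteq> a_kernel (poly_ring R (carrier M)) A (poly_eval R A \<sigma> l)"
    unfolding M.R.sym_rels_def a_kernel_def'
    by (auto simp: a_minus_def M.R.indexed_var_closed M.R.indexed_const_closed ev.eval_var
        ev.eval_const add smult closed \<sigma>.S.r_neg)
  then have "sym_ideal R M \<subseteq> a_kernel (poly_ring R (carrier M)) A (poly_eval R A \<sigma> l)"
    unfolding M.R.sym_ideal_rels by (intro P.genideal_minimal E.kernel_is_ideal)
  then show ?thesis using assms unfolding a_kernel_def' by blast
qed

end

section \<open>The symmetric algebra of \<open>R^n\<close> as a polynomial ring\<close>

context cring begin

text \<open>The degree-one part of the identification of \<open>Sym(R^n)\<close> with the polynomial
  ring in \<open>n\<close> variables.\<close>

definition linear_form :: "nat \<Rightarrow> (nat \<Rightarrow> 'a) \<Rightarrow> nat multiset \<Rightarrow> 'a"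
  where "linear_form n v =
    (\<Oplus>\<^bsub>PR {..<n}\<^esub>j\<in>{..<n}. indexed_const (v j) \<otimes>\<^bsub>PR {..<n}\<^esub> indexed_var j)"

lemma coord_carrierD: "v \<in> carrier (coord_module n) \<Longrightarrow> v i \<in> carrier R"
  by (simp add: coord_module_def)

lemma const_ring_hom_cring: "ring_hom_cring R (PR I) indexed_const"
  by (intro ring_hom_cringI ring_hom_ringI2 ring_axioms cring.axioms(1) poly_ring_cring const_ring_hom)
    (rule is_cring)

lemma linear_form_semilinear:
  "semilinear_map R (coord_module n) (PR {..<n}) indexed_const (linear_form n)"
proof -
  interpret P: cring "PR {..<n}" by (rule poly_ring_cring)
  interpret F: module R "coord_module n" by (rule coord_module)
  interpret c: ring_hom_cring R "PR {..<n}" indexed_const by (rule const_ring_hom_cring)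
  note cl = indexed_var_closed[of _ "{..<n}"] indexed_const_closed
  show ?thesis
  proof unfold_locales
    fix x y assume x: "x \<in> carrier (coord_module n)" and y: "y \<in> carrier (coord_module n)"
    show "linear_form n x \<in> carrier (PR {..<n})"
      unfolding linear_form_def using coord_carrierD[OF x] by (intro P.finsum_closed) (auto simp: cl)
    have "linear_form n (x \<oplus>\<^bsub>coord_module n\<^esub> y)
      = (\<Oplus>\<^bsub>PR {..<n}\<^esub>j\<in>{..<n}. indexed_const (x j) \<otimes>\<^bsub>PR {..<n}\<^esub> indexed_var j \<oplus>\<^bsub>PR {..<n}\<^esub> indexed_const (y j) \<otimes>\<^bsub>PR {..<n}\<^esub> indexed_var j)"
      unfolding linear_form_def using coord_carrierD[OF x] coord_carrierD[OF y]
      by (intro P.finsum_cong') (auto simp: cl coord_module_def P.l_distr)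
    also have "\<dots> = linear_form n x \<oplus>\<^bsub>PR {..<n}\<^esub> linear_form n y"
      unfolding linear_form_def using coord_carrierD[OF x] coord_carrierD[OF y]
      by (intro P.finsum_addf) (auto simp: cl)
    finally show "linear_form n (x \<oplus>\<^bsub>coord_module n\<^esub> y) = linear_form n x \<oplus>\<^bsub>PR {..<n}\<^esub> linear_form n y" .
  next
    fix a x assume a: "a \<in> carrier R" and x: "x \<in> carrier (coord_module n)"
    have "linear_form n (a \<odot>\<^bsub>coord_module n\<^esub> x)
      = (\<Oplus>\<^bsub>PR {..<n}\<^esub>j\<in>{..<n}. indexed_const a \<otimes>\<^bsub>PR {..<n}\<^esub> (indexed_const (x j) \<otimes>\<^bsub>PR {..<n}\<^esub> indexed_var j))"
      unfolding linear_form_def using a coord_carrierD[OF x]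
      by (intro P.finsum_cong') (auto simp: cl coord_module_def P.m_assoc)
    also have "\<dots> = indexed_const a \<otimes>\<^bsub>PR {..<n}\<^esub> linear_form n x"
      unfolding linear_form_def using a coord_carrierD[OF x]
      by (intro P.finsum_rdistr[symmetric]) (auto simp: cl)
    finally show "linear_form n (a \<odot>\<^bsub>coord_module n\<^esub> x) = indexed_const a \<otimes>\<^bsub>PR {..<n}\<^esub> linear_form n x" .
  qed
qed

lemma poly_finsum_coeff:
  assumes "finite A" "f \<in> A \<rightarrow> carrier (PR I)"
  shows "(\<Oplus>\<^bsub>PR I\<^esub>j\<in>A. f j) u = (\<Oplus>j\<in>A. f j u)"
proof -
  interpret P: cring "PR I" by (rule poly_ring_cring)
  show ?thesis using assms
  proof (induction A)
    case empty then show ?case by (simp add: poly_ring_simps indexed_const_def)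
  next
    case (insert x A)
    have "(\<lambda>j. f j u) \<in> A \<rightarrow> carrier R" "f x u \<in> carrier R"
      using insert pcoeff[of _ I] by (auto simp: Pi_iff)
    with insert show ?case by (simp add: Pi_iff, simp add: poly_ring_simps indexed_padd_def)
  qed
qed

text \<open>Multiplication by a variable only shifts monomials. The formula allows coefficients to
  be compared modulo a prime one monomial at a time.\<close>

lemma linear_form_mult_coeff:
  assumes v: "v \<in> carrier (coord_module n)" and q: "q \<in> carrier (PR {..<n})"
  shows "(linear_form n v \<otimes>\<^bsub>PR {..<n}\<^esub> q) u = (\<Oplus>j\<in>{..<n}. v j \<otimes> indexed_pmult q j u)"
proof -
  interpret P: cring "PR {..<n}" by (rule poly_ring_cring)
  note vc = coord_carrierD[OF v] and qc = pcoeff[OF q]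
  note cl = indexed_var_closed[of _ "{..<n}"] indexed_const_closed
  have "linear_form n v \<otimes>\<^bsub>PR {..<n}\<^esub> q
    = (\<Oplus>\<^bsub>PR {..<n}\<^esub>j\<in>{..<n}. indexed_const (v j) \<otimes>\<^bsub>PR {..<n}\<^esub> indexed_var j \<otimes>\<^bsub>PR {..<n}\<^esub> q)"
    unfolding linear_form_def using vc q by (intro P.finsum_ldistr) (auto simp: cl)
  then have "(linear_form n v \<otimes>\<^bsub>PR {..<n}\<^esub> q) u
    = (\<Oplus>j\<in>{..<n}. (indexed_const (v j) \<otimes>\<^bsub>PR {..<n}\<^esub> indexed_var j \<otimes>\<^bsub>PR {..<n}\<^esub> q) u)"
    using vc q by (simp only:) (intro poly_finsum_coeff, auto simp: cl)
  also have "\<dots> = (\<Oplus>j\<in>{..<n}. v j \<otimes> indexed_pmult q j u)"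
  proof (intro finsum_cong')
    fix j assume j: "j \<in> {..<n}"
    have pm: "indexed_pmult q j w \<in> carrier R" for w using qc by (simp add: indexed_pmult_def)
    have "indexed_const (v j) \<otimes>\<^bsub>PR {..<n}\<^esub> indexed_var j \<otimes>\<^bsub>PR {..<n}\<^esub> q = indexed_const (v j) \<otimes>\<^bsub>PR {..<n}\<^esub> indexed_pmult q j"
      using vc q j by (simp add: cl P.m_assoc indexed_var_mult[OF qc])
    then show "(indexed_const (v j) \<otimes>\<^bsub>PR {..<n}\<^esub> indexed_var j \<otimes>\<^bsub>PR {..<n}\<^esub> q) u = v j \<otimes> indexed_pmult q j u"
      by (simp add: mult_const[OF vc pm])
  qed (use vc qc in \<open>auto simp: indexed_pmult_def\<close>)
  finally show ?thesis .
qed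

text \<open>\<open>Sym(R\<^sup>n)\<close> is a polynomial ring in \<open>n\<close> variables: the inverse sends the variable \<open>j\<close>
  to the class of the standard basis vector \<open>d j\<close>.\<close>

lemma sym_ideal_coord:
  assumes q: "q \<in> carrier (PR (carrier (coord_module n)))"
    and 0: "poly_eval R (PR {..<n}) indexed_const (linear_form n) q = \<zero>\<^bsub>PR {..<n}\<^esub>"
  shows "q \<in> sym_ideal R (coord_module n)"
proof -
  let ?F = "coord_module n" let ?Q = "PR (carrier ?F)" let ?J = "sym_ideal R ?F"
  let ?ev = "poly_eval R (PR {..<n}) indexed_const (linear_form n)"
  interpret F: module R ?F by (rule coord_module)
  interpret Q: cring ?Q by (rule poly_ring_cring)
  interpret T: cring "PR {..<n}" by (rule poly_ring_cring)
  interpret S: cring "sym_algebra R ?F" by (rule sym_cring[OF coord_module])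
  interpret J: ideal ?J ?Q by (rule sym_ideal_ideal[OF coord_module])
  interpret l: semilinear_map R ?F "PR {..<n}" indexed_const "linear_form n" by (rule linear_form_semilinear)
  define \<pi> where "\<pi> = (\<lambda>p. ?J +>\<^bsub>?Q\<^esub> p)"
  have \<pi>: "\<pi> \<in> ring_hom ?Q (sym_algebra R ?F)"
    using J.rcos_ring_hom by (simp add: \<pi>_def sym_algebra_def)
  interpret \<pi>: ring_hom_cring ?Q "sym_algebra R ?F" \<pi>
    by (intro ring_hom_cringI ring_hom_ringI2 Q.ring_axioms S.ring_axioms \<pi> S.is_cring poly_ring_cring)
  have \<pi>eq: "\<pi> a = \<pi> b" if "a \<in> carrier ?Q" "b \<in> carrier ?Q" "a \<ominus>\<^bsub>?Q\<^esub> b \<in> ?J" for a b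
    using that Q.quotient_eq_iff_same_a_r_cos[OF J.ideal_axioms, of a b] by (simp add: \<pi>_def)
  have rels: "sym_rels ?F \<subseteq> ?J"
    unfolding sym_ideal_rels by (rule Q.genideal_self[OF sym_rels_closed[OF coord_module]])
  \<comment> \<open>Taking the class of a variable is linear by the relations in \<open>?J\<close>,
    so it can be applied to an expansion in basis vectors.\<close>
  interpret v: semilinear_map R ?F "sym_algebra R ?F" "\<lambda>k. \<pi> (indexed_const k)" "\<lambda>x. \<pi> (indexed_var x)"
  proof (intro semilinear_map.intro coord_module semilinear_map_axioms.intro ring_hom_cringI ring_hom_ringI2)
    show "(\<lambda>k. \<pi> (indexed_const k)) \<in> ring_hom R (sym_algebra R ?F)"
      using ring_hom_trans[OF const_ring_hom \<pi>] by (simp add: comp_def)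
    fix x assume x: "x \<in> carrier ?F"
    then show "\<pi> (indexed_var x) \<in> carrier (sym_algebra R ?F)" by (simp add: indexed_var_closed)
    {
      fix y assume y: "y \<in> carrier ?F"
      have "\<pi> (indexed_var (x \<oplus>\<^bsub>?F\<^esub> y)) = \<pi> (indexed_var x \<oplus>\<^bsub>?Q\<^esub> indexed_var y)"
        using x y by (intro \<pi>eq subsetD[OF rels]) (auto simp: sym_rels_def indexed_var_closed)
      then show "\<pi> (indexed_var (x \<oplus>\<^bsub>?F\<^esub> y)) = \<pi> (indexed_var x) \<oplus>\<^bsub>sym_algebra R ?F\<^esub> \<pi> (indexed_var y)"
        using x y by (simp add: indexed_var_closed)
    }
    fix a assume a: "a \<in> carrier R"
    have "\<pi> (indexed_var (a \<odot>\<^bsub>?F\<^esub> x)) = \<pi> (indexed_const a \<otimes>\<^bsub>?Q\<^esub> indexed_var x)"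
      using x a by (intro \<pi>eq subsetD[OF rels]) (auto simp: sym_rels_def indexed_var_closed indexed_const_closed)
    then show "\<pi> (indexed_var (a \<odot>\<^bsub>?F\<^esub> x)) = \<pi> (indexed_const a) \<otimes>\<^bsub>sym_algebra R ?F\<^esub> \<pi> (indexed_var x)"
      using x a by (simp add: indexed_var_closed indexed_const_closed)
  qed (auto simp: ring_axioms S.ring_axioms S.is_cring is_cring)
  \<comment> \<open>The inner test turns \<open>d j\<close> into the zero vector for
    \<open>j \<ge> n\<close>, where a unit vector would leave \<open>coord_module n\<close>.\<close>
  define d where "d = (\<lambda>j i :: nat. if i = j then if j < n then \<one> else \<zero> else \<zero>)"
  have d: "d \<in> {..<n} \<rightarrow> carrier ?F" by (auto simp: d_def coord_module_def)
  have dd: "v = (\<Oplus>\<^bsub>?F\<^esub>j\<in>{..<n}. v j \<odot>\<^bsub>?F\<^esub> d j)" if v: "v \<in> carrier ?F" for v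
  proof -
    have "(\<Oplus>\<^bsub>?F\<^esub>j\<in>{..<n}. v j \<odot>\<^bsub>?F\<^esub> d j) = (\<lambda>i. \<Oplus>j\<in>{..<n}. (v j \<odot>\<^bsub>?F\<^esub> d j) i)"
      using d coord_carrierD[OF v] by (intro coord_finsum) auto
    also have "\<dots> = v"
    proof
      fix i
      have "(\<Oplus>j\<in>{..<n}. (v j \<odot>\<^bsub>?F\<^esub> d j) i) = (\<Oplus>j\<in>{..<n}. if i = j then v j else \<zero>)"
        using coord_carrierD[OF v] by (intro finsum_cong') (auto simp: coord_module_def, auto simp: d_def)
      also have "\<dots> = v i"
      proof (cases "i < n")
        case True
        then show ?thesis using coord_carrierD[OF v] by (subst add.finprod_singleton[where f = v]) auto
      next
        case False
        then have "(\<Oplus>j\<in>{..<n}. if i = j then v j else \<zero>) = (\<Oplus>j\<in>{..<n}. \<zero>)"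
          by (intro finsum_cong') auto
        then show ?thesis using False v by (simp add: coord_module_def)
      qed
      finally show "(\<Oplus>j\<in>{..<n}. (v j \<odot>\<^bsub>?F\<^esub> d j) i) = v i" .
    qed
    finally show ?thesis by simp
  qed
  interpret r: ring_hom_cring "PR {..<n}" ?Q "poly_rename R d"
    by (intro ring_hom_cringI ring_hom_ringI2 Q.ring_axioms T.ring_axioms rename_ring_hom d Q.is_cring T.is_cring)
  define h where "h = \<pi> \<circ> poly_rename R d"
  have h: "h \<in> ring_hom (PR {..<n}) (sym_algebra R ?F)"
    unfolding h_def by (rule ring_hom_trans[OF rename_ring_hom[OF d] \<pi>])
  interpret h: ring_hom_cring "PR {..<n}" "sym_algebra R ?F" h
    by (intro ring_hom_cringI ring_hom_ringI2 S.ring_axioms T.ring_axioms h S.is_cring T.is_cring)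
  \<comment> \<open>So \<open>h\<close> is a left inverse of the map induced by \<open>?ev\<close>
    on \<open>Sym(R^n)\<close>, and \<open>?ev q = 0\<close> forces the class of \<open>q\<close> to
    vanish.\<close>
  have "(h \<circ> ?ev) q = \<pi> q"
  proof (rule poly_hom_unique[OF S.ring_axioms ring_hom_trans[OF l.ev.eval_ring_hom h] \<pi> _ _ q])
    fix k assume "k \<in> carrier R"
    then show "(h \<circ> ?ev) (indexed_const k) = \<pi> (indexed_const k)"
      by (simp add: l.ev.eval_const h_def rename_const)
  next
    fix v assume v: "v \<in> carrier ?F"
    have "(h \<circ> ?ev) (indexed_var v) = h (linear_form n v)"
      using v by (simp add: l.ev.eval_var)
    also have "\<dots> = (\<Oplus>\<^bsub>sym_algebra R ?F\<^esub>j\<in>{..<n}. h (indexed_const (v j) \<otimes>\<^bsub>PR {..<n}\<^esub> indexed_var j))"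
      unfolding linear_form_def using coord_carrierD[OF v]
      by (subst h.hom_finsum) (auto simp: indexed_const_closed indexed_var_closed comp_def)
    also have "\<dots> = (\<Oplus>\<^bsub>sym_algebra R ?F\<^esub>j\<in>{..<n}. \<pi> (indexed_const (v j)) \<otimes>\<^bsub>sym_algebra R ?F\<^esub> \<pi> (indexed_var (d j)))"
      using coord_carrierD[OF v] d
      by (intro S.finsum_cong') (auto simp: indexed_const_closed indexed_var_closed h_def rename_const rename_var Pi_iff)
    also have "\<dots> = \<pi> (indexed_var (\<Oplus>\<^bsub>?F\<^esub>j\<in>{..<n}. v j \<odot>\<^bsub>?F\<^esub> d j))"
      using coord_carrierD[OF v] d by (intro v.finsum_smult[symmetric]) auto
    finally show "(h \<circ> ?ev) (indexed_var v) = \<pi> (indexed_var v)" using dd[OF v] by simp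
  qed
  then have "\<pi> q = \<pi> \<zero>\<^bsub>?Q\<^esub>" using 0 by simp
  then have "q \<ominus>\<^bsub>?Q\<^esub> \<zero>\<^bsub>?Q\<^esub> \<in> ?J"
    using Q.quotient_eq_iff_same_a_r_cos[OF J.ideal_axioms q Q.zero_closed] by (simp add: \<pi>_def)
  then show ?thesis using q by (simp add: a_minus_def)
qed

end

section \<open>Maps from \<open>M\<close> to free modules in coordinates\<close>

context cring begin

lemma poly_eval_rename:
  assumes "poly_evaluation R A J s a" and f: "f \<in> I \<rightarrow> J" and p: "p \<in> carrier (PR I)"
  shows "poly_eval R A s a (poly_rename R f p) = poly_eval R A s (\<lambda>i. a (f i)) p"
proof -
  interpret a: poly_evaluation R A J s a by fact
  interpret b: poly_evaluation R A I s "\<lambda>i. a (f i)"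
    using f a.a by unfold_locales (auto simp: a.\<sigma>)
  have "(poly_eval R A s a \<circ> poly_rename R f) p = poly_eval R A s (\<lambda>i. a (f i)) p"
  proof (rule poly_hom_unique[OF a.A.ring_axioms ring_hom_trans[OF rename_ring_hom[OF f] a.eval_ring_hom] b.eval_ring_hom _ _ p])
    fix i assume i: "i \<in> I"
    then show "(poly_eval R A s a \<circ> poly_rename R f) (indexed_var i) = poly_eval R A s (\<lambda>i. a (f i)) (indexed_var i)"
      using f b.eval_var[OF i] a.eval_var[of "f i"] by (auto simp: rename_var)
  qed (simp add: rename_const a.eval_const b.eval_const)
  then show ?thesis by simp
qed

text \<open>For a linear \<open>\<phi>\<close> this is \<open>Sym(\<phi>)\<close> lifted to
  polynomials, with \<open>Sym(R^n)\<close> read as a polynomial ring.\<close>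

abbreviation coord_eval :: "nat \<Rightarrow> ('m \<Rightarrow> nat \<Rightarrow> 'a) \<Rightarrow> ('m multiset \<Rightarrow> 'a) \<Rightarrow> nat multiset \<Rightarrow> 'a"
  where "coord_eval n \<phi> \<equiv> poly_eval R (PR {..<n}) indexed_const (\<lambda>x. linear_form n (\<phi> x))"

lemma coord_eval_semilinear:
  assumes M: "module R M" and \<phi>: "\<phi> \<in> mod_hom R M (coord_module n)"
  shows "semilinear_map R M (PR {..<n}) indexed_const (\<lambda>x. linear_form n (\<phi> x))"
proof -
  interpret l: semilinear_map R "coord_module n" "PR {..<n}" indexed_const "linear_form n"
    by (rule linear_form_semilinear)
  note D = mod_homD[OF \<phi>]
  show ?thesis
    by (intro semilinear_map.intro M const_ring_hom_cring semilinear_map_axioms.intro)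
      (simp_all add: D(2-4) l.closed l.add l.smult)
qed

lemma mod_hom_zero:
  assumes "module R M" "module R N" "f \<in> mod_hom R M N"
  shows "f \<zero>\<^bsub>M\<^esub> = \<zero>\<^bsub>N\<^esub>"
proof -
  interpret M: module R M by fact
  interpret N: module R N by fact
  show ?thesis using mod_homD(4)[OF assms(3), of \<zero> "\<zero>\<^bsub>M\<^esub>"] mod_homD(2)[OF assms(3), of "\<zero>\<^bsub>M\<^esub>"] by simp
qed

lemma sym_kernel_iff:
  assumes M: "module R M" and N: "module R N" and g: "g \<in> mod_hom R M N"
    and w: "w \<in> carrier (PR (carrier M))"
  shows "sym_ideal R M +>\<^bsub>PR (carrier M)\<^esub> w \<in> sym_kernel R M N g \<longleftrightarrow> poly_rename R g w \<in> sym_ideal R N"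
proof -
  interpret IM: ideal "sym_ideal R M" "PR (carrier M)" by (rule sym_ideal_ideal[OF M])
  interpret IN: ideal "sym_ideal R N" "PR (carrier N)" by (rule sym_ideal_ideal[OF N])
  have rw: "poly_rename R g w \<in> carrier (PR (carrier N))"
    by (rule rename_closed[OF w mod_homD(1)[OF g]])
  have "sym_ideal R M +>\<^bsub>PR (carrier M)\<^esub> w \<in> carrier (sym_algebra R M)"
    using w by (auto simp: sym_algebra_def FactRing_def intro!: IM.a_rcosetsI IM.a_subset)
  then have "sym_ideal R M +>\<^bsub>PR (carrier M)\<^esub> w \<in> sym_kernel R M N g
      \<longleftrightarrow> sym_ideal R N +>\<^bsub>PR (carrier N)\<^esub> poly_rename R g w = sym_ideal R N"
    unfolding sym_kernel_def a_kernel_def' using sym_map_props(1)[OF M N g w]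
    by (simp add: sym_algebra_def[of R N] FactRing_def)
  also have "\<dots> \<longleftrightarrow> poly_rename R g w \<in> sym_ideal R N"
    using rw IN.rcos_const_imp_mem IN.a_rcos_const by blast
  finally show ?thesis .
qed

text \<open>The images of finitely many generators involve finitely many basis elements of
  \<open>G\<close>. Projecting to these coordinates loses nothing on the image of \<open>g\<close>,
  so neither the kernel of \<open>g\<close> nor that of \<open>Sym(g)\<close> changes.\<close>

lemma free_map_coordinates:
  assumes M: "module R M" and fg: "finitely_generated_module R M"
    and G: "free_module R G" and g: "g \<in> mod_hom R M G"
  obtains n \<phi> where "\<phi> \<in> mod_hom R M (coord_module n)"
    "\<And>x. x \<in> carrier M \<Longrightarrow> \<phi> x = \<zero>\<^bsub>coord_module n\<^esub> \<longleftrightarrow> g x = \<zero>\<^bsub>G\<^esub>"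
    "\<And>w. w \<in> carrier (PR (carrier M)) \<Longrightarrow>
      sym_ideal R M +>\<^bsub>PR (carrier M)\<^esub> w \<in> sym_kernel R M G g \<longleftrightarrow> coord_eval n \<phi> w = \<zero>\<^bsub>PR {..<n}\<^esub>"
proof -
  from G have mG: "module R G" by (simp add: free_module_def)
  interpret M: module R M by fact
  interpret G: module R G by fact
  obtain S where S: "S \<subseteq> carrier M" "finite S" and gen: "\<And>N. submodule N R M \<Longrightarrow> S \<subseteq> N \<Longrightarrow> N = carrier M"
    using fg unfolding finitely_generated_module_def by blast
  obtain n pr sc where pr: "pr \<in> mod_hom R G (coord_module n)" and sc: "sc \<in> mod_hom R (coord_module n) G"
    and scpr_S: "\<And>x. x \<in> S \<Longrightarrow> sc (pr (g x)) = g x"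
    by (rule factor_through_coord_module[OF G g S(2,1)]) (rule that)
  let ?F = "coord_module n"
  interpret F: module R ?F by (rule coord_module)
  note D = mod_homD[OF g] mod_homD[OF pr] mod_homD[OF sc]
  note z = mod_hom_zero[OF M mG g] mod_hom_zero[OF mG coord_module pr] mod_hom_zero[OF coord_module mG sc]
  \<comment> \<open>The elements on which \<open>sc\<close> undoes \<open>pr\<close> form a
    submodule; as it contains the generators, it is all of \<open>M\<close>.\<close>
  define N where "N = {x \<in> carrier M. sc (pr (g x)) = g x}"
  have "submodule N R M"
  proof (rule M.submoduleI)
    fix x assume "x \<in> N"
    then have x: "x \<in> carrier M" "sc (pr (g x)) = g x" by (auto simp: N_def)
    have "\<ominus>\<^bsub>M\<^esub> x = (\<ominus> \<one>) \<odot>\<^bsub>M\<^esub> x" using x by (simp add: M.smult_l_minus)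
    then show "\<ominus>\<^bsub>M\<^esub> x \<in> N" using x by (simp add: N_def D)
  qed (auto simp: N_def D z)
  moreover have "S \<subseteq> N" using S scpr_S by (auto simp: N_def)
  ultimately have "N = carrier M" by (rule gen)
  then have scpr: "sc (pr (g x)) = g x" if "x \<in> carrier M" for x
    using that unfolding N_def by blast
  define \<phi> where "\<phi> = pr \<circ> g"
  have \<phi>: "\<phi> \<in> mod_hom R M ?F" unfolding \<phi>_def by (rule mod_hom_compose[OF g pr])
  have ker: "\<phi> x = \<zero>\<^bsub>?F\<^esub> \<longleftrightarrow> g x = \<zero>\<^bsub>G\<^esub>" if "x \<in> carrier M" for x
    using scpr[OF that] z by (auto simp: \<phi>_def)
  interpret l: semilinear_map R ?F "PR {..<n}" indexed_const "linear_form n" by (rule linear_form_semilinear)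
  have "sym_ideal R M +>\<^bsub>PR (carrier M)\<^esub> w \<in> sym_kernel R M G g \<longleftrightarrow> coord_eval n \<phi> w = \<zero>\<^bsub>PR {..<n}\<^esub>"
    if w: "w \<in> carrier (PR (carrier M))" for w
  proof -
    have rw: "poly_rename R g w \<in> carrier (PR (carrier G))" "poly_rename R \<phi> w \<in> carrier (PR (carrier ?F))"
      using w mod_homD(1)[OF \<phi>] D(1) by (auto intro!: rename_closed)
    have ev: "coord_eval n \<phi> w = poly_eval R (PR {..<n}) indexed_const (linear_form n) (poly_rename R \<phi> w)"
      by (rule poly_eval_rename[OF l.ev.poly_evaluation_axioms mod_homD(1)[OF \<phi>] w, symmetric])
    have "sym_ideal R M +>\<^bsub>PR (carrier M)\<^esub> w \<in> sym_kernel R M G g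
        \<longleftrightarrow> poly_rename R g w \<in> sym_ideal R G"
      by (rule sym_kernel_iff[OF M mG g w])
    \<comment> \<open>Renaming along \<open>pr\<close> carries the relations of \<open>G\<close> to
      those of \<open>R^n\<close>, and renaming along \<open>sc\<close> carries them back.\<close>
    also have "\<dots> \<longleftrightarrow> coord_eval n \<phi> w = \<zero>\<^bsub>PR {..<n}\<^esub>"
    proof
      assume "poly_rename R g w \<in> sym_ideal R G"
      then have "poly_rename R pr (poly_rename R g w) \<in> sym_ideal R ?F"
        by (rule rename_sym_ideal[OF mG coord_module pr])
      also have "poly_rename R pr (poly_rename R g w) = poly_rename R \<phi> w"
        using D(1) by (intro rename_comp_on[OF w]) (auto simp: \<phi>_def)
      finally show "coord_eval n \<phi> w = \<zero>\<^bsub>PR {..<n}\<^esub>" unfolding ev by (rule l.eval_sym_ideal)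
    next
      assume "coord_eval n \<phi> w = \<zero>\<^bsub>PR {..<n}\<^esub>"
      then have "poly_rename R \<phi> w \<in> sym_ideal R ?F" unfolding ev by (rule sym_ideal_coord[OF rw(2)])
      then have "poly_rename R sc (poly_rename R \<phi> w) \<in> sym_ideal R G"
        by (rule rename_sym_ideal[OF coord_module mG sc])
      also have "poly_rename R sc (poly_rename R \<phi> w) = poly_rename R g w"
        using mod_homD(1)[OF \<phi>] scpr by (intro rename_comp_on[OF w]) (auto simp: \<phi>_def)
      finally show "poly_rename R g w \<in> sym_ideal R G" .
    qed
    finally show ?thesis .
  qed
  then show ?thesis using that[OF \<phi> ker] by blast
qed

text \<open>If \<open>d \<psi>\<close> agrees modulo \<open>P\<close> with a map \<open>\<theta>\<close> that factors through \<open>\<phi>\<close>, then the values of \<open>w\<close> at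
  \<open>\<theta>\<close> and at \<open>\<psi>\<close> differ modulo \<open>P\<close> by the factor \<open>d\<^sup>k\<close> in degree \<open>k\<close>, so no splitting of \<open>w\<close> into
  homogeneous parts is needed.\<close>

lemma coord_eval_mod_prime:
  assumes P: "primeideal P R" and M: "module R M"
    and \<phi>: "\<phi> \<in> mod_hom R M (coord_module n)" and \<psi>: "\<psi> \<in> mod_hom R M (coord_module m)"
    and ker: "\<And>x k. x \<in> carrier M \<Longrightarrow> (\<And>j. j < n \<Longrightarrow> \<phi> x j \<in> P) \<Longrightarrow> \<psi> x k \<in> P"
    and w: "w \<in> carrier (PR (carrier M))" and 0: "coord_eval n \<phi> w = \<zero>\<^bsub>PR {..<n}\<^esub>"
  shows "coord_eval m \<psi> w u \<in> P"
proof -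
  interpret M: module R M by fact
  interpret P: primeideal P R by fact
  note D\<phi> = mod_homD[OF \<phi>] and D\<psi> = mod_homD[OF \<psi>]
  have c\<phi>: "\<phi> x j \<in> carrier R" if "x \<in> carrier M" for x j by (rule coord_carrierD[OF D\<phi>(2)[OF that]])
  have c\<psi>: "\<psi> x j \<in> carrier R" if "x \<in> carrier M" for x j by (rule coord_carrierD[OF D\<psi>(2)[OF that]])
  \<comment> \<open>The pairs of coordinate vectors play the role of a vector space with two
    families of functionals.\<close>
  define N where "N = (\<lambda>x. (\<phi> x, \<psi> x)) ` carrier M"
  have "\<exists>d e. d \<in> carrier R - P \<and> (\<forall>j k. e j k \<in> carrier R) \<and>
    (\<forall>f h k. (f, h) \<in> N \<longrightarrow> d \<otimes> h k \<ominus> (\<Oplus>j\<in>{..<n}. f j \<otimes> e j k) \<in> P)"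
  proof (rule functionals_span_mod_prime[OF P])
    fix a b f h f' h' assume a: "a \<in> carrier R" "b \<in> carrier R" and "(f, h) \<in> N" "(f', h') \<in> N"
    then obtain x y where x: "x \<in> carrier M" "f = \<phi> x" "h = \<psi> x" and y: "y \<in> carrier M" "f' = \<phi> y" "h' = \<psi> y"
      by (auto simp: N_def)
    have "(\<lambda>i. a \<otimes> f i \<oplus> b \<otimes> f' i, \<lambda>k. a \<otimes> h k \<oplus> b \<otimes> h' k)
      = (\<phi> (a \<odot>\<^bsub>M\<^esub> x \<oplus>\<^bsub>M\<^esub> b \<odot>\<^bsub>M\<^esub> y), \<psi> (a \<odot>\<^bsub>M\<^esub> x \<oplus>\<^bsub>M\<^esub> b \<odot>\<^bsub>M\<^esub> y))"
      using a x y by (simp add: D\<phi> D\<psi>, simp add: coord_module_def)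
    then show "(\<lambda>i. a \<otimes> f i \<oplus> b \<otimes> f' i, \<lambda>k. a \<otimes> h k \<oplus> b \<otimes> h' k) \<in> N"
      unfolding N_def using a x y by (intro image_eqI[of _ _ "a \<odot>\<^bsub>M\<^esub> x \<oplus>\<^bsub>M\<^esub> b \<odot>\<^bsub>M\<^esub> y"]) auto
  next
    fix f h k assume "(f, h) \<in> N" and f: "\<And>j. j < n \<Longrightarrow> f j \<in> P"
    then obtain x where "x \<in> carrier M" "f = \<phi> x" "h = \<psi> x" by (auto simp: N_def)
    then show "h k \<in> P" using ker f by blast
  next
    show "f i \<in> carrier R" "h i \<in> carrier R" if "(f, h) \<in> N" for f h i
      using that c\<phi> c\<psi> by (auto simp: N_def)
  qed
  then obtain d e where d: "d \<in> carrier R" "d \<notin> P" and e: "\<And>j k. e j k \<in> carrier R"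
    and deN: "\<And>f h k. (f, h) \<in> N \<Longrightarrow> d \<otimes> h k \<ominus> (\<Oplus>j\<in>{..<n}. f j \<otimes> e j k) \<in> P"
    by blast
  have de: "d \<otimes> \<psi> x k \<ominus> (\<Oplus>j\<in>{..<n}. \<phi> x j \<otimes> e j k) \<in> P" if "x \<in> carrier M" for x k
    using that by (intro deN) (auto simp: N_def)
  \<comment> \<open>Vectors in \<open>coord_module m\<close> vanish from index \<open>m\<close> on,
    so the coefficients are cut off there.\<close>
  define e' where "e' = (\<lambda>j k. if k < m then e j k else \<zero>)"
  have e': "e' j \<in> carrier (coord_module m)" for j using e by (simp add: e'_def coord_module_def)
  define \<theta> where "\<theta> = (\<lambda>x. \<Oplus>\<^bsub>coord_module m\<^esub>j\<in>{..<n}. \<phi> x j \<odot>\<^bsub>coord_module m\<^esub> e' j)"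
  interpret F: module R "coord_module m" by (rule coord_module)
  have \<theta>c: "\<theta> x \<in> carrier (coord_module m)" if "x \<in> carrier M" for x
    unfolding \<theta>_def using e' c\<phi>[OF that] by (intro F.finsum_closed) auto
  have \<theta>: "\<theta> x k = (\<Oplus>j\<in>{..<n}. \<phi> x j \<otimes> e j k)" if x: "x \<in> carrier M" and k: "k < m" for x k
  proof -
    have "\<theta> x k = (\<Oplus>j\<in>{..<n}. (\<phi> x j \<odot>\<^bsub>coord_module m\<^esub> e' j) k)"
      unfolding \<theta>_def using e' c\<phi>[OF x] by (subst coord_finsum) auto
    also have "\<dots> = (\<Oplus>j\<in>{..<n}. \<phi> x j \<otimes> e j k)"
      using c\<phi>[OF x] e k by (intro finsum_cong') (auto simp: coord_module_def, auto simp: e'_def)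
    finally show ?thesis .
  qed
  have Q0: "\<zero>\<^bsub>R Quot P\<^esub> = P" by (simp add: FactRing_def)
  interpret Q: ring_hom_cring R "R Quot P" "(+>) P"
    by (rule P.rcos_ring_hom_cring)
  let ?\<rho> = "(+>) P"
  have \<rho>: "?\<rho> (\<theta> x k) = ?\<rho> d \<otimes>\<^bsub>R Quot P\<^esub> ?\<rho> (\<psi> x k)" if x: "x \<in> carrier M" and k: "k < m" for x k
  proof -
    have "?\<rho> (d \<otimes> \<psi> x k) = ?\<rho> (\<theta> x k)"
      using de[OF x, of k, folded \<theta>[OF x k]] d c\<psi>[OF x] coord_carrierD[OF \<theta>c[OF x]]
      by (subst quotient_eq_iff_same_a_r_cos[symmetric, OF P.ideal_axioms]) auto
    then show ?thesis using d c\<psi>[OF x] by simp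
  qed
  interpret lm: semilinear_map R "coord_module m" "PR {..<m}" indexed_const "linear_form m"
    by (rule linear_form_semilinear)
  interpret T: poly_evaluation R "PR {..<m}" "{..<n}" indexed_const "\<lambda>j. linear_form m (e' j)"
    by unfold_locales (auto simp: const_ring_hom intro: lm.closed e')
  \<comment> \<open>Substituting the linear form of \<open>e' j\<close> for variable
    \<open>j\<close> realises on polynomials the factorisation of \<open>\<theta>\<close> through
    \<open>\<phi>\<close>.\<close>
  let ?\<Theta> = "poly_eval R (PR {..<m}) indexed_const (\<lambda>j. linear_form m (e' j)) :: (nat multiset \<Rightarrow> 'a) \<Rightarrow> _"
  interpret \<Theta>: ring_hom_cring "PR {..<n}" "PR {..<m}" ?\<Theta>
    by (intro ring_hom_cringI ring_hom_ringI2 cring.axioms(1) poly_ring_cring T.eval_ring_hom)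
  interpret ev\<phi>: semilinear_map R M "PR {..<n}" indexed_const "\<lambda>x. linear_form n (\<phi> x)"
    by (rule coord_eval_semilinear[OF M \<phi>])
  interpret ev\<psi>: semilinear_map R M "PR {..<m}" indexed_const "\<lambda>x. linear_form m (\<psi> x)"
    by (rule coord_eval_semilinear[OF M \<psi>])
  have \<Theta>lin: "?\<Theta> (linear_form n (\<phi> x)) = linear_form m (\<theta> x)" if x: "x \<in> carrier M" for x
  proof -
    have "?\<Theta> (linear_form n (\<phi> x)) = (\<Oplus>\<^bsub>PR {..<m}\<^esub>j\<in>{..<n}. ?\<Theta> (indexed_const (\<phi> x j) \<otimes>\<^bsub>PR {..<n}\<^esub> indexed_var j))"
      unfolding linear_form_def[of n] using c\<phi>[OF x]
      by (subst \<Theta>.hom_finsum) (auto simp: indexed_const_closed indexed_var_closed comp_def)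
    also have "\<dots> = (\<Oplus>\<^bsub>PR {..<m}\<^esub>j\<in>{..<n}. indexed_const (\<phi> x j) \<otimes>\<^bsub>PR {..<m}\<^esub> linear_form m (e' j))"
      using c\<phi>[OF x] e' lm.closed
      by (intro lm.\<sigma>.S.finsum_cong') (auto simp: indexed_const_closed indexed_var_closed T.eval_const T.eval_var)
    also have "\<dots> = linear_form m (\<theta> x)"
      unfolding \<theta>_def using c\<phi>[OF x] e' by (intro lm.finsum_smult[symmetric]) auto
    finally show ?thesis .
  qed
  \<comment> \<open>The exponent \<open>size u\<close> is the degree of the monomial, as each
    variable of \<open>w\<close> contributes one factor \<open>d\<close>. All \<open>u\<close> are
    treated at once because the variable step refers to smaller monomials.\<close>
  have scale: "?\<rho> (?\<Theta> (coord_eval n \<phi> w) u) = ?\<rho> d [^]\<^bsub>R Quot P\<^esub> size u \<otimes>\<^bsub>R Quot P\<^esub> ?\<rho> (coord_eval m \<psi> w u)" for u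
    using w
  proof (induction arbitrary: u rule: poly_ring_induct)
    case (const k)
    then show ?case
      using d by (simp add: ev\<phi>.ev.eval_const ev\<psi>.ev.eval_const T.eval_const, simp add: indexed_const_def)
  next
    case (add p q)
    have "coord_eval n \<phi> p \<in> carrier (PR {..<n})" "coord_eval n \<phi> q \<in> carrier (PR {..<n})"
      "coord_eval m \<psi> p \<in> carrier (PR {..<m})" "coord_eval m \<psi> q \<in> carrier (PR {..<m})"
      using add by (auto intro: ev\<phi>.ev.eval_closed ev\<psi>.ev.eval_closed)
    then show ?case
      using add d pcoeff[OF T.eval_closed[of "coord_eval n \<phi> p"], of u] pcoeff[OF T.eval_closed[of "coord_eval n \<phi> q"], of u]
        pcoeff[of "coord_eval m \<psi> p" "{..<m}" u] pcoeff[of "coord_eval m \<psi> q" "{..<m}" u]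
      by (simp add: ev\<phi>.ev.eval_add ev\<psi>.ev.eval_add T.eval_add,
          simp add: poly_ring_simps(4) indexed_padd_def Q.S.r_distr)
  next
    case (mult p x)
    define q1 where "q1 = ?\<Theta> (coord_eval n \<phi> p)"
    define q2 where "q2 = coord_eval m \<psi> p"
    have q1: "q1 \<in> carrier (PR {..<m})" and q2: "q2 \<in> carrier (PR {..<m})"
      using mult by (auto simp: q1_def q2_def intro: ev\<phi>.ev.eval_closed ev\<psi>.ev.eval_closed T.eval_closed)
    note c1 = pcoeff[OF q1] and c2 = pcoeff[OF q2]
    have pm: "indexed_pmult q1 k u \<in> carrier R" "indexed_pmult q2 k u \<in> carrier R" for k
      using c1 c2 by (auto simp: indexed_pmult_def)
    note x = \<open>x \<in> carrier M\<close>
    note tc = coord_carrierD[OF \<theta>c[OF x]]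
    have IH: "?\<rho> (q1 v) = ?\<rho> d [^]\<^bsub>R Quot P\<^esub> size v \<otimes>\<^bsub>R Quot P\<^esub> ?\<rho> (q2 v)" for v
      unfolding q1_def q2_def by (rule mult.IH)
    have "?\<Theta> (coord_eval n \<phi> (indexed_var x \<otimes>\<^bsub>PR (carrier M)\<^esub> p)) = linear_form m (\<theta> x) \<otimes>\<^bsub>PR {..<m}\<^esub> q1"
      using mult by (simp add: ev\<phi>.ev.eval_var_mult ev\<phi>.ev.eval_closed ev\<phi>.closed \<Theta>lin q1_def)
    then have "?\<rho> (?\<Theta> (coord_eval n \<phi> (indexed_var x \<otimes>\<^bsub>PR (carrier M)\<^esub> p)) u)
      = ?\<rho> (\<Oplus>k\<in>{..<m}. \<theta> x k \<otimes> indexed_pmult q1 k u)"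
      by (simp only: linear_form_mult_coeff[OF \<theta>c[OF x] q1])
    also have "\<dots> = (\<Oplus>\<^bsub>R Quot P\<^esub>k\<in>{..<m}. ?\<rho> (\<theta> x k \<otimes> indexed_pmult q1 k u))"
      using tc pm by (subst Q.hom_finsum) (auto simp: comp_def)
    also have "\<dots> = (\<Oplus>\<^bsub>R Quot P\<^esub>k\<in>{..<m}. ?\<rho> d [^]\<^bsub>R Quot P\<^esub> size u \<otimes>\<^bsub>R Quot P\<^esub> ?\<rho> (\<psi> x k \<otimes> indexed_pmult q2 k u))"
    proof (intro Q.S.finsum_cong')
      fix k assume k: "k \<in> {..<m}"
      show "?\<rho> (\<theta> x k \<otimes> indexed_pmult q1 k u) = ?\<rho> d [^]\<^bsub>R Quot P\<^esub> size u \<otimes>\<^bsub>R Quot P\<^esub> ?\<rho> (\<psi> x k \<otimes> indexed_pmult q2 k u)"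
      proof (cases "k \<in># u")
        case True
        then obtain v where v: "u = add_mset k v" by (meson multi_member_split)
        \<comment> \<open>Removing \<open>k\<close> from \<open>u\<close> lowers the degree by one;
          the missing factor \<open>d\<close> comes from comparing \<open>\<theta>\<close> with
          \<open>\<psi>\<close>.\<close>
        have "?\<rho> (\<theta> x k \<otimes> q1 v) = (?\<rho> d \<otimes>\<^bsub>R Quot P\<^esub> ?\<rho> (\<psi> x k)) \<otimes>\<^bsub>R Quot P\<^esub> (?\<rho> d [^]\<^bsub>R Quot P\<^esub> size v \<otimes>\<^bsub>R Quot P\<^esub> ?\<rho> (q2 v))"
          using tc c1 \<rho>[OF x, of k] k IH[of v] by simp
        then show ?thesis using c\<psi>[OF x] c2 d by (simp add: v indexed_pmult_def Q.S.m_ac)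
      next
        case False
        then show ?thesis using tc c\<psi>[OF x] d by (simp add: indexed_pmult_def)
      qed
    qed (use d c\<psi>[OF x] pm in auto)
    also have "\<dots> = ?\<rho> d [^]\<^bsub>R Quot P\<^esub> size u \<otimes>\<^bsub>R Quot P\<^esub> (\<Oplus>\<^bsub>R Quot P\<^esub>k\<in>{..<m}. ?\<rho> (\<psi> x k \<otimes> indexed_pmult q2 k u))"
      using d c\<psi>[OF x] pm by (intro Q.S.finsum_rdistr[symmetric]) auto
    also have "(\<Oplus>\<^bsub>R Quot P\<^esub>k\<in>{..<m}. ?\<rho> (\<psi> x k \<otimes> indexed_pmult q2 k u)) = ?\<rho> (\<Oplus>k\<in>{..<m}. \<psi> x k \<otimes> indexed_pmult q2 k u)"
      using c\<psi>[OF x] pm by (subst Q.hom_finsum) (auto simp: comp_def)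
    also have "(\<Oplus>k\<in>{..<m}. \<psi> x k \<otimes> indexed_pmult q2 k u) = (linear_form m (\<psi> x) \<otimes>\<^bsub>PR {..<m}\<^esub> q2) u"
      by (rule linear_form_mult_coeff[OF D\<psi>(2)[OF x] q2, symmetric])
    also have "linear_form m (\<psi> x) \<otimes>\<^bsub>PR {..<m}\<^esub> q2 = coord_eval m \<psi> (indexed_var x \<otimes>\<^bsub>PR (carrier M)\<^esub> p)"
      using mult by (simp add: ev\<psi>.ev.eval_var_mult q2_def)
    finally show ?case .
  qed
  let ?c = "coord_eval m \<psi> w u"
  have c: "?c \<in> carrier R" by (rule pcoeff[OF ev\<psi>.ev.eval_closed[OF w]])
  have \<Theta>0: "?\<Theta> (coord_eval n \<phi> w) u = \<zero>"
    unfolding 0 by (simp, simp add: poly_ring_simps indexed_const_def)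
  \<comment> \<open>The left side of \<open>scale\<close> vanishes along with
    \<open>coord_eval n \<phi> w\<close>. Powers of \<open>d\<close> avoid the prime
    \<open>P\<close> and can be cancelled.\<close>
  have "?\<rho> (d [^] size u \<otimes> ?c) = ?\<rho> d [^]\<^bsub>R Quot P\<^esub> size u \<otimes>\<^bsub>R Quot P\<^esub> ?\<rho> ?c"
    by (simp only: Q.hom_mult[OF nat_pow_closed[OF d(1)] c] ring_hom_ring.hom_nat_pow[OF P.rcos_ring_hom_ring d(1)])
  also have "\<dots> = ?\<rho> \<zero>" by (simp only: scale[symmetric] \<Theta>0)
  also have "\<dots> = \<zero>\<^bsub>R Quot P\<^esub>" by (rule Q.hom_zero)
  finally have "?\<rho> (d [^] size u \<otimes> ?c) = P" unfolding Q0 .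
  then have "d [^] size u \<otimes> ?c \<in> P"
    by (rule P.rcos_const_imp_mem[OF m_closed[OF nat_pow_closed[OF d(1)] c]])
  moreover have "d [^] k \<notin> P" for k :: nat
  proof (induction k)
    case 0
    have "\<one> \<notin> P" using P.I_notcarr P.one_imp_carrier by blast
    then show ?case by simp
  next
    case (Suc k)
    then show ?case using P.I_prime[OF nat_pow_closed[OF d(1)] d(1), of k] d(2) by auto
  qed
  ultimately show ?thesis using P.I_prime[OF nat_pow_closed[OF d(1)] c] by blast
qed

end

section \<open>The kernel of the natural map\<close>

context cring begin

text \<open>By injectivity on the torsionless quotient, \<open>x\<close> dies in the double dual, so
  every functional on \<open>M\<close> kills it, in particular each coordinate of
  \<open>\<psi>\<close>.\<close>

lemma torsionless_functional_vanishes: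
  assumes M: "module R M" and G: "module R G" and g: "g \<in> mod_hom R M G"
    and incl: "induces_inclusion_on_torsionless_quotient R M G g"
    and \<psi>: "\<psi> \<in> mod_hom R M (coord_module m)" and x: "x \<in> carrier M" and gx: "g x = \<zero>\<^bsub>G\<^esub>"
  shows "\<psi> x k = \<zero>"
proof -
  interpret M: module R M by fact
  obtain g' where g': "\<And>y. y \<in> carrier M \<Longrightarrow> g' (to_bidual R M y) = g y"
    and inj: "inj_on g' (carrier (torsionless_quotient R M))"
    using incl unfolding induces_inclusion_on_torsionless_quotient_def by blast
  have tc: "to_bidual R M y \<in> carrier (torsionless_quotient R M)" if "y \<in> carrier M" for y
    using that by (simp add: torsionless_quotient_def)
  have "g' (to_bidual R M x) = g' (to_bidual R M \<zero>\<^bsub>M\<^esub>)"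
    using g' x gx mod_hom_zero[OF M G g] by simp
  then have eq: "to_bidual R M x = to_bidual R M \<zero>\<^bsub>M\<^esub>"
    using inj_onD[OF inj] tc x by simp
  \<comment> \<open>The restriction to \<open>carrier M\<close> is needed because elements of
    \<open>dual_module\<close> are extensional.\<close>
  define l where "l = (\<lambda>y\<in>carrier M. \<psi> y k)"
  have "l \<in> carrier (dual_module R M)"
    using mod_homD[OF \<psi>] coord_carrierD[OF mod_homD(2)[OF \<psi>]]
    by (simp add: dual_module_def mod_hom_def l_def, simp add: coord_module_def)
  then have "l x = l \<zero>\<^bsub>M\<^esub>" using fun_cong[OF eq, of l] by (simp add: to_bidual_def)
  then show ?thesis using x mod_hom_zero[OF M coord_module \<psi>]
    by (simp add: l_def, simp add: coord_module_def)
qed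

text \<open>Nilpotency is tested at prime annihilators. Multiplying by \<open>c\<close> turns
  membership in \<open>ann c\<close> into vanishing, to which the hypothesis on the torsionless
  quotient applies.\<close>

lemma coord_eval_nilpotent:
  assumes N: "noetherian_ring R" and M: "module R M" and fg: "finitely_generated_module R M"
    and G: "free_module R G" and g: "g \<in> mod_hom R M G"
    and incl: "induces_inclusion_on_torsionless_quotient R M G g"
    and \<psi>: "\<psi> \<in> mod_hom R M (coord_module m)"
    and w: "w \<in> carrier (PR (carrier M))"
    and ker: "sym_ideal R M +>\<^bsub>PR (carrier M)\<^esub> w \<in> sym_kernel R M G g"
  shows "\<exists>k::nat. coord_eval m \<psi> w u [^] k = \<zero>"
proof -
  from G have mG: "module R G" by (simp add: free_module_def)
  interpret M: module R M by fact
  obtain n \<phi> where \<phi>: "\<phi> \<in> mod_hom R M (coord_module n)"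
    and \<phi>g: "\<And>x. x \<in> carrier M \<Longrightarrow> \<phi> x = \<zero>\<^bsub>coord_module n\<^esub> \<longleftrightarrow> g x = \<zero>\<^bsub>G\<^esub>"
    and iff: "\<And>w. w \<in> carrier (PR (carrier M)) \<Longrightarrow>
      sym_ideal R M +>\<^bsub>PR (carrier M)\<^esub> w \<in> sym_kernel R M G g \<longleftrightarrow> coord_eval n \<phi> w = \<zero>\<^bsub>PR {..<n}\<^esub>"
    by (rule free_map_coordinates[OF M fg G g]) (rule that)
  have 0: "coord_eval n \<phi> w = \<zero>\<^bsub>PR {..<n}\<^esub>" using iff[OF w] ker by simp
  interpret ev\<psi>: semilinear_map R M "PR {..<m}" indexed_const "\<lambda>x. linear_form m (\<psi> x)"
    by (rule coord_eval_semilinear[OF M \<psi>])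
  have "coord_eval m \<psi> w u \<in> ann c" if c: "c \<in> carrier R" and P: "primeideal (ann c) R" for c
  proof (rule coord_eval_mod_prime[OF P M \<phi> \<psi> _ w 0])
    fix x k assume x: "x \<in> carrier M" and "\<And>j. j < n \<Longrightarrow> \<phi> x j \<in> ann c"
    \<comment> \<open>From index \<open>n\<close> on, the coordinates of \<open>\<phi> x\<close> are
      zero anyway.\<close>
    then have "\<phi> x j \<otimes> c = \<zero>" for j
      using c mod_homD(2)[OF \<phi> x] by (cases "j < n") (auto simp: ann_def coord_module_def)
    then have "c \<otimes> \<phi> x j = \<zero>" for j
      using c coord_carrierD[OF mod_homD(2)[OF \<phi> x]] by (simp add: m_comm)
    then have "\<phi> (c \<odot>\<^bsub>M\<^esub> x) = \<zero>\<^bsub>coord_module n\<^esub>"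
      using c x by (simp add: mod_homD(4)[OF \<phi>], simp add: coord_module_def)
    then have "g (c \<odot>\<^bsub>M\<^esub> x) = \<zero>\<^bsub>G\<^esub>" using \<phi>g c x by simp
    then have "\<psi> (c \<odot>\<^bsub>M\<^esub> x) k = \<zero>"
      using c x by (intro torsionless_functional_vanishes[OF M mG g incl \<psi>]) auto
    then have "c \<otimes> \<psi> x k = \<zero>"
      using c x by (simp add: mod_homD(4)[OF \<psi>], simp add: coord_module_def)
    then show "\<psi> x k \<in> ann c"
      using c coord_carrierD[OF mod_homD(2)[OF \<psi> x]] by (simp add: ann_def m_comm)
  qed
  then show ?thesis
    using nilpotent_if_in_prime_annihilators[OF N pcoeff[OF ev\<psi>.ev.eval_closed[OF w]]] by blast
qed

text \<open>Since \<open>R^m\<close> is among the free modules whose kernels are intersected in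
  \<open>rees_ideal\<close>, the coordinate evaluation passes through both quotients.\<close>

lemma rees_algebra_coord_hom:
  assumes M: "module R M" and \<psi>: "\<psi> \<in> mod_hom R M (coord_module m)"
  obtains f where "f \<in> ring_hom (rees_algebra R M) (PR {..<m})"
    "\<And>w. w \<in> carrier (PR (carrier M)) \<Longrightarrow>
      f (rees_ideal R M +>\<^bsub>sym_algebra R M\<^esub> (sym_ideal R M +>\<^bsub>PR (carrier M)\<^esub> w)) = coord_eval m \<psi> w"
proof -
  let ?T = "PR {..<m}"
  interpret T: cring ?T by (rule poly_ring_cring)
  interpret IM: ideal "sym_ideal R M" "PR (carrier M)" by (rule sym_ideal_ideal[OF M])
  interpret l: semilinear_map R "coord_module m" ?T indexed_const "linear_form m" by (rule linear_form_semilinear)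
  interpret ev: semilinear_map R M ?T indexed_const "\<lambda>x. linear_form m (\<psi> x)"
    by (rule coord_eval_semilinear[OF M \<psi>])
  define f1 where "f1 = (\<lambda>C. the_elem (coord_eval m \<psi> ` C))"
  note q1 = quotient_induced_map[OF sym_ideal_ideal[OF M] T.ring_axioms ev.ev.eval_ring_hom ev.eval_sym_ideal]
  have f1: "f1 (sym_ideal R M +>\<^bsub>PR (carrier M)\<^esub> w) = coord_eval m \<psi> w" if "w \<in> carrier (PR (carrier M))" for w
    unfolding f1_def by (rule q1(1)[OF _ that])
  have f1_hom: "f1 \<in> ring_hom (sym_algebra R M) ?T"
    unfolding f1_def sym_algebra_def by (rule q1(2))
  have kill: "f1 C = \<zero>\<^bsub>?T\<^esub>" if C: "C \<in> rees_ideal R M" for C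
  proof -
    have CK: "C \<in> sym_kernel R M (coord_module m) \<psi>"
      using C coord_module_free[of m] \<psi> unfolding rees_ideal_def by blast
    then have "C \<in> carrier (sym_algebra R M)" by (simp add: sym_kernel_def a_kernel_def')
    then obtain w where w: "w \<in> carrier (PR (carrier M))" "C = sym_ideal R M +>\<^bsub>PR (carrier M)\<^esub> w"
      by (rule sym_carrierE)
    have "poly_rename R \<psi> w \<in> sym_ideal R (coord_module m)"
      using CK sym_kernel_iff[OF M coord_module \<psi> w(1)] w(2) by simp
    then have "poly_eval R ?T indexed_const (linear_form m) (poly_rename R \<psi> w) = \<zero>\<^bsub>?T\<^esub>"
      by (rule l.eval_sym_ideal)
    then show ?thesis
      using poly_eval_rename[OF l.ev.poly_evaluation_axioms mod_homD(1)[OF \<psi>] w(1)] f1[OF w(1)] w(2) by simp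
  qed
  define f where "f = (\<lambda>D. the_elem (f1 ` D))"
  note q2 = quotient_induced_map[OF rees_ideal_ideal[OF M] T.ring_axioms f1_hom kill]
  show thesis
  proof (rule that[of f])
    show "f \<in> ring_hom (rees_algebra R M) ?T" unfolding f_def rees_algebra_def by (rule q2(2))
    fix w assume w: "w \<in> carrier (PR (carrier M))"
    have "sym_ideal R M +>\<^bsub>PR (carrier M)\<^esub> w \<in> carrier (sym_algebra R M)"
      using w by (auto simp: sym_algebra_def FactRing_def intro!: IM.a_rcosetsI IM.a_subset)
    then show "f (rees_ideal R M +>\<^bsub>sym_algebra R M\<^esub> (sym_ideal R M +>\<^bsub>PR (carrier M)\<^esub> w)) = coord_eval m \<psi> w"
      unfolding f_def using q2(1) f1[OF w] by simp
  qed
qed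

lemma rees_carrierE:
  assumes "z \<in> carrier (rees_algebra R M)"
  obtains w where "w \<in> carrier (PR (carrier M))"
    "z = rees_ideal R M +>\<^bsub>sym_algebra R M\<^esub> (sym_ideal R M +>\<^bsub>PR (carrier M)\<^esub> w)"
proof -
  obtain C where "C \<in> carrier (sym_algebra R M)" "z = rees_ideal R M +>\<^bsub>sym_algebra R M\<^esub> C"
    using assms by (auto simp: rees_algebra_def FactRing_def A_RCOSETS_def')
  then show ?thesis using that by (metis sym_carrierE)
qed

text \<open>For finitely generated \<open>M\<close>, every map to a free module has the same
  \<open>Sym\<close>-kernel as some map to an \<open>R^m\<close>, by
  \<open>free_map_coordinates\<close>; so only these need testing.\<close>

lemma rees_ideal_memI:
  assumes M: "module R M" and fg: "finitely_generated_module R M" and w: "w \<in> carrier (PR (carrier M))"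
    and 0: "\<And>m \<psi>. \<psi> \<in> mod_hom R M (coord_module m) \<Longrightarrow> coord_eval m \<psi> w = \<zero>\<^bsub>PR {..<m}\<^esub>"
  shows "sym_ideal R M +>\<^bsub>PR (carrier M)\<^esub> w \<in> rees_ideal R M"
  unfolding rees_ideal_def
proof (intro InterI)
  fix K assume "K \<in> {sym_kernel R M F h | (F :: ('a, nat \<Rightarrow> 'a) module) h. free_module R F \<and> h \<in> mod_hom R M F}"
  then obtain F :: "('a, nat \<Rightarrow> 'a) module" and h
    where K: "K = sym_kernel R M F h" and F: "free_module R F" and h: "h \<in> mod_hom R M F" by blast
  obtain m \<psi> where \<psi>: "\<psi> \<in> mod_hom R M (coord_module m)"
    and "\<And>x. x \<in> carrier M \<Longrightarrow> \<psi> x = \<zero>\<^bsub>coord_module m\<^esub> \<longleftrightarrow> h x = \<zero>\<^bsub>F\<^esub>"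
    and iff: "\<And>w. w \<in> carrier (PR (carrier M)) \<Longrightarrow>
      sym_ideal R M +>\<^bsub>PR (carrier M)\<^esub> w \<in> sym_kernel R M F h \<longleftrightarrow> coord_eval m \<psi> w = \<zero>\<^bsub>PR {..<m}\<^esub>"
    by (rule free_map_coordinates[OF M fg F h]) (rule that)
  show "sym_ideal R M +>\<^bsub>PR (carrier M)\<^esub> w \<in> K" using iff[OF w] 0[OF \<psi>] K by simp
qed

end

theorem proposition1p8:
  fixes R :: "('r, 'x) ring_scheme"
    and M :: "('r, 'm, 'y) module_scheme"
    and G :: "('r, 'n, 'z) module_scheme"
    and g :: "'m \<Rightarrow> 'n"
  assumes "cring R" and "noetherian_ring R"
    and "module R M" and "finitely_generated_module R M"
    and "free_module R G"
    and "g \<in> mod_hom R M G"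
    and "induces_inclusion_on_torsionless_quotient R M G g"
  shows "nilpotent_ideal (rees_algebra R M)
           (a_kernel (rees_algebra R M) (rees_algebra_of_map R M G g) (rees_natural_map R G g))"
proof -
  interpret R: cring R by fact
  note M = assms(3) and fg = assms(4) and G = assms(5) and g = assms(6)
  note epi = R.rees_natural_map_epi[OF M G g]
  let ?J = "sym_ideal R M" let ?L = "rees_ideal R M" let ?P = "poly_ring R (carrier M)"
  interpret B: cring "rees_algebra R M" by (rule epi(1))
  interpret S: cring "sym_algebra R M" by (rule R.sym_cring[OF M])
  interpret J: ideal ?J ?P by (rule R.sym_ideal_ideal[OF M])
  interpret L: ideal ?L "sym_algebra R M" by (rule R.rees_ideal_ideal[OF M])
  interpret nat: ring_hom_ring "rees_algebra R M" "rees_algebra_of_map R M G g" "rees_natural_map R G g"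
    by (intro ring_hom_ringI2 B.ring_axioms cring.axioms(1)[OF epi(2)] epi(3))
  define K where "K = a_kernel (rees_algebra R M) (rees_algebra_of_map R M G g) (rees_natural_map R G g)"
  have K: "ideal K (rees_algebra R M)" unfolding K_def by (rule nat.kernel_is_ideal)
  \<comment> \<open>One exponent \<open>n\<close> for all nilpotent elements of \<open>R\<close>;
    the power \<open>n\<close> of the kernel is shown to be zero.\<close>
  obtain I n where I: "ideal I R" and In: "I [^]\<^bsub>ideals_set R\<^esub> (n::nat) = {\<zero>\<^bsub>R\<^esub>}"
    and nil: "\<And>a k. a \<in> carrier R \<Longrightarrow> a [^]\<^bsub>R\<^esub> (k::nat) = \<zero>\<^bsub>R\<^esub> \<Longrightarrow> a \<in> I"
    by (rule R.exists_nilpotent_ideal[OF assms(2)]) (rule that)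
  note pow = R.ideal_power_ideal[OF I]
  have Sc: "?J +>\<^bsub>?P\<^esub> w \<in> carrier (sym_algebra R M)" if "w \<in> carrier ?P" for w
    using that by (auto simp: sym_algebra_def FactRing_def intro!: J.a_rcosetsI J.a_subset)
  have "z = \<zero>\<^bsub>rees_algebra R M\<^esub>" if z: "z \<in> K [^]\<^bsub>ideals_set (rees_algebra R M)\<^esub> n" for z
  proof -
    obtain w where w: "w \<in> carrier ?P" and zw: "z = ?L +>\<^bsub>sym_algebra R M\<^esub> (?J +>\<^bsub>?P\<^esub> w)"
      by (rule R.rees_carrierE[OF ideal.Icarr[OF B.ideal_power_ideal[OF K] z]]) (rule that)
    have "?J +>\<^bsub>?P\<^esub> w \<in> ?L"
    proof (rule R.rees_ideal_memI[OF M fg w])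
      fix m \<psi> assume \<psi>: "\<psi> \<in> mod_hom R M (R.coord_module m)"
      let ?T = "poly_ring R {..<m}"
      interpret T: cring ?T by (rule R.poly_ring_cring)
      obtain f where f: "f \<in> ring_hom (rees_algebra R M) ?T"
        and fw: "\<And>w. w \<in> carrier ?P \<Longrightarrow> f (?L +>\<^bsub>sym_algebra R M\<^esub> (?J +>\<^bsub>?P\<^esub> w)) = R.coord_eval m \<psi> w"
        by (rule R.rees_algebra_coord_hom[OF M \<psi>]) (rule that)
      \<comment> \<open>Lifting \<open>y\<close> to a polynomial \<open>v\<close> makes
        \<open>f y\<close> a coordinate evaluation, whose coefficients are nilpotent and therefore
        lie in \<open>I\<close>.\<close>
      have fK: "f y u \<in> I" if y: "y \<in> K" for y u
      proof -
        obtain v where v: "v \<in> carrier ?P" and yv: "y = ?L +>\<^bsub>sym_algebra R M\<^esub> (?J +>\<^bsub>?P\<^esub> v)"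
          by (rule R.rees_carrierE[OF ideal.Icarr[OF K y]]) (rule that)
        have "sym_map R G g (?J +>\<^bsub>?P\<^esub> v) = rees_natural_map R G g y"
          unfolding yv by (rule epi(5)[OF Sc[OF v], symmetric])
        also have "\<dots> = \<zero>\<^bsub>rees_algebra_of_map R M G g\<^esub>"
          using y unfolding K_def a_kernel_def' by blast
        also have "\<dots> = \<zero>\<^bsub>sym_algebra R G\<^esub>" by (simp add: rees_algebra_of_map_def)
        finally have "?J +>\<^bsub>?P\<^esub> v \<in> sym_kernel R M G g"
          using Sc[OF v] unfolding sym_kernel_def a_kernel_def' by blast
        then have "\<exists>k::nat. f y u [^]\<^bsub>R\<^esub> k = \<zero>\<^bsub>R\<^esub>"
          unfolding yv fw[OF v] by (rule R.coord_eval_nilpotent[OF assms(2) M fg G g assms(7) \<psi> v])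
        moreover have "f y u \<in> carrier R"
          using R.pcoeff ring_hom_closed[OF f ideal.Icarr[OF K y]] by blast
        ultimately show ?thesis using nil by blast
      qed
      \<comment> \<open>The filtration is by polynomials with coefficients in successive powers of
        \<open>I\<close>; at exponent \<open>n\<close> only the zero polynomial is left.\<close>
      have "f ` (K [^]\<^bsub>ideals_set (rees_algebra R M)\<^esub> n) \<subseteq> {q \<in> carrier ?T. \<forall>u. q u \<in> I [^]\<^bsub>ideals_set R\<^esub> n}"
      proof (rule ideal_power_image_subset[OF B.ring_axioms K f])
        show "f ` carrier (rees_algebra R M) \<subseteq> {q \<in> carrier ?T. \<forall>u. q u \<in> I [^]\<^bsub>ideals_set R\<^esub> (0::nat)}"
          unfolding ideal_power_0 using ring_hom_closed[OF f] R.pcoeff by blast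
      next
        fix k :: nat and x y
        assume "x \<in> {q \<in> carrier ?T. \<forall>u. q u \<in> I [^]\<^bsub>ideals_set R\<^esub> k}"
          "y \<in> {q \<in> carrier ?T. \<forall>u. q u \<in> I [^]\<^bsub>ideals_set R\<^esub> k}"
        then show "x \<oplus>\<^bsub>?T\<^esub> y \<in> {q \<in> carrier ?T. \<forall>u. q u \<in> I [^]\<^bsub>ideals_set R\<^esub> k}"
          using additive_subgroup.a_closed[OF ideal.axioms(1)[OF pow]] T.a_closed[of x y]
          by (simp, simp add: R.poly_ring_simps(4) R.indexed_padd_def)
      next
        fix k :: nat and x y
        assume x: "x \<in> {q \<in> carrier ?T. \<forall>u. q u \<in> I [^]\<^bsub>ideals_set R\<^esub> k}" and y: "y \<in> K"
        \<comment> \<open>Each coefficient of a product is a finite sum of products of an element of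
          \<open>I^k\<close> with one of \<open>I\<close>.\<close>
        have "(x \<otimes>\<^bsub>?T\<^esub> f y) u \<in> I [^]\<^bsub>ideals_set R\<^esub> Suc k" for u
          unfolding R.poly_ring_mult ideal_power_Suc using x fK[OF y]
          by (intro ideal.finsum_mem[OF pow[of "Suc k", unfolded ideal_power_Suc]] R.finite_submsets)
            (auto intro: ideal_prod.prod)
        then show "x \<otimes>\<^bsub>?T\<^esub> f y \<in> {q \<in> carrier ?T. \<forall>u. q u \<in> I [^]\<^bsub>ideals_set R\<^esub> Suc k}"
          using x ring_hom_closed[OF f ideal.Icarr[OF K y]] by simp
      qed
      then have "\<forall>u. f z u = \<zero>\<^bsub>R\<^esub>" using z unfolding In by blast
      then show "R.coord_eval m \<psi> w = \<zero>\<^bsub>?T\<^esub>"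
        using fw[OF w] zw by (auto simp: R.poly_ring_simps R.indexed_const_def fun_eq_iff)
    qed
    then show ?thesis unfolding zw by (simp add: L.a_rcos_const rees_algebra_def FactRing_def)
  qed
  moreover have "\<zero>\<^bsub>rees_algebra R M\<^esub> \<in> K [^]\<^bsub>ideals_set (rees_algebra R M)\<^esub> n"
    by (rule additive_subgroup.zero_closed[OF ideal.axioms(1)[OF B.ideal_power_ideal[OF K]]])
  ultimately have "K [^]\<^bsub>ideals_set (rees_algebra R M)\<^esub> n = {\<zero>\<^bsub>rees_algebra R M\<^esub>}" by blast
  then show ?thesis unfolding nilpotent_ideal_def K_def by blast
qed

end
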